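(* There exists a nonempty (Zariski-)open set $U\subset\mathfrak m$ such that for any $x\in U$ there is $g\in B$ satisfying $\mathrm{Ad}_g x\in\mathcal X$, where $$\mathcal X=\Big\{\sum_{\psi\in\Psi}c_\psi E_\psi+\sum_{\xi\in(S\cup\Phi)\setminus\Psi}E_\xi\ :\ c_\psi\in K,\ c_\psi\neq0\ \text{for all }\psi\in\Psi\Big\}.$$
   Context: Setting. $K$ is an algebraically closed field of characteristic zero, $G=\mathrm{GL}(n,K)$, $B$ is the subgroup of upper triangular matrices. $P\supset B$ is a parabolic subgroup of block upper triangular matrices with diagonal blocks of sizes $(r_1,\dots,r_u)$, $r_1+\dots+r_u=n$; put $R_k=r_1+\dots+r_k$, $R_0=0$. The Lie algebra of $P$ is $\mathfrak p=\mathfrak r\oplus\mathfrak m$, with $\mathfrak r$ the block diagonal subalgebra and $\mathfrak m$ the nilradical (strictly block upper triangular matrices). $P$ (hence $B$) acts on $\mathfrak m$ by $\mathrm{Ad}_g x=gxg^{-1}$. Roots. A positive root $\varepsilon_i-\varepsilon_j$ ($1\le i<j\le n$) is identified with the pair $(i,j)$; $\Delta^+$ is the set of all positive roots; $E_{(i,j)}=E_{i,j}$ is the matrix unit. $\Delta^+_{\mathfrak r}$ is the set of $(i,j)$, $i<j$, with $i,j$ in the same diagonal block; $M=\Delta^+\setminus\Delta^+_{\mathfrak r}$ is the set of roots of $\mathfrak m$. For roots write $\gamma'>\gamma$ if $\gamma'-\gamma\in\Delta^+$ (not an order relation); $\gamma,\gamma'$ are comparable if $\gamma'>\gamma$ or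 $\gamma>\gamma'$. Base. The base $S$ is the unique subset $S\subset M$ whose elements are pairwise non-comparable and such that for each $\gamma\in M\setminus S$ there is $\xi\in S$ with $\gamma>\xi$. The set $\Phi$. An admissible pair is $q=(\xi,\xi')$ with $\xi=(i,j)\in S$, $\xi'=(k,l)\in S$ and $\alpha_q:=(j,k)\in\Delta^+_{\mathfrak r}$. Put $\varphi_q=\alpha_q+\xi'=(j,l)$ and $\Phi=\{\varphi_q\}$ over all admissible pairs $q$. The set $\Psi=\Psi_1\sqcup\Psi_2$. $\Psi_1$ is the set of $\psi=(i,b)\in\Phi$ for which there exist $j>i$ and $a<b$ such that $(i,a)$, $(j,a)$, $(j,b)$ all lie in $S\cup\Phi$. $\Psi_2$ is the set of $\psi\in\Phi$ of the form $\psi=(R_{t-1}+k,R_t+1)$ with $1\le k<r_t$ for which there is $s<t$ such that at least $k$ roots of $\Phi$ have the form $(R_{s-1}+1,j)$. *)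

theory Defs
  imports
    "HOL-Computational_Algebra.Polynomial"
    "Jordan_Normal_Form.Matrix"
begin

text \<open>
  Block sizes \<open>(r\<^sub>1, \<dots>, r\<^sub>u)\<close> are given by a list \<open>r\<close>, so \<open>u = length r\<close> and
  \<open>r\<^sub>t = r ! (t - 1)\<close>.  Rows, columns, roots and blocks are numbered from 1, whereas matrix
  entries \<open>A $$ (i, j)\<close> are numbered from 0; the shift occurs in \<open>nilradical\<close> and
  \<open>E_root\<close> only.
\<close>

definition R :: "nat list \<Rightarrow> nat \<Rightarrow> nat" where
  "R r k = sum_list (take k r)"

definition block :: "nat list \<Rightarrow> nat \<Rightarrow> nat set" where
  "block r t = {R r (t - 1) <.. R r t}"

type_synonym root = "nat \<times> nat"

text \<open>The pair \<open>(i, j)\<close> stands for the vector \<open>\<epsilon>\<^sub>i - \<epsilon>\<^sub>j\<close>.\<close>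

definition root_vec :: "root \<Rightarrow> nat \<Rightarrow> int" where
  "root_vec \<gamma> m = of_bool (m = fst \<gamma>) - of_bool (m = snd \<gamma>)"

definition pos_roots :: "nat \<Rightarrow> root set" where
  "pos_roots n = {(i, j). 1 \<le> i \<and> i < j \<and> j \<le> n}"

definition levi_roots :: "nat list \<Rightarrow> root set" where
  "levi_roots r = {(i, j) \<in> pos_roots (sum_list r).
     \<exists>t\<in>{1..length r}. i \<in> block r t \<and> j \<in> block r t}"

definition M_roots :: "nat list \<Rightarrow> root set" where
  "M_roots r = pos_roots (sum_list r) - levi_roots r"

definition root_gt :: "nat \<Rightarrow> root \<Rightarrow> root \<Rightarrow> bool" where
  "root_gt n \<gamma>' \<gamma> \<longleftrightarrow>
     (\<exists>\<beta>\<in>pos_roots n. \<forall>m. root_vec \<gamma>' m - root_vec \<gamma> m = root_vec \<beta> m)"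

definition comparable :: "nat \<Rightarrow> root \<Rightarrow> root \<Rightarrow> bool" where
  "comparable n \<gamma> \<gamma>' \<longleftrightarrow> root_gt n \<gamma>' \<gamma> \<or> root_gt n \<gamma> \<gamma>'"

definition is_base :: "nat list \<Rightarrow> root set \<Rightarrow> bool" where
  "is_base r S \<longleftrightarrow> S \<subseteq> M_roots r
     \<and> (\<forall>\<xi>\<in>S. \<forall>\<xi>'\<in>S. \<xi> \<noteq> \<xi>' \<longrightarrow> \<not> comparable (sum_list r) \<xi> \<xi>')
     \<and> (\<forall>\<gamma>\<in>M_roots r - S. \<exists>\<xi>\<in>S. root_gt (sum_list r) \<gamma> \<xi>)"

definition base :: "nat list \<Rightarrow> root set" where
  "base r = (THE S. is_base r S)"

text \<open>The base is well defined: it is the kernel of a finite acyclic relation.\<close>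

definition height :: "root \<Rightarrow> int" where
  "height \<gamma> = int (snd \<gamma>) - int (fst \<gamma>)"

lemma sum_root_vec:
  assumes "\<gamma> \<in> pos_roots n"
  shows "(\<Sum>m=1..n. int m * root_vec \<gamma> m) = - height \<gamma>"
proof -
  obtain i j where g: "\<gamma> = (i, j)" by (cases \<gamma>)
  have ij: "i \<in> {1..n}" "j \<in> {1..n}" using assms by (auto simp: pos_roots_def g)
  have "(\<Sum>m=1..n. int m * root_vec \<gamma> m)
      = (\<Sum>m=1..n. (if m = i then int m else 0) - (if m = j then int m else 0))"
    by (rule sum.cong) (auto simp: root_vec_def g)
  also have "\<dots> = int i - int j"
    using ij by (simp add: sum_subtractf)
  finally show ?thesis by (simp add: height_def g)
qed

lemma root_gt_height:
  assumes "root_gt n \<gamma>' \<gamma>" "\<gamma>' \<in> pos_roots n" "\<gamma> \<in> pos_roots n"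
  shows "height \<gamma> < height \<gamma>'"
proof -
  obtain \<beta> where b: "\<beta> \<in> pos_roots n"
    and e: "\<And>m. root_vec \<gamma>' m - root_vec \<gamma> m = root_vec \<beta> m"
    using assms(1) by (auto simp: root_gt_def)
  have "- height \<gamma>' - (- height \<gamma>) = (\<Sum>m=1..n. int m * root_vec \<beta> m)"
    unfolding sum_root_vec[OF assms(2), symmetric] sum_root_vec[OF assms(3), symmetric]
    by (simp add: e[symmetric] sum_subtractf right_diff_distrib)
  also have "\<dots> = - height \<beta>" by (rule sum_root_vec[OF b])
  finally have "height \<gamma>' = height \<gamma> + height \<beta>" by simp
  moreover have "height \<beta> > 0" using b by (auto simp: pos_roots_def height_def)
  ultimately show ?thesis by simp
qed

lemma ex1_base: "\<exists>!S. is_base r S"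
proof -
  let ?M = "M_roots r" and ?gt = "root_gt (sum_list r)"
  have ht: "nat (height \<gamma>) < nat (height \<gamma>')" if "?gt \<gamma>' \<gamma>" "\<gamma>' \<in> ?M" "\<gamma> \<in> ?M" for \<gamma> \<gamma>'
    using root_gt_height[OF that(1)] that(2,3)
    by (auto simp: M_roots_def pos_roots_def height_def)
  have char: "is_base r S \<longleftrightarrow> S \<subseteq> ?M \<and> (\<forall>\<gamma>\<in>?M. \<gamma> \<in> S \<longleftrightarrow> \<not> (\<exists>\<xi>\<in>S. ?gt \<gamma> \<xi>))" for S
  proof (cases "S \<subseteq> ?M")
    case True
    have irrefl: "\<not> ?gt \<xi> \<xi>" if "\<xi> \<in> S" for \<xi>
      using ht[of \<xi> \<xi>] that True by auto
    have "(\<forall>\<xi>\<in>S. \<forall>\<xi>'\<in>S. \<xi> \<noteq> \<xi>' \<longrightarrow> \<not> comparable (sum_list r) \<xi> \<xi>')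
        \<longleftrightarrow> (\<forall>\<gamma>\<in>S. \<forall>\<xi>\<in>S. \<not> ?gt \<gamma> \<xi>)"
      unfolding comparable_def using irrefl by metis
    then show ?thesis
      unfolding is_base_def using True by auto
  qed (simp add: is_base_def)
  define step where "step = (\<lambda>f \<gamma>. \<gamma> \<in> ?M \<and> \<not> (\<exists>\<xi>\<in>?M. f \<xi> \<and> ?gt \<gamma> \<xi>))"
  define Q where "Q = wfrec (measure (\<lambda>\<gamma>. nat (height \<gamma>))) step"
  have Q: "Q \<gamma> \<longleftrightarrow> \<gamma> \<in> ?M \<and> \<not> (\<exists>\<xi>\<in>?M. Q \<xi> \<and> ?gt \<gamma> \<xi>)" for \<gamma>
  proof -
    have "Q \<gamma> = step (cut Q (measure (\<lambda>\<gamma>. nat (height \<gamma>))) \<gamma>) \<gamma>"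
      unfolding Q_def by (rule wfrec) simp
    then show ?thesis
      using ht[of \<gamma>] by (auto simp: step_def cut_def)
  qed
  have "is_base r {\<gamma>. Q \<gamma>}"
    unfolding char using Q by blast
  moreover have "S = S'" if "is_base r S" "is_base r S'" for S S'
  proof -
    have "\<gamma> \<in> ?M \<Longrightarrow> \<gamma> \<in> S \<longleftrightarrow> \<gamma> \<in> S'" for \<gamma>
    proof (induction "nat (height \<gamma>)" arbitrary: \<gamma> rule: less_induct)
      case less
      have "(\<exists>\<xi>\<in>S. ?gt \<gamma> \<xi>) \<longleftrightarrow> (\<exists>\<xi>\<in>S'. ?gt \<gamma> \<xi>)"
        using less.hyps[OF ht] less.prems that unfolding char by (meson subsetD)
      then show ?case using less.prems that unfolding char by metis
    qed
    then show ?thesis using that unfolding char by blast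
  qed
  ultimately show ?thesis by blast
qed

lemma is_base_base: "is_base r (base r)"
  unfolding base_def by (rule theI'[OF ex1_base])

definition Phi :: "nat list \<Rightarrow> root set" where
  "Phi r = {(j, l). \<exists>i k. (i, j) \<in> base r \<and> (k, l) \<in> base r \<and> (j, k) \<in> levi_roots r}"

definition Psi1 :: "nat list \<Rightarrow> root set" where
  "Psi1 r = {(i, b) \<in> Phi r. \<exists>j a. j > i \<and> a < b
     \<and> (i, a) \<in> base r \<union> Phi r \<and> (j, a) \<in> base r \<union> Phi r \<and> (j, b) \<in> base r \<union> Phi r}"

definition Psi2 :: "nat list \<Rightarrow> root set" where
  "Psi2 r = {\<psi> \<in> Phi r. \<exists>t\<in>{1..length r}. \<exists>k. 1 \<le> k \<and> k < r ! (t - 1)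
     \<and> \<psi> = (R r (t - 1) + k, R r t + 1)
     \<and> (\<exists>s. 1 \<le> s \<and> s < t \<and> k \<le> card {\<phi> \<in> Phi r. \<exists>j. \<phi> = (R r (s - 1) + 1, j)})}"

definition Psi :: "nat list \<Rightarrow> root set" where
  "Psi r = Psi1 r \<union> Psi2 r"

definition nilradical :: "nat list \<Rightarrow> 'a::zero mat set" where
  "nilradical r = {x \<in> carrier_mat (sum_list r) (sum_list r).
     \<forall>i<sum_list r. \<forall>j<sum_list r. x $$ (i, j) \<noteq> 0 \<longrightarrow>
       (\<exists>s t. 1 \<le> s \<and> s < t \<and> t \<le> length r \<and> i + 1 \<in> block r s \<and> j + 1 \<in> block r t)}"

definition E_root :: "nat \<Rightarrow> root \<Rightarrow> 'a::zero_neq_one mat" where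
  "E_root n \<gamma> = mat n n (\<lambda>(i, j). if (i + 1, j + 1) = \<gamma> then 1 else 0)"

definition Borel_subgroup :: "nat \<Rightarrow> 'a::field mat set" where
  "Borel_subgroup n = {g \<in> Units (ring_mat TYPE('a) n ()). upper_triangular g}"

definition Ad :: "nat \<Rightarrow> 'a::field mat \<Rightarrow> 'a mat \<Rightarrow> 'a mat" where
  "Ad n g x = g * x * inv\<^bsub>ring_mat TYPE('a) n ()\<^esub> g"

definition canonical_set :: "nat list \<Rightarrow> 'a::field mat set" where
  "canonical_set r = (let n = sum_list r; V = ring_mat TYPE('a) n () in
     {(\<Oplus>\<^bsub>V\<^esub>\<psi>\<in>Psi r. c \<psi> \<cdot>\<^sub>m E_root n \<psi>) \<oplus>\<^bsub>V\<^esub> (\<Oplus>\<^bsub>V\<^esub>\<xi>\<in>(base r \<union> Phi r) - Psi r. E_root n \<xi>)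
       | c :: root \<Rightarrow> 'a. \<forall>\<psi>\<in>Psi r. c \<psi> \<noteq> 0})"

inductive_set poly_funs :: "nat \<Rightarrow> ('a::comm_ring_1 mat \<Rightarrow> 'a) set" for n where
  const: "(\<lambda>_. c) \<in> poly_funs n"
| entry: "i < n \<Longrightarrow> j < n \<Longrightarrow> (\<lambda>x. x $$ (i, j)) \<in> poly_funs n"
| add: "f \<in> poly_funs n \<Longrightarrow> g \<in> poly_funs n \<Longrightarrow> (\<lambda>x. f x + g x) \<in> poly_funs n"
| mult: "f \<in> poly_funs n \<Longrightarrow> g \<in> poly_funs n \<Longrightarrow> (\<lambda>x. f x * g x) \<in> poly_funs n"

text \<open>\<open>U\<close> is open in the subspace \<open>V\<close> of the \<open>n \<times> n\<close> matrices: its complement in \<open>V\<close> is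
  the zero locus in \<open>V\<close> of a set of polynomials.\<close>

definition zariski_open_in :: "nat \<Rightarrow> 'a::comm_ring_1 mat set \<Rightarrow> 'a mat set \<Rightarrow> bool" where
  "zariski_open_in n V U \<longleftrightarrow>
     U \<subseteq> V \<and> (\<exists>F\<subseteq>poly_funs n. V - U = {x \<in> V. \<forall>f\<in>F. f x = 0})"

end

theory Submission
  imports Defs
begin

text \<open>
  Let \<open>S\<close> be the base, and let the matrix \<open>x\<close> in the nilradical be
  built up row by row, from the bottom upwards. Suppose that the rows below \<open>i\<close>
  have been brought by \<open>B\<close> to a matrix \<open>y\<close> whose nonzero entries are
  exactly those in the positions of \<open>S \<union> \<Phi>\<close> that these rows
  contribute, and let \<open>w\<close> be the new row \<open>i\<close> in the corresponding
  coordinates. Row vectors form a module over the polynomials in \<open>y\<close>, which acts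
  from the right. Adding multiples of lower rows to row \<open>i\<close> changes
  \<open>w\<close> by an element of the row space of \<open>y\<close>, and this space is
  spanned by the pivot columns, those of the base roots in lower rows. So only the entries of
  \<open>w\<close> in the remaining, free columns matter. The base is defined greedily: the
  base root of row \<open>i\<close> sits in the leftmost free column \<open>j\<close>, in the
  first block \<open>t\<close> that has any.

  The free columns of the block \<open>t\<close> behind \<open>j\<close> are cleared with the
  column \<open>j\<close>. The row operations that have to accompany this add multiples of the
  rows behind \<open>j\<close> to row \<open>j\<close>, and they fill exactly the new
  positions of \<open>\<Phi>\<close>; the entries there are nonzero if the entries of
  \<open>w\<close> were (\<open>normal_supp_step\<close>). The free columns in later blocks
  must be cleared without changing \<open>y\<close>, hence by a matrix that commutes with
  \<open>y\<close>. Such matrices exist for the following reason. Under the parabolic group,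
  \<open>y\<close> is conjugate to a model, a Richardson element, which is a sum of matrix
  units in the positions \<open>(a, nxt a)\<close>. Its module of row vectors is a direct sum
  of chains, and homomorphisms between chains can be written down: those needed exist because
  chains that start in later blocks have larger labels and are shorter
  (\<open>chain_hom_commutes\<close>). The conjugation to the model is carried along in the
  induction (\<open>normalizes_pivot_row\<close>).

  All matrices that occur are rational functions of \<open>x\<close>. Each step needs finitely
  many rational functions to be nonzero, and the base point can be chosen such that they are
  (\<open>generic_row\<close>). Thus everything works where one polynomial does not vanish
  (\<open>generic_normal_form\<close>), and this is the open set.

  It remains to turn the entries outside \<open>\<Psi>\<close> into 1 by a diagonal matrix.
  This can be done because the graph with edges \<open>(S \<union> \<Phi>) - \<Psi>\<close> on
  the set of indices is a forest (\<open>unit_positions_cut\<close>): removing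
  \<open>\<Psi>\<^sub>1\<close> breaks the cycles inside one block of rows, and removing
  \<open>\<Psi>\<^sub>2\<close> those that close up through several blocks.
\<close>

section \<open>Blocks, free columns and the base\<close>

text \<open>
  Rows, columns and blocks are numbered from 0 below, so the root \<open>(i, j)\<close> sits
  in position \<open>(i - 1, j - 1)\<close>.
\<close>

locale composition =
  fixes r :: "nat list" and n :: nat
  assumes sum_r: "sum_list r = n" and pos_r: "\<forall>m\<in>set r. 0 < m"
begin

definition blk :: "nat \<Rightarrow> nat" where
  "blk i = (LEAST t. i < R r (Suc t))"

text \<open>
  Rows of a block are labelled from the bottom, starting with 1.
\<close>

definition lab :: "nat \<Rightarrow> nat" where
  "lab i = R r (Suc (blk i)) - i"

definition piv_rows :: "nat set" where
  "piv_rows = {i. i < n \<and> (\<exists>s. blk i < s \<and> s < length r \<and> lab i \<le> r ! s)}"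

definition nb :: "nat \<Rightarrow> nat" where
  "nb i = (LEAST s. blk i < s \<and> s < length r \<and> lab i \<le> r ! s)"

text \<open>
  The base is found greedily: from the bottom up, each row takes the leftmost column behind
  its block that is still unused. Block by block this gives a closed form: the
  \<open>k\<close>-th row from the bottom takes the \<open>k\<close>-th column from the left
  in the first later block with at least \<open>k\<close> columns. So \<open>piv_rows\<close>
  is the set of rows that contain a base root, and \<open>piv i\<close> is the column of that
  root.
\<close>

definition piv :: "nat \<Rightarrow> nat" where
  "piv i = R r (nb i) + lab i - 1"

text \<open>
  The same block as for \<open>piv\<close>, but the \<open>k\<close>-th column from the right.
  Now the label is kept, so the iterates of \<open>nxt\<close> form chains of constant label.
  The sum of the matrix units in the positions \<open>(i, nxt i)\<close> lies in the dense
  orbit of \<open>P\<close> on the nilradical (a Richardson element) and serves as a model of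
  a generic matrix.
\<close>

definition nxt :: "nat \<Rightarrow> nat" where
  "nxt i = R r (Suc (nb i)) - lab i"

lemma R_zero: "R r 0 = 0"
  by (simp add: R_def)

lemma R_Suc: "t < length r \<Longrightarrow> R r (Suc t) = R r t + r ! t"
  by (simp add: R_def take_Suc_conv_app_nth)

lemma R_length: "R r (length r) = n"
  by (simp add: R_def sum_r)

lemma R_mono: "s \<le> t \<Longrightarrow> R r s \<le> R r t"
proof -
  assume "s \<le> t"
  then have "take t r = take s r @ take (t - s) (drop s r)"
    by (metis le_add_diff_inverse take_add)
  then show ?thesis by (simp add: R_def)
qed

lemma r_pos: "t < length r \<Longrightarrow> 0 < r ! t"
  using pos_r by auto

lemma R_le_n: "R r t \<le> n"
proof (cases "t \<le> length r")
  case True then show ?thesis using R_mono[OF True] R_length by simp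
next
  case False then show ?thesis by (simp add: R_def sum_r)
qed

lemma blk_bounds:
  assumes "i < n"
  shows "blk i < length r" "R r (blk i) \<le> i" "i < R r (Suc (blk i))"
proof -
  have len: "0 < length r" using assms sum_r by (cases r) auto
  have ex: "i < R r (Suc (length r - 1))" using assms R_length len by simp
  show 1: "i < R r (Suc (blk i))" unfolding blk_def by (rule LeastI, rule ex)
  have "blk i \<le> length r - 1" unfolding blk_def by (rule Least_le, rule ex)
  then show "blk i < length r" using len by linarith
  show "R r (blk i) \<le> i"
  proof (cases "blk i")
    case 0 then show ?thesis by (simp add: R_zero)
  next
    case (Suc t)
    then have "\<not> i < R r (Suc t)"
      using not_less_Least[of t "\<lambda>t. i < R r (Suc t)"] unfolding blk_def by simp
    then show ?thesis using Suc by simp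
  qed
qed

lemma blk_eqI: "R r s \<le> i \<Longrightarrow> i < R r (Suc s) \<Longrightarrow> blk i = s"
proof -
  assume a: "R r s \<le> i" "i < R r (Suc s)"
  show ?thesis unfolding blk_def
  proof (rule Least_equality, rule a(2), rule ccontr)
    fix t assume t: "i < R r (Suc t)" "\<not> s \<le> t"
    then have "R r (Suc t) \<le> R r s" by (intro R_mono) simp
    then show False using t a by simp
  qed
qed

lemma blk_mono: "i \<le> j \<Longrightarrow> j < n \<Longrightarrow> blk i \<le> blk j"
  unfolding blk_def[of i] using blk_bounds(3)[of j] by (intro Least_le) simp

lemma less_if_blk_less: "blk i < blk j \<Longrightarrow> i < n \<Longrightarrow> i < j"
  by (metis blk_mono leD linorder_le_less_linear)

lemma lab_bounds: "i < n \<Longrightarrow> 1 \<le> lab i \<and> lab i \<le> r ! blk i"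
  using blk_bounds[of i] R_Suc[of "blk i"] by (auto simp: lab_def)

lemma index_lab: "i < n \<Longrightarrow> i = R r (Suc (blk i)) - lab i"
  using blk_bounds[of i] by (auto simp: lab_def)

lemma lab_less: "i < k \<Longrightarrow> k < n \<Longrightarrow> blk i = blk k \<Longrightarrow> lab k < lab i"
  using blk_bounds[of k] by (auto simp: lab_def)

lemma blk_lab_inj: "i < n \<Longrightarrow> j < n \<Longrightarrow> blk i = blk j \<Longrightarrow> lab i = lab j \<Longrightarrow> i = j"
  using index_lab by metis

lemma slot_index:
  assumes "s < length r" "1 \<le> k" "k \<le> r ! s"
  shows "R r (Suc s) - k < n" "blk (R r (Suc s) - k) = s" "lab (R r (Suc s) - k) = k"
    "R r s + k - 1 < n" "blk (R r s + k - 1) = s" "lab (R r s + k - 1) = r ! s - k + 1"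
proof -
  note R = R_Suc[OF assms(1)] R_le_n[of "Suc s"]
  show b: "blk (R r (Suc s) - k) = s" by (rule blk_eqI) (use R assms in auto)
  show "R r (Suc s) - k < n" using R assms by auto
  show "lab (R r (Suc s) - k) = k" using R assms b by (auto simp: lab_def)
  show b: "blk (R r s + k - 1) = s" by (rule blk_eqI) (use R assms in auto)
  show "R r s + k - 1 < n" using R assms by auto
  show "lab (R r s + k - 1) = r ! s - k + 1" using R assms b by (auto simp: lab_def)
qed

lemma piv_rows_less: "i \<in> piv_rows \<Longrightarrow> i < n" by (simp add: piv_rows_def)

lemma nb_props:
  assumes "i \<in> piv_rows"
  shows "blk i < nb i" "nb i < length r" "lab i \<le> r ! nb i"
  using LeastI_ex[of "\<lambda>s. blk i < s \<and> s < length r \<and> lab i \<le> r ! s"] assms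
  unfolding nb_def piv_rows_def by auto

lemma nb_le: "blk i < s \<Longrightarrow> s < length r \<Longrightarrow> lab i \<le> r ! s \<Longrightarrow> nb i \<le> s"
  unfolding nb_def by (rule Least_le) auto

lemma piv_rowsI: "i < n \<Longrightarrow> blk i < s \<Longrightarrow> s < length r \<Longrightarrow> lab i \<le> r ! s \<Longrightarrow> i \<in> piv_rows"
  unfolding piv_rows_def by auto

lemma nb_least: "i \<in> piv_rows \<Longrightarrow> blk i < s \<Longrightarrow> s < nb i \<Longrightarrow> r ! s < lab i"
  using nb_le[of i s] nb_props[of i] by (meson leI leD less_trans)

lemma piv_props:
  assumes "i \<in> piv_rows"
  shows "piv i < n" "blk (piv i) = nb i" "i < piv i" "R r (blk (piv i)) + lab i = Suc (piv i)"
proof -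
  note p = nb_props[OF assms] and l = lab_bounds[OF piv_rows_less[OF assms]]
  note s = slot_index[OF p(2) _ p(3)]
  show "piv i < n" "blk (piv i) = nb i" using s(4,5) l by (simp_all add: piv_def)
  then show "i < piv i" using p(1) less_if_blk_less piv_rows_less[OF assms] by simp
  show "R r (blk (piv i)) + lab i = Suc (piv i)"
    using \<open>blk (piv i) = nb i\<close> l by (simp add: piv_def)
qed

lemma nxt_props:
  assumes "i \<in> piv_rows"
  shows "nxt i < n" "blk (nxt i) = nb i" "i < nxt i" "lab (nxt i) = lab i"
proof -
  note p = nb_props[OF assms] and l = lab_bounds[OF piv_rows_less[OF assms]]
  note s = slot_index[OF p(2) _ p(3)]
  show "nxt i < n" "blk (nxt i) = nb i" "lab (nxt i) = lab i" using s(1-3) l by (simp_all add: nxt_def)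
  then show "i < nxt i" using p(1) less_if_blk_less piv_rows_less[OF assms] by simp
qed

lemma slot_inj:
  assumes "i \<in> piv_rows" "k \<in> piv_rows" "nb i = nb k" "lab i = lab k"
  shows "i = k"
proof -
  have "\<not> blk a < blk b" if "a \<in> piv_rows" "b \<in> piv_rows" "nb a = nb b" "lab a = lab b" for a b
    using nb_least[of a "blk b"] nb_props[of b] lab_bounds[of b] piv_rows_less[of b] that by auto
  then have "blk i = blk k" using assms by (metis linorder_neqE_nat)
  then show ?thesis using blk_lab_inj assms piv_rows_less by blast
qed

lemma piv_inj: "i \<in> piv_rows \<Longrightarrow> k \<in> piv_rows \<Longrightarrow> piv i = piv k \<Longrightarrow> i = k"
  using slot_inj piv_props by (metis add_left_cancel)

lemma nxt_inj: "i \<in> piv_rows \<Longrightarrow> k \<in> piv_rows \<Longrightarrow> nxt i = nxt k \<Longrightarrow> i = k"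
  using slot_inj nxt_props by metis

text \<open>
  Position \<open>k\<close> of the block \<open>s\<close> belongs to the last earlier block
  with at least \<open>k\<close> rows: the blocks in between are too small to receive that
  root.
\<close>

lemma slot_source:
  assumes "i < n" "blk i < s" "s < length r" "1 \<le> k" "k \<le> r ! s"
    and "\<exists>s'. blk i \<le> s' \<and> s' < s \<and> k \<le> r ! s' \<and> (s' = blk i \<longrightarrow> k < lab i)"
  shows "\<exists>d. i < d \<and> d \<in> piv_rows \<and> nb d = s \<and> lab d = k"
proof -
  \<comment> \<open>The largest element of this set is the block of the row that is looked for.\<close>
  define A where "A = {s'. blk i \<le> s' \<and> s' < s \<and> k \<le> r ! s' \<and> (s' = blk i \<longrightarrow> k < lab i)}"
  have fin: "finite A" by (rule finite_subset[of _ "{..<s}"]) (auto simp: A_def)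
  have ne: "A \<noteq> {}" using assms(6) by (auto simp: A_def)
  define s' where "s' = Max A"
  have s'A: "s' \<in> A" unfolding s'_def using fin ne by simp
  have max: "\<And>t. t \<in> A \<Longrightarrow> t \<le> s'" unfolding s'_def using fin by simp
  have s': "blk i \<le> s'" "s' < s" "k \<le> r ! s'" "s' = blk i \<Longrightarrow> k < lab i" using s'A by (auto simp: A_def)
  define d where "d = R r (Suc s') - k"
  have d: "d < n" "blk d = s'" "lab d = k"
    using slot_index(1-3)[of s' k] s' assms by (auto simp: d_def)
  have dP: "d \<in> piv_rows" by (rule piv_rowsI[of d s]) (use d s' assms in auto)
  have "nb d = s"
  proof (rule antisym)
    show "nb d \<le> s" by (rule nb_le) (use d s' assms in auto)
    show "s \<le> nb d"
    proof (rule ccontr)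
      assume "\<not> s \<le> nb d"
      then have "nb d \<in> A" using nb_props[OF dP] d s' by (auto simp: A_def)
      then show False using max nb_props(1)[OF dP] d by fastforce
    qed
  qed
  moreover have "i < d"
  proof (cases "s' = blk i")
    case True
    then show ?thesis using d s' assms blk_bounds[of i] by (auto simp: lab_def)
  next
    case False
    then show ?thesis using d s' less_if_blk_less[of i d] assms by simp
  qed
  ultimately show ?thesis using dP d by blast
qed

lemma free_slot:
  assumes "i < n" "blk i < s" "s < length r" "1 \<le> k" "k \<le> r ! s"
    and "\<And>d. i < d \<Longrightarrow> d \<in> piv_rows \<Longrightarrow> nb d = s \<Longrightarrow> lab d = k \<Longrightarrow> False"
  shows "i \<in> piv_rows" "nb i \<le> s" "lab i \<le> k" "nb i < s \<Longrightarrow> r ! nb i < k"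
proof -
  have no: "\<And>s'. blk i \<le> s' \<Longrightarrow> s' < s \<Longrightarrow> k \<le> r ! s' \<Longrightarrow> s' = blk i \<and> lab i \<le> k"
    using slot_source[OF assms(1-5)] assms(6) by (meson leI)
  show l: "lab i \<le> k"
  proof (rule ccontr)
    assume c: "\<not> lab i \<le> k"
    then have "k \<le> r ! blk i" using lab_bounds[OF assms(1)] by simp
    then show False using no[of "blk i"] assms c by simp
  qed
  show i: "i \<in> piv_rows" by (rule piv_rowsI[of i s]) (use assms l in auto)
  show "nb i \<le> s" by (rule nb_le) (use assms l in auto)
  show "r ! nb i < k" if "nb i < s"
  proof (rule ccontr)
    assume "\<not> r ! nb i < k"
    then show False using no[of "nb i"] nb_props(1)[OF i] that by simp
  qed
qed

text \<open>
  The greedy property of \<open>piv\<close>: if the rows below \<open>i\<close> leave a column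
  unused, then row \<open>i\<close> contains a base root, and its column is the leftmost
  unused one. It yields the base, and it locates the entries of a row that multiples of lower
  rows cannot clear.
\<close>

lemma free_piv:
  assumes "i < n" "c < n" "blk i < blk c" and free: "\<And>d. i < d \<Longrightarrow> d \<in> piv_rows \<Longrightarrow> piv d \<noteq> c"
  shows "i \<in> piv_rows" "nb i \<le> blk c" "nb i = blk c \<Longrightarrow> piv i \<le> c"
proof -
  define k where "k = Suc c - R r (blk c)"
  have k: "1 \<le> k" "k \<le> r ! blk c" using blk_bounds[OF assms(2)] R_Suc[of "blk c"]
    by (auto simp: k_def)
  note f = free_slot[OF assms(1,3) blk_bounds(1)[OF assms(2)] k]
  have nod: False if "i < d" "d \<in> piv_rows" "nb d = blk c" "lab d = k" for d
    using free[OF that(1,2)] piv_props[OF that(2)] that blk_bounds[OF assms(2)] by (simp add: k_def)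
  show i: "i \<in> piv_rows" "nb i \<le> blk c" using f(1,2)[OF nod] by auto
  show "piv i \<le> c" if "nb i = blk c"
  proof -
    have "lab i \<le> k" by (rule f(3)) (use nod in auto)
    then show ?thesis
      using piv_props[OF i(1)] that blk_bounds[OF assms(2)] by (auto simp: k_def)
  qed
qed

lemma piv_not_later:
  assumes "i \<in> piv_rows" "blk c = nb i" "piv i \<le> c" "i < d" "d \<in> piv_rows"
  shows "piv d \<noteq> c"
proof
  assume e: "piv d = c"
  have nbd: "nb d = nb i" using piv_props[OF assms(5)] e assms by simp
  have l: "lab i \<le> lab d" using piv_props(2,4)[OF assms(5)] piv_props(2,4)[OF assms(1)] e assms by simp
  have "blk i \<le> blk d" using blk_mono assms piv_rows_less by simp
  moreover have "blk i \<noteq> blk d" using lab_less[of i d] assms piv_rows_less l by auto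
  moreover have "\<not> blk i < blk d"
    using nb_least[OF assms(1), of "blk d"] nb_props[OF assms(5)] nbd lab_bounds[of d] piv_rows_less[OF assms(5)] l
    by auto
  ultimately show False by simp
qed

text \<open>
  The analogue for \<open>nxt\<close>. The strict inequality between the labels is what makes
  homomorphisms between chains well defined and nilpotent.
\<close>

lemma free_nxt:
  assumes "i < n" "c < n" "blk i < blk c" and free: "\<And>d. i < d \<Longrightarrow> d \<in> piv_rows \<Longrightarrow> nxt d \<noteq> c"
  shows "i \<in> piv_rows" "nb i \<le> blk c" "c \<noteq> nxt i \<Longrightarrow> lab i < lab c"
proof -
  note l = lab_bounds[OF assms(2)] and b = blk_bounds[OF assms(2)]
  have nod: False if "i < d" "d \<in> piv_rows" "nb d = blk c" "lab d = lab c" for d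
    using free[OF that(1,2)] that index_lab[OF assms(2)] by (simp add: nxt_def)
  note f = free_slot[OF assms(1,3) b(1), of "lab c", OF _ _ nod]
  show i: "i \<in> piv_rows" "nb i \<le> blk c" using f(1,2) l by auto
  show "lab i < lab c" if "c \<noteq> nxt i"
  proof (cases "nb i < blk c")
    case True
    then show ?thesis using f(4) l nb_props(3)[OF i(1)] by force
  next
    case False
    then have "blk c = blk (nxt i)" using i nxt_props by force
    then have "lab c \<noteq> lab i" using that blk_lab_inj[of c "nxt i"] nxt_props[OF i(1)] assms by auto
    then show ?thesis using f(3) l by force
  qed
qed

text \<open>
  A chain of smaller label passes through every block that a chain of larger label passes
  through. Hence it does not stop earlier and cannot fall behind.
\<close>

lemma piv_rows_mono:
  assumes "d \<in> piv_rows" "a < n" "lab a \<le> lab d" "blk a \<le> blk d"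
  shows "a \<in> piv_rows" "nb a \<le> nb d" "blk a < blk d \<Longrightarrow> nb a < nb d"
proof -
  note p = nb_props[OF assms(1)]
  show a: "a \<in> piv_rows" by (rule piv_rowsI[of a "nb d"]) (use p assms in auto)
  show "nb a \<le> nb d" by (rule nb_le) (use p assms in auto)
  show "nb a < nb d" if "blk a < blk d"
  proof -
    have "nb a \<le> blk d" by (rule nb_le)
      (use that assms lab_bounds[of d] piv_rows_less[OF assms(1)] blk_bounds[of d] in auto)
    then show ?thesis using p by simp
  qed
qed

lemma block_iff: "i < n \<Longrightarrow> 1 \<le> t \<Longrightarrow> Suc i \<in> block r t \<longleftrightarrow> t = Suc (blk i)"
  using blk_bounds[of i] blk_eqI[of "t - 1" i] by (cases t) (auto simp: block_def)

lemma levi_iff: "(Suc i, Suc j) \<in> levi_roots r \<longleftrightarrow> i < j \<and> j < n \<and> blk i = blk j"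
  using blk_bounds[of i] blk_bounds[of j]
  by (auto simp: levi_roots_def pos_roots_def sum_r block_iff)

lemma M_iff: "(Suc i, Suc j) \<in> M_roots r \<longleftrightarrow> i < j \<and> j < n \<and> blk i < blk j"
  using blk_mono[of i j] by (auto simp: M_roots_def levi_iff) (auto simp: pos_roots_def sum_r)

lemma M_elim: 
  assumes "\<gamma> \<in> M_roots r" obtains i j where "\<gamma> = (Suc i, Suc j)"
proof -
  obtain i j where "\<gamma> = (i, j)" "1 \<le> i" "1 \<le> j" using assms by (auto simp: M_roots_def pos_roots_def)
  then show ?thesis using that[of "i - 1" "j - 1"] by auto
qed

end

lemma root_gt_iff:
  assumes "i < j" "i' < j'" "j \<le> n" "j' \<le> n" "1 \<le> i" "1 \<le> i'"
  shows "root_gt n (i', j') (i, j) \<longleftrightarrow> (i' < i \<and> j' = j) \<or> (i' = i \<and> j < j')"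
proof
  assume "root_gt n (i', j') (i, j)"
  then obtain a b where ab: "a < b" and e: "\<And>m. root_vec (i', j') m - root_vec (i, j) m = root_vec (a, b) m"
    by (auto simp: root_gt_def pos_roots_def)
  show "(i' < i \<and> j' = j) \<or> (i' = i \<and> j < j')"
    using e[of i] e[of j] e[of i'] e[of j'] e[of a] e[of b] assms ab
    by (auto simp: root_vec_def of_bool_def split: if_splits)
next
  assume h: "(i' < i \<and> j' = j) \<or> (i' = i \<and> j < j')"
  show "root_gt n (i', j') (i, j)"
  proof (cases "j' = j")
    case True
    then have "i' < i" using h by auto
    then show ?thesis unfolding root_gt_def
      by (intro bexI[of _ "(i', i)"]) (use True assms in \<open>auto simp: root_vec_def pos_roots_def\<close>)
  next
    case False
    then have "i' = i" "j < j'" using h by auto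
    then show ?thesis unfolding root_gt_def
      by (intro bexI[of _ "(j, j')"]) (use assms in \<open>auto simp: root_vec_def pos_roots_def\<close>)
  qed
qed

context composition
begin

text \<open>
  The base is unique, so it suffices to verify its two properties. Comparable roots share a
  row or a column, which \<open>piv\<close> excludes by injectivity; a position that is not in
  the base lies to the right of a base root if its column is still unused when its row is
  reached, and above one otherwise.
\<close>

lemma base_eq: "base r = (\<lambda>i. (Suc i, Suc (piv i))) ` piv_rows" (is "_ = ?S")
proof -
  have "is_base r ?S"
    unfolding is_base_def
  proof (intro conjI ballI impI)
    show "?S \<subseteq> M_roots r" using piv_props nb_props by (auto simp: M_iff)
  next
    fix \<xi> \<xi>' assume "\<xi> \<in> ?S" "\<xi>' \<in> ?S" and ne: "\<xi> \<noteq> \<xi>'"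
    then obtain i k where ik: "i \<in> piv_rows" "k \<in> piv_rows" "\<xi> = (Suc i, Suc (piv i))" "\<xi>' = (Suc k, Suc (piv k))"
      by blast
    then have "i \<noteq> k" using ne by blast
    then have "piv i \<noteq> piv k" using piv_inj ik by blast
    then show "\<not> comparable (sum_list r) \<xi> \<xi>'"
      using \<open>i \<noteq> k\<close> piv_props(1,3)[OF ik(1)] piv_props(1,3)[OF ik(2)]
      by (simp add: ik(3,4) comparable_def root_gt_iff sum_r)
  next
    fix \<gamma> assume g: "\<gamma> \<in> M_roots r - ?S"
    then obtain i j where ij: "\<gamma> = (Suc i, Suc j)" using M_elim by blast
    have m: "i < j" "j < n" "blk i < blk j" using g ij by (auto simp: M_iff)
    show "\<exists>\<xi>\<in>?S. root_gt (sum_list r) \<gamma> \<xi>"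
    proof (cases "\<exists>d>i. d \<in> piv_rows \<and> piv d = j")
      case True
      then obtain d where d: "d > i" "d \<in> piv_rows" "piv d = j" by blast
      then show ?thesis using ij m piv_props(1,3)[OF d(2)]
        by (intro bexI[of _ "(Suc d, Suc (piv d))"]) (auto simp: root_gt_iff sum_r)
    next
      case False
      then have i: "i \<in> piv_rows" "nb i \<le> blk j" "nb i = blk j \<Longrightarrow> piv i \<le> j"
        using free_piv[of i j] m by auto
      then have "piv i \<le> j" using piv_props[OF i(1)] m less_if_blk_less[of "piv i" j] by fastforce
      moreover have "piv i \<noteq> j" using g ij i(1) by auto
      ultimately have "piv i < j" by simp
      then show ?thesis using ij m i piv_props(1,3)[OF i(1)]
        by (intro bexI[of _ "(Suc i, Suc (piv i))"]) (auto simp: root_gt_iff sum_r)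
    qed
  qed
  then show ?thesis using ex1_base[of r] is_base_base[of r] by auto
qed

lemma base_iff: "(Suc i, Suc j) \<in> base r \<longleftrightarrow> i \<in> piv_rows \<and> j = piv i"
  by (auto simp: base_eq)

lemma Phi_iff: "(Suc j, Suc l) \<in> Phi r \<longleftrightarrow>
  (\<exists>h k. h \<in> piv_rows \<and> piv h = j \<and> k \<in> piv_rows \<and> l = piv k \<and> blk k = blk j \<and> j < k)"
proof -
  have "(Suc j, Suc l) \<in> Phi r \<longleftrightarrow> (\<exists>i k. (i, Suc j) \<in> base r \<and> (k, Suc l) \<in> base r \<and> (Suc j, k) \<in> levi_roots r)"
    by (simp add: Phi_def)
  also have "\<dots> \<longleftrightarrow> (\<exists>h k. (Suc h, Suc j) \<in> base r \<and> (Suc k, Suc l) \<in> base r \<and> (Suc j, Suc k) \<in> levi_roots r)"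
  proof -
    have "(\<exists>h. i = Suc h) \<and> (\<exists>h. j = Suc h)" if "(i, j) \<in> base r" for i j
      using that by (auto simp: base_eq)
    then show ?thesis by metis
  qed
  also have "\<dots> \<longleftrightarrow> (\<exists>h k. h \<in> piv_rows \<and> piv h = j \<and> k \<in> piv_rows \<and> l = piv k \<and> blk k = blk j \<and> j < k)"
    unfolding base_iff levi_iff by (metis piv_rows_less)
  finally show ?thesis .
qed

end

section \<open>Rational functions near a point\<close>

text \<open>
  A property holds near \<open>x\<^sub>0\<close> if it holds on a basic Zariski open
  neighbourhood of that point in \<open>V\<close>.
\<close>

definition near :: "nat \<Rightarrow> 'a::field mat set \<Rightarrow> 'a mat \<Rightarrow> ('a mat \<Rightarrow> bool) \<Rightarrow> bool" where
  "near n V x\<^sub>0 P \<longleftrightarrow> (\<exists>q\<in>poly_funs n. q x\<^sub>0 \<noteq> 0 \<and> (\<forall>x\<in>V. q x \<noteq> 0 \<longrightarrow> P x))"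

text \<open>
  The elements of the local ring at \<open>x\<^sub>0\<close>.
\<close>

definition regular :: "nat \<Rightarrow> 'a::field mat set \<Rightarrow> 'a mat \<Rightarrow> ('a mat \<Rightarrow> 'a) \<Rightarrow> bool" where
  "regular n V x\<^sub>0 f \<longleftrightarrow> (\<exists>p\<in>poly_funs n. \<exists>q\<in>poly_funs n. q x\<^sub>0 \<noteq> 0 \<and>
     (\<forall>x\<in>V. q x \<noteq> 0 \<longrightarrow> f x = p x / q x))"

lemma near_at: "near n V x\<^sub>0 P \<Longrightarrow> x\<^sub>0 \<in> V \<Longrightarrow> P x\<^sub>0"
  by (auto simp: near_def)

lemma near_mono: "near n V x\<^sub>0 P \<Longrightarrow> (\<And>x. x \<in> V \<Longrightarrow> P x \<Longrightarrow> Q x) \<Longrightarrow> near n V x\<^sub>0 Q"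
  by (auto simp: near_def)

lemma near_conj: "near n V x\<^sub>0 P \<Longrightarrow> near n V x\<^sub>0 Q \<Longrightarrow> near n V x\<^sub>0 (\<lambda>x. P x \<and> Q x)"
proof -
  assume "near n V x\<^sub>0 P" "near n V x\<^sub>0 Q"
  then obtain p q where "p \<in> poly_funs n" "q \<in> poly_funs n" "p x\<^sub>0 \<noteq> 0" "q x\<^sub>0 \<noteq> 0"
    "\<forall>x\<in>V. p x \<noteq> 0 \<longrightarrow> P x" "\<forall>x\<in>V. q x \<noteq> 0 \<longrightarrow> Q x" by (auto simp: near_def)
  then show ?thesis unfolding near_def
    by (intro bexI[of _ "\<lambda>x. p x * q x"]) (auto intro: poly_funs.mult)
qed

lemma near_True: "(\<And>x. x \<in> V \<Longrightarrow> P x) \<Longrightarrow> near n V x\<^sub>0 P"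
  unfolding near_def by (intro bexI[of _ "\<lambda>_. 1"]) (auto intro: poly_funs.const)

lemma near_ball:
  assumes "finite A" "\<And>c. c \<in> A \<Longrightarrow> near n V x\<^sub>0 (P c)"
  shows "near n V x\<^sub>0 (\<lambda>x. \<forall>c\<in>A. P c x)"
  using assms
proof (induction A rule: finite_induct)
  case empty show ?case by (rule near_True) simp
next
  case (insert c A)
  then have "near n V x\<^sub>0 (\<lambda>x. P c x \<and> (\<forall>c\<in>A. P c x))" by (intro near_conj) auto
  then show ?case by (rule near_mono) simp
qed

lemma regular_poly: "f \<in> poly_funs n \<Longrightarrow> regular n V x\<^sub>0 f"
  unfolding regular_def
  by (intro bexI[of _ f] bexI[of _ "\<lambda>_. 1"]) (auto intro: poly_funs.const)

lemma regular_const: "regular n V x\<^sub>0 (\<lambda>_. c)"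
  by (rule regular_poly) (rule poly_funs.const)

lemma regular_mult: "regular n V x\<^sub>0 f \<Longrightarrow> regular n V x\<^sub>0 g \<Longrightarrow> regular n V x\<^sub>0 (\<lambda>x. f x * g x)"
proof -
  assume "regular n V x\<^sub>0 f" "regular n V x\<^sub>0 g"
  then obtain p q p' q' where "p \<in> poly_funs n" "q \<in> poly_funs n" "q x\<^sub>0 \<noteq> 0"
    "\<forall>x\<in>V. q x \<noteq> 0 \<longrightarrow> f x = p x / q x" "p' \<in> poly_funs n" "q' \<in> poly_funs n" "q' x\<^sub>0 \<noteq> 0"
    "\<forall>x\<in>V. q' x \<noteq> 0 \<longrightarrow> g x = p' x / q' x" unfolding regular_def by blast
  then show ?thesis unfolding regular_def
    by (intro bexI[of _ "\<lambda>x. p x * p' x"] bexI[of _ "\<lambda>x. q x * q' x"]) (auto intro: poly_funs.mult)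
qed

lemma regular_add: "regular n V x\<^sub>0 f \<Longrightarrow> regular n V x\<^sub>0 g \<Longrightarrow> regular n V x\<^sub>0 (\<lambda>x. f x + g x)"
proof -
  assume "regular n V x\<^sub>0 f" "regular n V x\<^sub>0 g"
  then obtain p q p' q' where h: "p \<in> poly_funs n" "q \<in> poly_funs n" "q x\<^sub>0 \<noteq> 0"
    "\<forall>x\<in>V. q x \<noteq> 0 \<longrightarrow> f x = p x / q x" "p' \<in> poly_funs n" "q' \<in> poly_funs n" "q' x\<^sub>0 \<noteq> 0"
    "\<forall>x\<in>V. q' x \<noteq> 0 \<longrightarrow> g x = p' x / q' x" unfolding regular_def by blast
  show ?thesis unfolding regular_def
    by (intro bexI[of _ "\<lambda>x. p x * q' x + p' x * q x"] bexI[of _ "\<lambda>x. q x * q' x"])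
      (use h in \<open>auto intro!: poly_funs.mult poly_funs.add simp: add_frac_eq\<close>)
qed

lemma regular_uminus: "regular n V x\<^sub>0 f \<Longrightarrow> regular n V x\<^sub>0 (\<lambda>x. - f x)"
  using regular_mult[OF regular_const[of n V x\<^sub>0 "-1"]] by simp

lemma regular_diff: "regular n V x\<^sub>0 f \<Longrightarrow> regular n V x\<^sub>0 g \<Longrightarrow> regular n V x\<^sub>0 (\<lambda>x. f x - g x)"
  using regular_add[OF _ regular_uminus, of n V x\<^sub>0 f g] by simp

lemma regular_sum: "finite A \<Longrightarrow> (\<And>c. c \<in> A \<Longrightarrow> regular n V x\<^sub>0 (f c)) \<Longrightarrow>
  regular n V x\<^sub>0 (\<lambda>x. \<Sum>c\<in>A. f c x)"
  by (induction A rule: finite_induct) (auto intro: regular_const regular_add)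

text \<open>
  Every genericity condition of the construction is of this form, so that in the end a single
  polynomial describes the open set.
\<close>

lemma regular_near_nonzero:
  assumes "regular n V x\<^sub>0 f" "x\<^sub>0 \<in> V" "f x\<^sub>0 \<noteq> 0"
  shows "near n V x\<^sub>0 (\<lambda>x. f x \<noteq> 0)"
proof -
  obtain p q where h: "p \<in> poly_funs n" "q \<in> poly_funs n" "q x\<^sub>0 \<noteq> 0"
    "\<forall>x\<in>V. q x \<noteq> 0 \<longrightarrow> f x = p x / q x" using assms(1) unfolding regular_def by blast
  then have "p x\<^sub>0 \<noteq> 0" using assms by auto
  then show ?thesis unfolding near_def
    by (intro bexI[of _ "\<lambda>x. p x * q x"]) (use h in \<open>auto intro: poly_funs.mult\<close>)
qed

lemma regular_inverse:
  assumes "regular n V x\<^sub>0 f" "x\<^sub>0 \<in> V" "f x\<^sub>0 \<noteq> 0"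
  shows "regular n V x\<^sub>0 (\<lambda>x. inverse (f x))"
proof -
  obtain p q where h: "p \<in> poly_funs n" "q \<in> poly_funs n" "q x\<^sub>0 \<noteq> 0"
    "\<forall>x\<in>V. q x \<noteq> 0 \<longrightarrow> f x = p x / q x" using assms(1) unfolding regular_def by blast
  then have "p x\<^sub>0 \<noteq> 0" using assms by auto
  then show ?thesis unfolding regular_def
    by (intro bexI[of _ "\<lambda>x. q x * q x"] bexI[of _ "\<lambda>x. p x * q x"])
      (use h in \<open>auto intro: poly_funs.mult\<close>)
qed

lemma regular_divide:
  "regular n V x\<^sub>0 f \<Longrightarrow> regular n V x\<^sub>0 g \<Longrightarrow> x\<^sub>0 \<in> V \<Longrightarrow> g x\<^sub>0 \<noteq> 0 \<Longrightarrow>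
    regular n V x\<^sub>0 (\<lambda>x. f x / g x)"
  unfolding divide_inverse by (intro regular_mult regular_inverse)

lemma poly_funs_compose:
  assumes "f \<in> poly_funs n" "\<And>a b. a < n \<Longrightarrow> b < n \<Longrightarrow> (\<lambda>x. T x $$ (a, b)) \<in> poly_funs n"
  shows "(\<lambda>x. f (T x)) \<in> poly_funs n"
  using assms(1) by induction (auto intro: poly_funs.intros assms(2))

lemma near_compose:
  assumes "near n V' (T x\<^sub>0) P" "\<And>x. x \<in> V \<Longrightarrow> T x \<in> V'"
    "\<And>a b. a < n \<Longrightarrow> b < n \<Longrightarrow> (\<lambda>x. T x $$ (a, b)) \<in> poly_funs n"
  shows "near n V x\<^sub>0 (\<lambda>x. P (T x))"
proof -
  obtain q where "q \<in> poly_funs n" "q (T x\<^sub>0) \<noteq> 0" "\<forall>x\<in>V'. q x \<noteq> 0 \<longrightarrow> P x"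
    using assms(1) by (auto simp: near_def)
  then show ?thesis unfolding near_def
    by (intro bexI[of _ "\<lambda>x. q (T x)"]) (auto simp: assms intro: poly_funs_compose)
qed

lemma regular_compose:
  assumes "regular n V' (T x\<^sub>0) f" "\<And>x. x \<in> V \<Longrightarrow> T x \<in> V'"
    "\<And>a b. a < n \<Longrightarrow> b < n \<Longrightarrow> (\<lambda>x. T x $$ (a, b)) \<in> poly_funs n"
  shows "regular n V x\<^sub>0 (\<lambda>x. f (T x))"
proof -
  obtain p q where h: "p \<in> poly_funs n" "q \<in> poly_funs n" "q (T x\<^sub>0) \<noteq> 0"
    "\<forall>x\<in>V'. q x \<noteq> 0 \<longrightarrow> f x = p x / q x" using assms(1) unfolding regular_def by blast
  then show ?thesis unfolding regular_def
    by (intro bexI[of _ "\<lambda>x. p (T x)"] bexI[of _ "\<lambda>x. q (T x)"])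
      (auto simp: assms intro: poly_funs_compose)
qed

definition regular_mat :: "nat \<Rightarrow> 'a::field mat set \<Rightarrow> 'a mat \<Rightarrow> ('a mat \<Rightarrow> 'a mat) \<Rightarrow> bool" where
  "regular_mat n V x\<^sub>0 A \<longleftrightarrow> (\<forall>x. A x \<in> carrier_mat n n) \<and>
     (\<forall>a<n. \<forall>b<n. regular n V x\<^sub>0 (\<lambda>x. A x $$ (a, b)))"

lemma regular_matD: 
  "regular_mat n V x\<^sub>0 A \<Longrightarrow> A x \<in> carrier_mat n n"
  "regular_mat n V x\<^sub>0 A \<Longrightarrow> a < n \<Longrightarrow> b < n \<Longrightarrow> regular n V x\<^sub>0 (\<lambda>x. A x $$ (a, b))"
  by (auto simp: regular_mat_def)

lemma regular_mat_mat:
  "(\<And>a b. a < n \<Longrightarrow> b < n \<Longrightarrow> regular n V x\<^sub>0 (\<lambda>x. f x a b)) \<Longrightarrow>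
    regular_mat n V x\<^sub>0 (\<lambda>x. mat n n (\<lambda>(a, b). f x a b))"
  by (simp add: regular_mat_def)

lemma regular_mat_const: "A \<in> carrier_mat n n \<Longrightarrow> regular_mat n V x\<^sub>0 (\<lambda>_. A)"
  by (simp add: regular_mat_def regular_const)

lemma mult_entry: "A \<in> carrier_mat n n \<Longrightarrow> B \<in> carrier_mat n n \<Longrightarrow> a < n \<Longrightarrow> b < n \<Longrightarrow>
  (A * B) $$ (a, b) = (\<Sum>d<n. A $$ (a, d) * B $$ (d, b))"
  by (simp add: scalar_prod_def atLeast0LessThan)

lemma regular_mat_mult:
  assumes A: "regular_mat n V x\<^sub>0 A" and B: "regular_mat n V x\<^sub>0 B"
  shows "regular_mat n V x\<^sub>0 (\<lambda>x. A x * B x)"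
  unfolding regular_mat_def
proof (intro conjI allI impI)
  show "A x * B x \<in> carrier_mat n n" for x using regular_matD(1)[OF A] regular_matD(1)[OF B] by (metis mult_carrier_mat)
  fix a b assume "a < n" "b < n"
  then have e: "(\<lambda>x. (A x * B x) $$ (a, b)) = (\<lambda>x. \<Sum>d<n. A x $$ (a, d) * B x $$ (d, b))"
    using regular_matD(1)[OF A] regular_matD(1)[OF B] mult_entry by blast
  show "regular n V x\<^sub>0 (\<lambda>x. (A x * B x) $$ (a, b))"
    unfolding e using \<open>a < n\<close> \<open>b < n\<close> A B
    by (intro regular_sum regular_mult regular_matD) auto
qed

lemma regular_mat_add:
  assumes A: "regular_mat n V x\<^sub>0 A" and B: "regular_mat n V x\<^sub>0 B"
  shows "regular_mat n V x\<^sub>0 (\<lambda>x. A x + B x)"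
  unfolding regular_mat_def
proof (intro conjI allI impI)
  show "A x + B x \<in> carrier_mat n n" for x using regular_matD(1)[OF A] regular_matD(1)[OF B] by (metis add_carrier_mat)
  have d: "dim_row (B x) = n" "dim_col (B x) = n" for x
    using regular_matD(1)[OF B] by (metis carrier_matD)+
  fix a b assume "a < n" "b < n"
  then have e: "(\<lambda>x. (A x + B x) $$ (a, b)) = (\<lambda>x. A x $$ (a, b) + B x $$ (a, b))"
    by (simp add: d)
  show "regular n V x\<^sub>0 (\<lambda>x. (A x + B x) $$ (a, b))"
    unfolding e using \<open>a < n\<close> \<open>b < n\<close> A B by (intro regular_add regular_matD) auto
qed

lemma regular_mat_diff:
  assumes A: "regular_mat n V x\<^sub>0 A" and B: "regular_mat n V x\<^sub>0 B"
  shows "regular_mat n V x\<^sub>0 (\<lambda>x. A x - B x)"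
  unfolding regular_mat_def
proof (intro conjI allI impI)
  show "A x - B x \<in> carrier_mat n n" for x using regular_matD(1)[OF A] regular_matD(1)[OF B] by (metis minus_carrier_mat)
  have d: "dim_row (B x) = n" "dim_col (B x) = n" for x
    using regular_matD(1)[OF B] by (metis carrier_matD)+
  fix a b assume "a < n" "b < n"
  then have e: "(\<lambda>x. (A x - B x) $$ (a, b)) = (\<lambda>x. A x $$ (a, b) - B x $$ (a, b))"
    by (simp add: d)
  show "regular n V x\<^sub>0 (\<lambda>x. (A x - B x) $$ (a, b))"
    unfolding e using \<open>a < n\<close> \<open>b < n\<close> A B by (intro regular_diff regular_matD) auto
qed

lemma regular_mat_compose:
  assumes "regular_mat n V' (T x\<^sub>0) A" "\<And>x. x \<in> V \<Longrightarrow> T x \<in> V'"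
    "\<And>a b. a < n \<Longrightarrow> b < n \<Longrightarrow> (\<lambda>x. T x $$ (a, b)) \<in> poly_funs n"
  shows "regular_mat n V x\<^sub>0 (\<lambda>x. A (T x))"
  using assms(1) unfolding regular_mat_def by (auto intro: regular_compose[OF _ assms(2,3)])

section \<open>Supports of matrices and conjugation\<close>

text \<open>
  Most products below are seen to vanish, or to be triangular, from the supports of their
  factors.
\<close>

definition supp_in :: "nat \<Rightarrow> 'a::zero mat \<Rightarrow> (nat \<Rightarrow> nat \<Rightarrow> bool) \<Rightarrow> bool" where
  "supp_in n A \<rho> \<longleftrightarrow> A \<in> carrier_mat n n \<and> (\<forall>a<n. \<forall>b<n. A $$ (a, b) \<noteq> 0 \<longrightarrow> \<rho> a b)"

lemma supp_in_carrier: "supp_in n A \<rho> \<Longrightarrow> A \<in> carrier_mat n n"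
  by (simp add: supp_in_def)

lemma supp_in_mono: "supp_in n A \<rho> \<Longrightarrow> (\<And>a b. a < n \<Longrightarrow> b < n \<Longrightarrow> \<rho> a b \<Longrightarrow> \<sigma> a b) \<Longrightarrow> supp_in n A \<sigma>"
  by (auto simp: supp_in_def)

lemma supp_in_mult:
  fixes A B :: "'a::semiring_0 mat"
  assumes "supp_in n A \<rho>" "supp_in n B \<sigma>"
    "\<And>a d b. a < n \<Longrightarrow> d < n \<Longrightarrow> b < n \<Longrightarrow> \<rho> a d \<Longrightarrow> \<sigma> d b \<Longrightarrow> \<tau> a b"
  shows "supp_in n (A * B) \<tau>"
  unfolding supp_in_def
proof (intro conjI allI impI)
  have c: "A \<in> carrier_mat n n" "B \<in> carrier_mat n n" using assms(1,2) by (simp_all add: supp_in_def)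
  then show "A * B \<in> carrier_mat n n" by simp
  fix a b assume ab: "a < n" "b < n" and nz: "(A * B) $$ (a, b) \<noteq> 0"
  then have "(\<Sum>d<n. A $$ (a, d) * B $$ (d, b)) \<noteq> 0" using mult_entry[OF c] by simp
  then obtain d where "d < n" "A $$ (a, d) * B $$ (d, b) \<noteq> 0" by (meson sum.not_neutral_contains_not_neutral lessThan_iff)
  then show "\<tau> a b" using assms ab unfolding supp_in_def by (metis mult_zero_left mult_zero_right)
qed

lemma supp_in_zero: "supp_in n A (\<lambda>_ _. False) \<Longrightarrow> A = 0\<^sub>m n n"
  by (rule eq_matI) (auto simp: supp_in_def)

lemma supp_in_mult_zero:
  fixes A B :: "'a::semiring_0 mat"
  assumes "supp_in n A \<rho>" "supp_in n B \<sigma>"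
    "\<And>a d b. a < n \<Longrightarrow> d < n \<Longrightarrow> b < n \<Longrightarrow> \<rho> a d \<Longrightarrow> \<sigma> d b \<Longrightarrow> False"
  shows "A * B = 0\<^sub>m n n"
  by (rule supp_in_zero[OF supp_in_mult[OF assms]])

lemma supp_in_add:
  "supp_in n A \<rho> \<Longrightarrow> supp_in n B \<rho> \<Longrightarrow> supp_in n (A + B :: 'a::monoid_add mat) \<rho>"
  unfolding supp_in_def by (auto simp: carrier_matD) (metis add_0_left)

lemma supp_in_diff:
  "supp_in n A \<rho> \<Longrightarrow> supp_in n B \<rho> \<Longrightarrow> supp_in n (A - B :: 'a::group_add mat) \<rho>"
  unfolding supp_in_def by (auto simp: carrier_matD) (metis diff_self)

lemma supp_in_one: "(\<And>a. \<rho> a a) \<Longrightarrow> supp_in n (1\<^sub>m n) \<rho>"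
  by (auto simp: supp_in_def)

text \<open>
  The intertwining form \<open>g * x = y * g\<close> keeps inverses out of the computations.
  The inverse \<open>g'\<close> is a parameter because it has to depend rationally on the
  matrix, too.
\<close>

definition conjugates :: "nat \<Rightarrow> 'a::field mat \<Rightarrow> 'a mat \<Rightarrow> 'a mat \<Rightarrow> 'a mat \<Rightarrow> bool" where
  "conjugates n g g' x y \<longleftrightarrow> g \<in> carrier_mat n n \<and> g' \<in> carrier_mat n n \<and> x \<in> carrier_mat n n \<and>
     y \<in> carrier_mat n n \<and> g * g' = 1\<^sub>m n \<and> g' * g = 1\<^sub>m n \<and> g * x = y * g"

lemma conjugates_trans:
  assumes "conjugates n g g' x y" "conjugates n k k' y z"
  shows "conjugates n (k * g) (g' * k') x z"
proof -
  note a = assms[unfolded conjugates_def]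
  have c: "g \<in> carrier_mat n n" "g' \<in> carrier_mat n n" "k \<in> carrier_mat n n" "k' \<in> carrier_mat n n"
    "x \<in> carrier_mat n n" "y \<in> carrier_mat n n" "z \<in> carrier_mat n n" using a by auto
  note as = assoc_mult_mat[of _ n n _ n _ n]
  have "k * g * (g' * k') = k * (g * g') * k'" using c by (simp add: as)
  moreover have "g' * k' * (k * g) = g' * (k' * k) * g" using c by (simp add: as)
  moreover have "k * g * x = z * (k * g)"
  proof -
    have e: "g * x = y * g" "k * y = z * k" using a by auto
    have "k * g * x = k * (g * x)" by (rule as) (use c in auto)
    also have "\<dots> = k * y * g" unfolding e(1) by (rule as[symmetric]) (use c in auto)
    also have "\<dots> = z * (k * g)" unfolding e(2) by (rule as) (use c in auto)
    finally show ?thesis .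
  qed
  moreover have "k * (g * g') * k' = 1\<^sub>m n" "g' * (k' * k) * g = 1\<^sub>m n"
    using a by (auto simp: right_mult_one_mat[of _ n n])
  ultimately show ?thesis using c by (simp add: conjugates_def minus_carrier_mat)
qed

lemma conjugates_sym:
  assumes "conjugates n g g' x y"
  shows "conjugates n g' g y x"
proof -
  note a = assms[unfolded conjugates_def]
  have c: "g \<in> carrier_mat n n" "g' \<in> carrier_mat n n" "x \<in> carrier_mat n n" "y \<in> carrier_mat n n"
    and e: "g * g' = 1\<^sub>m n" "g' * g = 1\<^sub>m n" "g * x = y * g" using a by auto
  note as = assoc_mult_mat[of _ n n _ n _ n]
  have "g' * y = g' * y * (g * g')" using c by (simp add: e(1))
  also have "\<dots> = g' * (y * g) * g'" using c by (simp add: as)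
  also have "\<dots> = g' * (g * x) * g'" using e(3) by simp
  also have "\<dots> = g' * g * x * g'" using as[OF c(2) c(1) c(3)] by simp
  also have "\<dots> = x * g'" using c by (simp add: e(2))
  finally show ?thesis using c e by (simp add: conjugates_def)
qed

lemma one_plus_square_zero:
  assumes c: "N \<in> carrier_mat n n" and "N * N = 0\<^sub>m n n"
  shows "(1\<^sub>m n + N) * (1\<^sub>m n - N) = (1\<^sub>m n :: 'a::ring_1 mat)" "(1\<^sub>m n - N) * (1\<^sub>m n + N) = 1\<^sub>m n"
proof -
  have m: "1\<^sub>m n + N \<in> carrier_mat n n" "1\<^sub>m n - N \<in> carrier_mat n n" using c by auto
  show "(1\<^sub>m n + N) * (1\<^sub>m n - N) = 1\<^sub>m n"
    using assms m
    by (subst add_mult_distrib_mat[of _ n n _ _ n]) (auto simp: mult_minus_distrib_mat[of _ n n _ n] intro!: eq_matI)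
  show "(1\<^sub>m n - N) * (1\<^sub>m n + N) = 1\<^sub>m n"
    using assms m
    by (subst minus_mult_distrib_mat[of _ n n _ _ n]) (auto simp: mult_add_distrib_mat[of _ n n _ n] intro!: eq_matI)
qed

lemma conjugates_unipotent:
  assumes c: "N \<in> carrier_mat n n" "x \<in> carrier_mat n n" "y \<in> carrier_mat n n"
    and "N * N = 0\<^sub>m n n" "x + N * x = y + y * N"
  shows "conjugates n (1\<^sub>m n + N) (1\<^sub>m n - N) x y"
proof -
  have "(1\<^sub>m n + N) * x = y * (1\<^sub>m n + N)"
    using c assms(5) by (simp add: add_mult_distrib_mat[of _ n n _ _ n] mult_add_distrib_mat[of _ n n _ n])
  then show ?thesis using one_plus_square_zero[OF c(1) assms(4)] c by (simp add: conjugates_def minus_carrier_mat)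
qed

lemma conjugates_unipotent_minus:
  assumes c: "N \<in> carrier_mat n n" "x \<in> carrier_mat n n" "y \<in> carrier_mat n n"
    and "N * N = 0\<^sub>m n n" "x + y * N = y + N * x"
  shows "conjugates n (1\<^sub>m n - N) (1\<^sub>m n + N) x y"
proof -
  have e: "x - N * x = y - y * N"
  proof (rule eq_matI)
    fix a b assume ab: "a < dim_row (y - y * N)" "b < dim_col (y - y * N)"
    then have "(x + y * N) $$ (a, b) = (y + N * x) $$ (a, b)" using assms(5) by simp
    then show "(x - N * x) $$ (a, b) = (y - y * N) $$ (a, b)" using ab c
      by (simp add: algebra_simps)
  qed (use c in auto)
  have 3: "(1\<^sub>m n - N) * x = y * (1\<^sub>m n - N)"
    using c e by (simp add: minus_mult_distrib_mat[of _ n n _ _ n] mult_minus_distrib_mat[of _ n n _ n])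
  show ?thesis using one_plus_square_zero[OF c(1) assms(4)] 3 c by (simp add: conjugates_def minus_carrier_mat)
qed

section \<open>Homomorphisms between chains\<close>

context composition
begin

text \<open>
  The rows of the Richardson element from \<open>i\<close> on.
\<close>

definition chain :: "nat \<Rightarrow> 'a::field mat" where
  "chain i = mat n n (\<lambda>(a, b). if i \<le> a \<and> a \<in> piv_rows \<and> b = nxt a then 1 else 0)"

text \<open>
  On rows supported in the image of \<open>chain i\<close>, multiplication by the transposed
  matrix yields a preimage under \<open>chain i\<close>; so the linear systems below have
  explicit, hence rational, solutions.
\<close>

definition chain_T :: "nat \<Rightarrow> 'a::field mat" where
  "chain_T i = mat n n (\<lambda>(b, a). if i \<le> a \<and> a \<in> piv_rows \<and> b = nxt a then 1 else 0)"

text \<open>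
  The positions of \<open>S \<union> \<Phi>\<close> for the matrix that consists of the rows
  from \<open>i\<close> on. A root of \<open>\<Phi>\<close> in row \<open>piv h\<close>
  appears only once the row \<open>h\<close> is present.
\<close>

definition normal_supp :: "nat \<Rightarrow> nat \<Rightarrow> nat \<Rightarrow> bool" where
  "normal_supp i a b \<longleftrightarrow> (i \<le> a \<and> a \<in> piv_rows \<and> b = piv a) \<or>
     (\<exists>h k. i \<le> h \<and> h \<in> piv_rows \<and> piv h = a \<and> k \<in> piv_rows \<and> blk k = blk a \<and> a < k \<and> b = piv k)"

definition free_nxt_col :: "nat \<Rightarrow> nat \<Rightarrow> bool" where
  "free_nxt_col i c \<longleftrightarrow> c < n \<and> blk i < blk c \<and> (\<forall>d>i. d \<in> piv_rows \<longrightarrow> nxt d \<noteq> c)"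

definition free_piv_col :: "nat \<Rightarrow> nat \<Rightarrow> bool" where
  "free_piv_col i c \<longleftrightarrow> c < n \<and> blk i < blk c \<and> (\<forall>d>i. d \<in> piv_rows \<longrightarrow> piv d \<noteq> c)"

text \<open>
  The pairs \<open>(nxt\<^sup>m c, nxt\<^sup>m c')\<close> for all \<open>m\<close> for which
  both exist.
\<close>

inductive chain_pair :: "nat \<Rightarrow> nat \<Rightarrow> nat \<Rightarrow> nat \<Rightarrow> bool" for c c' where
  base: "chain_pair c c' c c'"
| step: "chain_pair c c' a b \<Longrightarrow> a \<in> piv_rows \<Longrightarrow> b \<in> piv_rows \<Longrightarrow> chain_pair c c' (nxt a) (nxt b)"

lemma chain_pair_props:
  assumes "chain_pair c c' a b" "c < n" "c' < n" "lab c < lab c'" "blk c \<le> blk c'"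
  shows "a < n \<and> b < n \<and> lab a = lab c \<and> lab b = lab c' \<and> blk a \<le> blk b \<and>
    (blk c < blk c' \<longrightarrow> blk a < blk b) \<and> c \<le> a \<and> c' \<le> b"
  using assms(1)
proof induction
  case base then show ?case using assms by auto
next
  case (step a b)
  then have "a \<in> piv_rows" "nb a \<le> nb b" "blk a < blk b \<Longrightarrow> nb a < nb b"
    using piv_rows_mono[of b a] assms by auto
  then show ?case using nxt_props[OF step(2)] nxt_props[OF step(3)] step.IH by auto
qed

lemma free_nxt_col_props:
  assumes "free_nxt_col i c" "i < n"
  shows "i \<in> piv_rows" "nb i \<le> blk c" "c \<noteq> nxt i \<Longrightarrow> lab i < lab c" "c < n" "i < c"
proof -
  have f: "c < n" "blk i < blk c" "\<And>d. i < d \<Longrightarrow> d \<in> piv_rows \<Longrightarrow> nxt d \<noteq> c"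
    using assms by (auto simp: free_nxt_col_def)
  show "i \<in> piv_rows" "nb i \<le> blk c" "c \<noteq> nxt i \<Longrightarrow> lab i < lab c" 
    using free_nxt[OF assms(2) f(1,2,3)] by auto
  show "c < n" "i < c" using f less_if_blk_less assms by auto
qed

lemma free_nxt_nxt: "i \<in> piv_rows \<Longrightarrow> free_nxt_col i (nxt i)"
  using nxt_props nb_props nxt_inj by (fastforce simp: free_nxt_col_def)

text \<open>
  Acting on row vectors from the right, this matrix sends the chain that starts in \<open>nxt
  i\<close> to the combination with coefficients \<open>\<delta>\<close> of the other chains
  that start in free columns, and it kills all other chains.
\<close>

definition chain_hom :: "nat \<Rightarrow> (nat \<Rightarrow> 'a::field) \<Rightarrow> 'a mat" where
  "chain_hom i \<delta> = mat n n (\<lambda>(a, b).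
     \<Sum>c\<in>{c. free_nxt_col i c \<and> c \<noteq> nxt i}. if chain_pair (nxt i) c a b then \<delta> c else 0)"

lemma finite_free_nxt: "finite {c. free_nxt_col i c \<and> P c}"
  by (rule finite_subset[of _ "{..<n}"]) (auto simp: free_nxt_col_def)

lemma chain_hom_carrier: "chain_hom i \<delta> \<in> carrier_mat n n"
  by (simp add: chain_hom_def)

lemma chain_carrier:
  "(chain i :: 'a::field mat) \<in> carrier_mat n n" "(chain_T i :: 'a mat) \<in> carrier_mat n n"
  by (simp_all add: chain_def chain_T_def)

lemma chain_hom_nonzeroE:
  assumes "chain_hom i \<delta> $$ (a, b) \<noteq> 0" "a < n" "b < n"
  obtains c where "free_nxt_col i c" "c \<noteq> nxt i" "chain_pair (nxt i) c a b" "\<delta> c \<noteq> 0"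
proof -
  have "chain_hom i \<delta> $$ (a, b) = (\<Sum>c\<in>{c. free_nxt_col i c \<and> c \<noteq> nxt i}. if chain_pair (nxt i) c a b then \<delta> c else 0)"
    unfolding chain_hom_def using assms(2,3) by (subst index_mat) auto
  then have "(\<Sum>c\<in>{c. free_nxt_col i c \<and> c \<noteq> nxt i}. if chain_pair (nxt i) c a b then \<delta> c else 0) \<noteq> 0"
    using assms(1) by argo
  then have "\<exists>c\<in>{c. free_nxt_col i c \<and> c \<noteq> nxt i}. (if chain_pair (nxt i) c a b then \<delta> c else 0) \<noteq> 0"
    by (rule contrapos_np) (rule sum.neutral, blast)
  then obtain c where "free_nxt_col i c" "c \<noteq> nxt i" "(if chain_pair (nxt i) c a b then \<delta> c else 0) \<noteq> 0"
    by blast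
  then show ?thesis using that[of c] by (cases "chain_pair (nxt i) c a b") simp_all
qed

lemma chain_pair_free:
  assumes "i \<in> piv_rows" "free_nxt_col i c" "c \<noteq> nxt i" "chain_pair (nxt i) c a b"
  shows "a < n" "b < n" "lab a = lab i" "lab i < lab b" "blk a \<le> blk b" "nb i < blk c \<Longrightarrow> blk a < blk b"
    "nxt i \<le> a" "c \<le> b" "i < a" "i < b" "b \<in> piv_rows \<Longrightarrow> a \<in> piv_rows"
proof -
  note f = free_nxt_col_props[OF assms(2) piv_rows_less[OF assms(1)]] and x = nxt_props[OF assms(1)]
  note t = chain_pair_props[OF assms(4) x(1) f(4)]
  show *: "a < n" "b < n" "lab a = lab i" "lab i < lab b" "blk a \<le> blk b" "nb i < blk c \<Longrightarrow> blk a < blk b"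
    "nxt i \<le> a" "c \<le> b" "i < a" "i < b" using t x f assms by auto
  show "b \<in> piv_rows \<Longrightarrow> a \<in> piv_rows" using piv_rows_mono(1)[of b a] * by simp
qed

lemma chain_pair_start:
  assumes "i \<in> piv_rows" "free_nxt_col i c" "c \<noteq> nxt i"
  shows "chain_pair (nxt i) c (nxt i) b \<longleftrightarrow> b = c"
proof
  assume "chain_pair (nxt i) c (nxt i) b"
  then show "b = c"
  proof cases
    case (step a b')
    then show ?thesis using chain_pair_free(7)[OF assms step(3)] nxt_props[OF step(4)] by simp
  qed simp
qed (simp add: chain_pair.base)

lemma chain_pair_nxt_iff:
  assumes "i \<in> piv_rows" "free_nxt_col i c" "c \<noteq> nxt i" "i < a" "a \<in> piv_rows"
  shows "chain_pair (nxt i) c (nxt a) b \<longleftrightarrow> (\<exists>d. d \<in> piv_rows \<and> b = nxt d \<and> chain_pair (nxt i) c a d)"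
proof
  assume "chain_pair (nxt i) c (nxt a) b"
  then show "\<exists>d. d \<in> piv_rows \<and> b = nxt d \<and> chain_pair (nxt i) c a d"
  proof cases
    case base
    then show ?thesis using nxt_inj[OF assms(5,1)] assms(4) by auto
  next
    case (step a' b')
    then have "a' = a" using nxt_inj[of a' a] assms by auto
    then show ?thesis using step by auto
  qed
qed (use assms chain_pair.step in auto)

lemma chain_hom_supp:
  assumes "i \<in> piv_rows"
  shows "supp_in n (chain_hom i \<delta>) (\<lambda>a b. lab a = lab i \<and> lab i < lab b \<and> blk a \<le> blk b \<and> i < a \<and> i < b)"
  unfolding supp_in_def
proof (intro conjI allI impI chain_hom_carrier)
  fix a b assume "a < n" "b < n" "chain_hom i \<delta> $$ (a, b) \<noteq> 0"
  then obtain c where c: "free_nxt_col i c" "c \<noteq> nxt i" "chain_pair (nxt i) c a b"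
    using chain_hom_nonzeroE by metis
  note t = chain_pair_free[OF assms c]
  show "lab a = lab i" "lab i < lab b" "blk a \<le> blk b" "i < a" "i < b" using t by auto
qed

lemma chain_hom_supp_strict:
  assumes "i \<in> piv_rows" "\<And>c. blk c \<le> nb i \<Longrightarrow> \<delta> c = 0"
  shows "supp_in n (chain_hom i \<delta>) (\<lambda>a b. blk a < blk b)"
  unfolding supp_in_def
proof (intro conjI allI impI chain_hom_carrier)
  fix a b assume "a < n" "b < n" "chain_hom i \<delta> $$ (a, b) \<noteq> 0"
  then obtain c where c: "free_nxt_col i c" "c \<noteq> nxt i" "chain_pair (nxt i) c a b" "\<delta> c \<noteq> 0"
    using chain_hom_nonzeroE by metis
  then have "nb i < blk c" using assms(2)[of c] by force
  then show "blk a < blk b" using chain_pair_free(6)[OF assms(1) c(1-3)] by simp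
qed

text \<open>
  The image lies in chains of label larger than \<open>lab i\<close>, and these are killed.
\<close>

lemma chain_hom_square: "i \<in> piv_rows \<Longrightarrow> chain_hom i \<delta> * chain_hom i \<delta> = 0\<^sub>m n n"
  by (rule supp_in_mult_zero[OF chain_hom_supp chain_hom_supp]) auto

lemma chain_hom_row:
  assumes "i \<in> piv_rows" "b < n"
  shows "chain_hom i \<delta> $$ (nxt i, b) = (if free_nxt_col i b \<and> b \<noteq> nxt i then \<delta> b else 0)"
proof -
  have "chain_hom i \<delta> $$ (nxt i, b) =
    (\<Sum>c\<in>{c. free_nxt_col i c \<and> c \<noteq> nxt i}. if chain_pair (nxt i) c (nxt i) b then \<delta> c else 0)"
    using assms nxt_props(1)[OF assms(1)] by (simp add: chain_hom_def)
  also have "\<dots> = (\<Sum>c\<in>{c. free_nxt_col i c \<and> c \<noteq> nxt i}. if b = c then \<delta> c else 0)"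
    by (rule sum.cong) (auto simp: chain_pair_start[OF assms(1)])
  also have "\<dots> = (if free_nxt_col i b \<and> b \<noteq> nxt i then \<delta> b else 0)"
    by (subst sum.delta'[OF finite_free_nxt]) simp
  finally show ?thesis .
qed

lemma chain_hom_other_row:
  assumes "i \<in> piv_rows" "a < n" "b < n" "a \<noteq> nxt i" "chain_hom i \<delta> $$ (a, b) \<noteq> 0"
  shows "\<exists>d>i. d \<in> piv_rows \<and> nxt d = b"
proof -
  obtain c where c: "free_nxt_col i c" "c \<noteq> nxt i" "chain_pair (nxt i) c a b" "\<delta> c \<noteq> 0"
    using assms chain_hom_nonzeroE by metis
  from c(3) show ?thesis
  proof cases
    case base then show ?thesis using assms by simp
  next
    case (step a' b')
    then show ?thesis using chain_pair_free(10)[OF assms(1) c(1,2) step(3)] by auto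
  qed
qed

text \<open>
  Row vectors form a module over the polynomials in \<open>chain (Suc i)\<close>, a direct sum
  of chains. The chain that starts in \<open>nxt i\<close> may be mapped to one that starts in
  another free column because the latter, having a larger label and starting no earlier, takes
  no more steps.
\<close>

lemma chain_hom_commutes:
  fixes \<delta> :: "nat \<Rightarrow> 'a::field"
  assumes "i \<in> piv_rows"
  shows "chain_hom i \<delta> * chain (Suc i) = chain (Suc i) * chain_hom i \<delta>"
proof (rule eq_matI)
  let ?F = "{c. free_nxt_col i c \<and> c \<noteq> nxt i}"
  note car = chain_hom_carrier[of i \<delta>] chain_carrier[where 'a='a and i="Suc i"]
  fix a b assume "a < dim_row (chain (Suc i) * chain_hom i \<delta>)" "b < dim_col (chain (Suc i) * chain_hom i \<delta>)"
  then have ab: "a < n" "b < n" using car by auto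
  have "(chain_hom i \<delta> * chain (Suc i)) $$ (a, b) =
      (\<Sum>d<n. \<Sum>c\<in>?F. (if chain_pair (nxt i) c a d then \<delta> c else 0) * (if i < d \<and> d \<in> piv_rows \<and> b = nxt d then 1 else 0))"
    using ab by (subst mult_entry[OF car(1,2) ab]) (simp add: chain_hom_def chain_def Suc_le_eq sum_distrib_right)
  also have "\<dots> = (\<Sum>c\<in>?F. \<Sum>d<n. (if chain_pair (nxt i) c a d then \<delta> c else 0) * (if i < d \<and> d \<in> piv_rows \<and> b = nxt d then 1 else 0))"
    by (rule sum.swap)
  also have "\<dots> = (\<Sum>c\<in>?F. if a \<in> piv_rows \<and> i < a \<and> chain_pair (nxt i) c (nxt a) b then \<delta> c else 0)"
  proof (rule sum.cong[OF refl])
    fix c assume c: "c \<in> ?F"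
    show "(\<Sum>d<n. (if chain_pair (nxt i) c a d then \<delta> c else 0) * (if i < d \<and> d \<in> piv_rows \<and> b = nxt d then 1 else 0))
      = (if a \<in> piv_rows \<and> i < a \<and> chain_pair (nxt i) c (nxt a) b then \<delta> c else 0)" (is "?l = ?r")
    proof (cases "\<exists>d. d \<in> piv_rows \<and> b = nxt d \<and> chain_pair (nxt i) c a d")
      case True
      then obtain d where d: "d \<in> piv_rows" "b = nxt d" "chain_pair (nxt i) c a d" by blast
      have dp: "i < d" "a \<in> piv_rows" "i < a" using chain_pair_free[OF assms _ _ d(3)] c d by auto
      have "?l = (\<Sum>e<n. if e = d then \<delta> c else 0)"
        by (rule sum.cong) (use d dp nxt_inj in auto)
      also have "\<dots> = \<delta> c" using piv_rows_less[OF d(1)] by simp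
      also have "\<dots> = ?r" using d dp c chain_pair.step by auto
      finally show ?thesis .
    next
      case False
      then have "?l = 0" by (intro sum.neutral) auto
      moreover have "?r = 0" using False chain_pair_nxt_iff[OF assms] c by auto
      ultimately show ?thesis by simp
    qed
  qed
  also have "\<dots> = (if a \<in> piv_rows \<and> i < a then chain_hom i \<delta> $$ (nxt a, b) else 0)"
    using ab nxt_props(1) by (auto simp: chain_hom_def)
  also have "\<dots> = (\<Sum>d<n. if d = nxt a then (if a \<in> piv_rows \<and> i < a then chain_hom i \<delta> $$ (d, b) else 0) else 0)"
    using nxt_props(1)[of a] by simp
  also have "\<dots> = (chain (Suc i) * chain_hom i \<delta>) $$ (a, b)"
    unfolding mult_entry[OF car(2,1) ab] by (rule sum.cong) (use ab in \<open>auto simp: chain_def Suc_le_eq\<close>)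
  finally show "(chain_hom i \<delta> * chain (Suc i)) $$ (a, b) = (chain (Suc i) * chain_hom i \<delta>) $$ (a, b)" .
qed (use chain_hom_carrier[of i \<delta>] chain_carrier[where 'a='a and i="Suc i"] in auto)

lemma chain_T_chain:
  fixes A :: "'a::field mat"
  assumes "supp_in n A (\<lambda>a b. \<exists>d\<ge>i. d \<in> piv_rows \<and> nxt d = b)"
  shows "A * chain_T i * chain i = A"
proof -
  have "chain_T i * chain i = mat n n (\<lambda>(b, b'). if b = b' \<and> (\<exists>d\<ge>i. d \<in> piv_rows \<and> nxt d = b) then 1 else (0::'a))"
    (is "_ = ?P")
  proof (rule eq_matI)
    fix b b' assume "b < dim_row ?P" "b' < dim_col ?P"
    then have b: "b < n" "b' < n" by auto
    have "(chain_T i * chain i) $$ (b, b') = (\<Sum>d<n. if i \<le> d \<and> d \<in> piv_rows \<and> b = nxt d \<and> b' = nxt d then 1 else (0::'a))"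
      unfolding mult_entry[OF chain_carrier(2,1) b]
      by (rule sum.cong) (use b in \<open>auto simp: chain_def chain_T_def\<close>)
    also have "\<dots> = ?P $$ (b, b')"
    proof (cases "b = b' \<and> (\<exists>d\<ge>i. d \<in> piv_rows \<and> nxt d = b)")
      case True
      then obtain d where d: "d \<ge> i" "d \<in> piv_rows" "nxt d = b" by auto
      have "(\<Sum>d<n. if i \<le> d \<and> d \<in> piv_rows \<and> b = nxt d \<and> b' = nxt d then 1 else 0) = (\<Sum>e<n. if e = d then 1 else (0::'a))"
        by (rule sum.cong) (use True d nxt_inj in auto)
      then show ?thesis using True b piv_rows_less[OF d(2)] by auto
    next
      case False
      then have "(\<Sum>d<n. if i \<le> d \<and> d \<in> piv_rows \<and> b = nxt d \<and> b' = nxt d then 1 else (0::'a)) = 0"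
        by (intro sum.neutral) auto
      then show ?thesis using False b by auto
    qed
    finally show "(chain_T i * chain i) $$ (b, b') = ?P $$ (b, b')" .
  qed (use chain_carrier[where 'a='a] in auto)
  moreover have "A * ?P = A"
  proof (rule eq_matI)
    fix a b assume "a < dim_row A" "b < dim_col A"
    then have ab: "a < n" "b < n" using supp_in_carrier[OF assms] by auto
    have "(A * ?P) $$ (a, b) = (\<Sum>d<n. A $$ (a, d) * ?P $$ (d, b))"
      by (rule mult_entry) (use supp_in_carrier[OF assms] ab in auto)
    also have "\<dots> = (\<Sum>d<n. if d = b then A $$ (a, d) else 0)"
      by (rule sum.cong) (use ab assms in \<open>auto simp: supp_in_def\<close>)
    also have "\<dots> = A $$ (a, b)" using ab by simp
    finally show "(A * ?P) $$ (a, b) = A $$ (a, b)" .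
  qed (use supp_in_carrier[OF assms] in auto)
  ultimately show ?thesis
    using assoc_mult_mat[OF supp_in_carrier[OF assms] chain_carrier(2) chain_carrier(1)] by simp
qed

lemma normal_supp_row: "normal_supp i k b \<Longrightarrow> k \<in> piv_rows \<Longrightarrow> b = piv k \<or> (\<exists>k'>k. k' \<in> piv_rows \<and> b = piv k')"
  unfolding normal_supp_def by auto

text \<open>
  Let \<open>e\<^sub>k\<close> be the unit row vectors. The vector \<open>e\<^sub>k y\<close>
  is a nonzero multiple of the unit vector of column \<open>piv k\<close> plus multiples of
  those of columns \<open>piv k'\<close> with \<open>k' > k\<close>. Since \<open>e\<^sub>k y
  H = e\<^sub>k H chain\<close>, downward induction on \<open>k\<close> shows that
  \<open>H\<close> maps the unit vectors of the pivot columns into the image of the chain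
  matrix. So these columns span the row space of \<open>y\<close>.
\<close>

lemma pivot_rows_in_image:
  fixes H y :: "'a::field mat"
  assumes H: "H \<in> carrier_mat n n" "H * chain (Suc i) = y * H"
    and y: "y \<in> carrier_mat n n" "\<forall>a<n. \<forall>b<n. y $$ (a, b) \<noteq> 0 \<longleftrightarrow> normal_supp (Suc i) a b"
    and c: "c < n" "\<And>d. i < d \<Longrightarrow> d \<in> piv_rows \<Longrightarrow> nxt d \<noteq> c"
  shows "i < k \<Longrightarrow> k \<in> piv_rows \<Longrightarrow> H $$ (piv k, c) = 0"
proof (induction "n - k" arbitrary: k rule: less_induct)
  case less
  note kn = piv_rows_less[OF less.prems(2)] and pk = piv_props(1)[OF less.prems(2)]
  have "(\<Sum>b<n. y $$ (k, b) * H $$ (b, c)) = (y * H) $$ (k, c)"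
    by (rule mult_entry[symmetric]) (use y H kn c in auto)
  also have "\<dots> = (\<Sum>b<n. H $$ (k, b) * chain (Suc i) $$ (b, c))"
    unfolding H(2)[symmetric] by (rule mult_entry) (use chain_carrier H kn c in auto)
  also have "\<dots> = 0"
    by (rule sum.neutral) (use c in \<open>auto simp: chain_def Suc_le_eq\<close>)
  finally have z: "(\<Sum>b<n. y $$ (k, b) * H $$ (b, c)) = 0" .
  have "(\<Sum>b<n. y $$ (k, b) * H $$ (b, c)) = (\<Sum>b<n. if b = piv k then y $$ (k, b) * H $$ (b, c) else 0)"
  proof (rule sum.cong[OF refl])
    fix b assume "b \<in> {..<n}"
    then have b: "b < n" by simp
    show "y $$ (k, b) * H $$ (b, c) = (if b = piv k then y $$ (k, b) * H $$ (b, c) else 0)"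
    proof (cases "b = piv k \<or> y $$ (k, b) = 0")
      case False
      then have "normal_supp (Suc i) k b" using y b kn by auto
      then obtain k' where k': "k' > k" "k' \<in> piv_rows" "b = piv k'"
        using normal_supp_row[of "Suc i" k b] less.prems False by auto
      then have "H $$ (b, c) = 0" using less.hyps[of k'] less.prems piv_rows_less[of k'] by auto
      then show ?thesis by auto
    qed auto
  qed
  also have "\<dots> = y $$ (k, piv k) * H $$ (piv k, c)" using pk by simp
  finally have "y $$ (k, piv k) * H $$ (piv k, c) = 0" using z by simp
  moreover have "y $$ (k, piv k) \<noteq> 0" using y kn pk less.prems by (auto simp: normal_supp_def)
  ultimately show ?case by simp
qed

section \<open>Adding a row to a normal form\<close>

text \<open>
  Elements of this kind fix, from the left, a matrix that is concentrated in the row \<open>i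
  - 1\<close>, which is the next one to be added.
\<close>

definition acts_from :: "nat \<Rightarrow> 'a::field mat \<Rightarrow> bool" where
  "acts_from i g \<longleftrightarrow> g \<in> carrier_mat n n \<and>
     (\<forall>a<n. \<forall>b<n. a < i \<or> b < i \<longrightarrow> g $$ (a, b) = (if a = b then 1 else 0))"

definition blockupper :: "'a::field mat \<Rightarrow> bool" where
  "blockupper g \<longleftrightarrow> supp_in n g (\<lambda>a b. blk a \<le> blk b)"

definition upper :: "'a::field mat \<Rightarrow> bool" where
  "upper g \<longleftrightarrow> supp_in n g (\<le>)"

lemma acts_from_Suc: "acts_from (Suc i) g \<Longrightarrow> acts_from i g"
  by (simp add: acts_from_def)

lemma acts_from_mult:
  assumes "acts_from i g" "acts_from i k"
  shows "acts_from i (g * k)"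
  unfolding acts_from_def
proof (intro conjI allI impI)
  have c: "g \<in> carrier_mat n n" "k \<in> carrier_mat n n" using assms by (auto simp: acts_from_def)
  then show "g * k \<in> carrier_mat n n" by simp
  fix a b assume ab: "a < n" "b < n" "a < i \<or> b < i"
  have "(g * k) $$ (a, b) = (\<Sum>d<n. g $$ (a, d) * k $$ (d, b))" using mult_entry[OF c ab(1,2)] .
  also have "\<dots> = (\<Sum>d<n. if d = (if a < i then a else b) then (if a = b then 1 else 0) else 0)"
    by (rule sum.cong) (use assms ab in \<open>auto simp: acts_from_def\<close>)
  also have "\<dots> = (if a = b then 1 else 0)" using ab by simp
  finally show "(g * k) $$ (a, b) = (if a = b then 1 else 0)" .
qed

lemma acts_from_unipotent:
  assumes "supp_in n N (\<lambda>a b. i \<le> a \<and> i \<le> b)"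
  shows "acts_from i (1\<^sub>m n + N)" "acts_from i (1\<^sub>m n - N)"
proof -
  have c: "N \<in> carrier_mat n n" using assms by (simp add: supp_in_def)
  have z: "N $$ (a, b) = 0" if "a < n" "b < n" "a < i \<or> b < i" for a b
    using assms that unfolding supp_in_def by force
  show "acts_from i (1\<^sub>m n + N)" "acts_from i (1\<^sub>m n - N)"
    using c z by (auto simp: acts_from_def)
qed

lemma acts_from_supp: "acts_from i g \<Longrightarrow> supp_in n g (\<lambda>a b. a = b \<or> (i \<le> a \<and> i \<le> b))"
  unfolding acts_from_def supp_in_def by (metis not_le)

lemma acts_from_row:
  assumes g: "acts_from (Suc i) g" and V: "supp_in n V \<rho>" and row: "\<And>a b. \<rho> a b \<Longrightarrow> a = i"
  shows "g * V = V"
proof (rule eq_matI)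
  have c: "V \<in> carrier_mat n n" "g \<in> carrier_mat n n" using g V by (auto simp: acts_from_def supp_in_def)
  fix a b assume "a < dim_row V" "b < dim_col V"
  then have ab: "a < n" "b < n" using c by auto
  have "(g * V) $$ (a, b) = (\<Sum>d<n. g $$ (a, d) * V $$ (d, b))" using mult_entry[OF c(2,1) ab] .
  also have "\<dots> = (\<Sum>d<n. if d = a then V $$ (d, b) else 0)"
  proof (rule sum.cong[OF refl])
    fix d assume "d \<in> {..<n}"
    then show "g $$ (a, d) * V $$ (d, b) = (if d = a then V $$ (d, b) else 0)"
      using g V row[of d b] ab unfolding acts_from_def supp_in_def
      by (cases "V $$ (d, b) = 0") auto
  qed
  also have "\<dots> = V $$ (a, b)" using ab by simp
  finally show "(g * V) $$ (a, b) = V $$ (a, b)" .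
qed (use g V in \<open>auto simp: acts_from_def supp_in_def\<close>)

lemma upper_mult: "upper g \<Longrightarrow> upper k \<Longrightarrow> upper (g * k)"
  unfolding upper_def by (erule (1) supp_in_mult) simp

lemma blockupper_mult: "blockupper g \<Longrightarrow> blockupper k \<Longrightarrow> blockupper (g * k)"
  unfolding blockupper_def by (erule (1) supp_in_mult) simp

lemma upper_unipotent:
  assumes "supp_in n N (\<le>)" shows "upper (1\<^sub>m n + N)" "upper (1\<^sub>m n - N)"
  unfolding upper_def using assms by (intro supp_in_add supp_in_diff supp_in_one; simp)+

lemma blockupper_unipotent:
  assumes "supp_in n N (\<lambda>a b. blk a \<le> blk b)" shows "blockupper (1\<^sub>m n + N)" "blockupper (1\<^sub>m n - N)"
  unfolding blockupper_def using assms by (intro supp_in_add supp_in_diff supp_in_one; simp)+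

text \<open>
  Besides the conjugation \<open>g\<close> in \<open>B\<close> to the normal form
  \<open>y\<close>, a conjugation \<open>h\<close> in \<open>P\<close> from the chain model to
  \<open>y\<close> is carried along: it turns homomorphisms of chains into matrices that
  commute with \<open>y\<close>.
\<close>

definition normalizes ::
  "nat \<Rightarrow> 'a::field mat \<Rightarrow> 'a mat \<Rightarrow> 'a mat \<Rightarrow> 'a mat \<Rightarrow> 'a mat \<Rightarrow> 'a mat \<Rightarrow> bool" where
  "normalizes i x g g' h h' y \<longleftrightarrow>
     acts_from i g \<and> acts_from i g' \<and> acts_from i h \<and> acts_from i h' \<and>
     upper g \<and> upper g' \<and> blockupper h \<and> blockupper h' \<and>
     conjugates n g g' x y \<and> conjugates n h h' (chain i) y \<and>
     (\<forall>a<n. \<forall>b<n. y $$ (a, b) \<noteq> 0 \<longleftrightarrow> normal_supp i a b)"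

text \<open>
  The entries of a new row \<open>i\<close> that lower rows cannot clear are those in free
  columns. They lie in the block \<open>nb i\<close>, from the column \<open>piv i\<close> on,
  and in later blocks.
\<close>

definition block_part :: "nat \<Rightarrow> 'a::field mat \<Rightarrow> 'a mat" where
  "block_part i W = mat n n (\<lambda>(a, b). if blk b = nb i \<and> piv i \<le> b then W $$ (a, b) else 0)"

definition later_part :: "nat \<Rightarrow> 'a::field mat \<Rightarrow> 'a mat" where
  "later_part i W = mat n n (\<lambda>(a, b). if nb i < blk b \<and> free_piv_col i b then W $$ (a, b) else 0)"

text \<open>
  Here the row is expressed in the coordinates of the chain model.
\<close>

definition free_part :: "nat \<Rightarrow> 'a::field mat \<Rightarrow> 'a mat" where
  "free_part i A = mat n n (\<lambda>(a, b). if free_nxt_col i b then A $$ (a, b) else 0)"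

text \<open>
  The coefficients for which \<open>chain_hom\<close> moves the row \<open>A\<close> to the
  part of the row \<open>B\<close> in later free columns, modulo the image of the chain
  matrix.
\<close>

definition later_ratio :: "nat \<Rightarrow> 'a::field mat \<Rightarrow> 'a mat \<Rightarrow> nat \<Rightarrow> 'a" where
  "later_ratio i A B c = (if nb i < blk c then B $$ (i, c) / A $$ (i, nxt i) else 0)"

definition row_ratio :: "nat \<Rightarrow> 'a::field mat \<Rightarrow> nat \<Rightarrow> 'a" where
  "row_ratio i A c = A $$ (i, c) / A $$ (i, nxt i)"

text \<open>
  Conjugation by \<open>1 + col_clear i W\<close> clears the row \<open>i\<close> of
  \<open>W\<close> behind its entry in column \<open>piv i\<close>; the row operation that
  goes with it adds multiples of later rows of the block \<open>nb i\<close> to row \<open>piv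
  i\<close>.
\<close>

definition col_clear :: "nat \<Rightarrow> 'a::field mat \<Rightarrow> 'a mat" where
  "col_clear i W = mat n n (\<lambda>(a, b).
     if a = piv i \<and> blk b = nb i \<and> piv i < b then W $$ (i, b) / W $$ (i, piv i) else 0)"

definition row_scale :: "nat \<Rightarrow> 'a::field \<Rightarrow> 'a mat" where
  "row_scale i c = mat n n (\<lambda>(a, b). if a = b then (if a = i then c else 1) else 0)"

lemma part_carrier:
  fixes W :: "'a::field mat" and c :: 'a
  shows
  "block_part i W \<in> carrier_mat n n" "later_part i W \<in> carrier_mat n n" "free_part i W \<in> carrier_mat n n"
  "col_clear i W \<in> carrier_mat n n" "row_scale i c \<in> carrier_mat n n"
  by (simp_all add: block_part_def later_part_def free_part_def col_clear_def row_scale_def)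

lemma normal_supp_props:
  assumes "normal_supp i a b"
  shows "i \<le> a \<and> a < b \<and> blk a < blk b \<and> (\<exists>d\<ge>i. d \<in> piv_rows \<and> b = piv d)"
  using assms unfolding normal_supp_def
proof (elim disjE exE conjE)
  assume "i \<le> a" "a \<in> piv_rows" "b = piv a"
  then show ?thesis using piv_props[of a] nb_props[of a] by auto
next
  fix h k assume "i \<le> h" "h \<in> piv_rows" "piv h = a" "k \<in> piv_rows" "blk k = blk a" "a < k" "b = piv k"
  then show ?thesis using piv_props[of h] piv_props[of k] nb_props[of k] by (intro conjI exI[of _ k]) auto
qed

text \<open>
  The third kind of entry of a new row: pivot columns of lower rows.
\<close>

lemma uncovered_free:
  assumes "i < n" "b < n" "blk i < blk b"
    and "\<not> (blk b = nb i \<and> piv i \<le> b)" "\<not> (nb i < blk b \<and> free_piv_col i b)"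
  shows "\<exists>d>i. d \<in> piv_rows \<and> piv d = b"
proof (rule ccontr)
  assume c: "\<not> ?thesis"
  then have "nb i \<le> blk b" "nb i = blk b \<Longrightarrow> piv i \<le> b" using free_piv[OF assms(1-3)] by auto
  then show False using c assms by (auto simp: free_piv_col_def)
qed

lemma row_scale_conjugates:
  assumes i: "i \<in> piv_rows" and c: "c \<noteq> 0"
  shows "conjugates n (row_scale i c) (row_scale i (inverse c)) (chain i)
    (mat n n (\<lambda>(a, b). if a = i \<and> b = nxt i then c else 0) + chain (Suc i))"
proof -
  have l: "(row_scale i e * M) $$ (a, b) = (if a = i then e else 1) * M $$ (a, b)"
    if "M \<in> carrier_mat n n" "a < n" "b < n" for e and M :: "'a mat" and a b
  proof -
    have "(row_scale i e * M) $$ (a, b) = (\<Sum>d<n. if d = a then (if a = i then e else 1) * M $$ (a, b) else 0)"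
      unfolding mult_entry[OF part_carrier(5) that]
      by (rule sum.cong) (use that in \<open>auto simp: row_scale_def\<close>)
    then show ?thesis using that by simp
  qed
  have rr: "(M * row_scale i e) $$ (a, b) = M $$ (a, b) * (if b = i then e else 1)"
    if "M \<in> carrier_mat n n" "a < n" "b < n" for e and M :: "'a mat" and a b
  proof -
    have "(M * row_scale i e) $$ (a, b) = (\<Sum>d<n. if d = b then M $$ (a, b) * (if b = i then e else 1) else 0)"
      unfolding mult_entry[OF that(1) part_carrier(5) that(2,3)]
      by (rule sum.cong) (use that in \<open>auto simp: row_scale_def\<close>)
    then show ?thesis using that by simp
  qed
  note car = part_carrier(5)[where 'a='a] chain_carrier(1)[where 'a='a]
  have inv: "row_scale i e * row_scale i (inverse e) = 1\<^sub>m n" if "e \<noteq> 0" for e :: 'a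
  proof (rule eq_matI)
    fix a b assume "a < dim_row (1\<^sub>m n)" "b < dim_col (1\<^sub>m n)"
    then have ab: "a < n" "b < n" by auto
    have "(row_scale i e * row_scale i (inverse e)) $$ (a, b)
        = (if a = i then e else 1) * row_scale i (inverse e) $$ (a, b)"
      using l car ab by blast
    then show "(row_scale i e * row_scale i (inverse e)) $$ (a, b) = 1\<^sub>m n $$ (a, b)"
      using ab that by (auto simp: row_scale_def)
  qed (auto simp: row_scale_def)
  have x: "nxt a \<noteq> i" if "i \<le> a" "a \<in> piv_rows" for a using nxt_props[OF that(2)] that by simp
  have "row_scale i c * chain i =
      (mat n n (\<lambda>(a, b). if a = i \<and> b = nxt i then c else 0) + chain (Suc i)) * row_scale i c"
    (is "?l = ?r")
  proof (rule eq_matI)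
    fix a b assume "a < dim_row ?r" "b < dim_col ?r"
    then have ab: "a < n" "b < n" using car by (auto simp: chain_def row_scale_def)
    have "?l $$ (a, b) = (if a = i then c else 1) * chain i $$ (a, b)" using l car ab by blast
    moreover have "?r $$ (a, b) = (mat n n (\<lambda>(a, b). if a = i \<and> b = nxt i then c else 0) + chain (Suc i)) $$ (a, b)
      * (if b = i then c else 1)" using rr car ab by simp
    ultimately show "?l $$ (a, b) = ?r $$ (a, b)" using ab i x car by (auto simp: chain_def)
  qed (auto simp: chain_def row_scale_def)
  then show ?thesis using inv[of c] inv[of "inverse c"] c car by (simp add: conjugates_def)
qed

text \<open>
  Adding the combination \<open>- U\<close> of lower rows to row \<open>i\<close> changes it
  by \<open>- U * y\<close>. Every \<open>W - X\<close> that \<open>H\<close> maps into the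
  image of the chain matrix is of the form \<open>U * y\<close>, because
  \<open>chain_T\<close> inverts the chain matrix there. No compensating column operation is
  visible, as column \<open>i\<close> is zero.
\<close>

lemma clear_row_conjugates:
  fixes y W K H H' :: "'a::field mat"
  assumes hh: "conjugates n H H' (chain (Suc i)) y"
    and acts: "acts_from (Suc i) H'"
    and W: "supp_in n W (\<lambda>a b. a = i \<and> blk i < blk b)"
    and X: "supp_in n X (\<lambda>a b. a = i \<and> blk i < blk b)"
    and y: "supp_in n y (\<lambda>a b. i < a \<and> i < b)"
    and img: "supp_in n ((W - X) * H) (\<lambda>a b. \<exists>d\<ge>Suc i. d \<in> piv_rows \<and> nxt d = b)"
    and U: "U = (W - X) * H * chain_T (Suc i) * H'"
  shows "conjugates n (1\<^sub>m n - U) (1\<^sub>m n + U) (W + y) (X + y)" "supp_in n U (\<lambda>a b. a = i \<and> i < b)"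
proof -
  have c: "H \<in> carrier_mat n n" "H' \<in> carrier_mat n n" "y \<in> carrier_mat n n" "W \<in> carrier_mat n n"
    "X \<in> carrier_mat n n" "H * chain (Suc i) = y * H" "H * H' = 1\<^sub>m n" "H' * H = 1\<^sub>m n"
    using hh W X by (auto simp: conjugates_def supp_in_def)
  note cc = chain_carrier[where 'a='a and i="Suc i"]
  note as = assoc_mult_mat[of _ n n _ n _ n]
  have D: "supp_in n (W - X) (\<lambda>a b. a = i)"
    by (intro supp_in_diff supp_in_mono[OF W] supp_in_mono[OF X]) auto
  note Dc = supp_in_carrier[OF D]
  have T: "supp_in n (chain_T (Suc i) :: 'a mat) (\<lambda>a b. i < b)"
    by (auto simp: supp_in_def chain_T_def)
  have 1: "supp_in n ((W - X) * H) (\<lambda>a b. a = i)"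
    by (rule supp_in_mult[OF D, of _ "\<lambda>_ _. True"]) (use c in \<open>auto simp: supp_in_def\<close>)
  have 2: "supp_in n ((W - X) * H * chain_T (Suc i)) (\<lambda>a b. a = i \<and> i < b)"
    by (rule supp_in_mult[OF 1 T]) auto
  show Us: "supp_in n U (\<lambda>a b. a = i \<and> i < b)" unfolding U
    by (rule supp_in_mult[OF 2 acts_from_supp[OF acts]]) auto
  note Uc = supp_in_carrier[OF Us]
  have Hy: "H' * y = chain (Suc i) * H'" using conjugates_sym[OF hh] by (simp add: conjugates_def)
  have "U * y = (W - X) * H * chain_T (Suc i) * (H' * y)"
    unfolding U by (rule as) (use c cc Dc in auto)
  also have "\<dots> = (W - X) * H * chain_T (Suc i) * chain (Suc i) * H'"
    unfolding Hy by (rule as[symmetric]) (use c cc Dc in auto)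
  also have "\<dots> = (W - X) * H * H'" unfolding chain_T_chain[OF img] ..
  also have "\<dots> = (W - X) * (H * H')" by (rule as) (use c Dc in auto)
  also have "\<dots> = W - X" using c Dc by simp
  finally have Uy: "U * y = W - X" .
  have UW: "U * W = 0\<^sub>m n n" by (rule supp_in_mult_zero[OF Us W]) auto
  have "supp_in n (X + y) (\<lambda>a b. b \<noteq> i)"
    by (intro supp_in_add supp_in_mono[OF X] supp_in_mono[OF y]) auto
  then have XU: "(X + y) * U = 0\<^sub>m n n" by (rule supp_in_mult_zero[OF _ Us]) auto
  have UU: "U * U = 0\<^sub>m n n" by (rule supp_in_mult_zero[OF Us Us]) auto
  have "U * (W + y) = U * W + U * y" using c Uc by (simp add: mult_add_distrib_mat[of _ n n _ n])
  then have UWy: "U * (W + y) = W - X" unfolding UW Uy left_add_zero_mat[OF Dc] .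
  show "conjugates n (1\<^sub>m n - U) (1\<^sub>m n + U) (W + y) (X + y)"
  proof (rule conjugates_unipotent_minus[OF Uc _ _ UU])
    show "W + y + (X + y) * U = X + y + U * (W + y)"
      unfolding XU UWy by (rule eq_matI) (use c Dc in auto)
  qed (use c in auto)
qed

text \<open>
  Conjugation by an endomorphism \<open>1 + \<theta>\<close> of the module of row vectors
  fixes \<open>y\<close> and changes only the new row.
\<close>

lemma module_hom_conjugates:
  fixes y W \<theta> :: "'a::field mat"
  assumes W: "supp_in n W (\<lambda>a b. a = i)" and y: "y \<in> carrier_mat n n"
    and \<theta>: "supp_in n \<theta> (\<lambda>a b. i < a \<and> i < b)" "\<theta> * \<theta> = 0\<^sub>m n n" "\<theta> * y = y * \<theta>"
  shows "conjugates n (1\<^sub>m n + \<theta>) (1\<^sub>m n - \<theta>) (W + W * \<theta> + y) (W + y)"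
    "conjugates n (1\<^sub>m n - \<theta>) (1\<^sub>m n + \<theta>) (W + y) (W + W * \<theta> + y)"
proof -
  have c: "W \<in> carrier_mat n n" "\<theta> \<in> carrier_mat n n" using W \<theta> by (auto simp: supp_in_def)
  define M where "M = W * \<theta>"
  have M: "M \<in> carrier_mat n n" using c by (simp add: M_def)
  have 1: "\<theta> * W = 0\<^sub>m n n" by (rule supp_in_mult_zero[OF \<theta>(1) W]) auto
  have 2: "\<theta> * M = 0\<^sub>m n n" using 1 c by (simp add: M_def assoc_mult_mat[of _ n n _ n _ n, symmetric])
  have 3: "M * \<theta> = 0\<^sub>m n n" using \<theta>(2) c by (simp add: M_def assoc_mult_mat[of _ n n _ n _ n])
  have l: "\<theta> * (W + M + y) = \<theta> * y" "\<theta> * (W + y) = \<theta> * y"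
    using c y M 1 2 by (simp_all add: mult_add_distrib_mat[of _ n n _ n])
  have r: "(W + y) * \<theta> = M + y * \<theta>" "(W + M + y) * \<theta> = M + y * \<theta>"
    using c y M 3 by (simp_all add: add_mult_distrib_mat[of _ n n _ _ n] M_def[symmetric])
  define L where "L = y * \<theta>"
  have L: "L \<in> carrier_mat n n" using c y by (simp add: L_def)
  have e1: "W + M + y + \<theta> * (W + M + y) = W + y + (W + y) * \<theta>"
    unfolding l r \<theta>(3) L_def[symmetric] by (rule eq_matI) (use c y M L in auto)
  have e2: "W + y + (W + M + y) * \<theta> = W + M + y + \<theta> * (W + y)"
    unfolding l r \<theta>(3) L_def[symmetric] by (rule eq_matI) (use c y M L in auto)
  show "conjugates n (1\<^sub>m n + \<theta>) (1\<^sub>m n - \<theta>) (W + W * \<theta> + y) (W + y)"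
    unfolding M_def[symmetric]
    by (rule conjugates_unipotent[OF c(2) _ _ \<theta>(2) e1]) (use c y M in auto)
  show "conjugates n (1\<^sub>m n - \<theta>) (1\<^sub>m n + \<theta>) (W + y) (W + W * \<theta> + y)"
    unfolding M_def[symmetric]
    by (rule conjugates_unipotent_minus[OF c(2) _ _ \<theta>(2) e2]) (use c y M in auto)
qed

definition row_entry :: "nat \<Rightarrow> nat \<Rightarrow> 'a::field \<Rightarrow> 'a mat" where
  "row_entry i j c = mat n n (\<lambda>(a, b). if a = i \<and> b = j then c else 0)"

text \<open>
  Column \<open>piv i\<close> of \<open>y\<close> is still zero, so the column operation
  affects the new row only.
\<close>

lemma col_clear_conjugates:
  fixes W y :: "'a::field mat"
  assumes i: "i \<in> piv_rows" and W: "supp_in n W (\<lambda>a b. a = i \<and> blk b = nb i \<and> piv i \<le> b)"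
    and nz: "W $$ (i, piv i) \<noteq> 0"
    and y: "y \<in> carrier_mat n n" "\<forall>a<n. \<forall>b<n. y $$ (a, b) \<noteq> 0 \<longleftrightarrow> normal_supp (Suc i) a b"
  shows "conjugates n (1\<^sub>m n + col_clear i W) (1\<^sub>m n - col_clear i W) (W + y)
    (row_entry i (piv i) (W $$ (i, piv i)) + y + col_clear i W * y)"
proof -
  define N E where "N = col_clear i W" and "E = row_entry i (piv i) (W $$ (i, piv i))"
  have Ns: "supp_in n N (\<lambda>a b. a = piv i \<and> piv i < b)"
    by (auto simp: N_def col_clear_def supp_in_def)
  have ys: "supp_in n y (\<lambda>a b. b \<noteq> piv i)"
    unfolding supp_in_def
  proof (intro conjI allI impI y(1))
    fix a b assume "a < n" "b < n" "y $$ (a, b) \<noteq> 0"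
    then have "normal_supp (Suc i) a b" using y by auto
    then show "b \<noteq> piv i" using normal_supp_props[of "Suc i" a b] piv_inj[OF i] by (metis Suc_n_not_le_n)
  qed
  note c = supp_in_carrier[OF W] supp_in_carrier[OF Ns] y(1)
  have Ec: "E \<in> carrier_mat n n" by (simp add: E_def row_entry_def)
  have NN: "N * N = 0\<^sub>m n n" by (rule supp_in_mult_zero[OF Ns Ns]) auto
  have NW: "N * W = 0\<^sub>m n n" by (rule supp_in_mult_zero[OF Ns W]) (use piv_props[OF i] in auto)
  have yN: "y * N = 0\<^sub>m n n" by (rule supp_in_mult_zero[OF ys Ns]) auto
  have NyN: "N * y * N = 0\<^sub>m n n" using c yN by (simp add: assoc_mult_mat[of _ n n _ n _ n])
  have EN: "E + E * N = W"
  proof (rule eq_matI)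
    fix a b assume "a < dim_row W" "b < dim_col W"
    then have ab: "a < n" "b < n" using c by auto
    have "(E * N) $$ (a, b) = (\<Sum>d<n. if d = piv i then E $$ (a, d) * N $$ (d, b) else 0)"
      unfolding mult_entry[OF Ec c(2) ab] by (rule sum.cong) (use ab in \<open>auto simp: E_def row_entry_def\<close>)
    also have "\<dots> = E $$ (a, piv i) * N $$ (piv i, b)" using piv_props(1)[OF i] by simp
    finally have e: "(E * N) $$ (a, b) = E $$ (a, piv i) * N $$ (piv i, b)" .
    have "(E + E * N) $$ (a, b) = E $$ (a, b) + (E * N) $$ (a, b)"
      using Ec c ab by simp
    also have "\<dots> = W $$ (a, b)"
    proof -
      have W0: "W $$ (a, b) = 0" if "\<not> (a = i \<and> blk b = nb i \<and> piv i \<le> b)"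
        using W ab that unfolding supp_in_def by blast
      have E: "E $$ (a, b) = (if a = i \<and> b = piv i then W $$ (i, piv i) else 0)"
        "E $$ (a, piv i) = (if a = i then W $$ (i, piv i) else 0)"
        using ab piv_props(1)[OF i] by (simp_all add: E_def row_entry_def)
      have N: "N $$ (piv i, b) = (if blk b = nb i \<and> piv i < b then W $$ (i, b) / W $$ (i, piv i) else 0)"
        using ab piv_props(1)[OF i] by (simp add: N_def col_clear_def)
      show ?thesis unfolding e E N
        using W0 nz piv_props(2)[OF i] by (cases "a = i"; cases "b = piv i"; cases "piv i < b") simp_all
    qed
    finally show "(E + E * N) $$ (a, b) = W $$ (a, b)" .
  qed (use Ec c in auto)
  define L where "L = N * y"
  have Lc: "L \<in> carrier_mat n n" using c by (simp add: L_def)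
  have l: "N * (W + y) = L"
    unfolding mult_add_distrib_mat[OF c(2,1,3)] NW L_def[symmetric] using Lc by simp
  have "(E + y + L) * N = E * N + y * N + L * N"
    using c Ec Lc by (simp add: add_mult_distrib_mat[of _ n n _ _ n] assoc_add_mat[of _ n n])
  then have r: "(E + y + L) * N = E * N" unfolding yN NyN[folded L_def] using Ec c by simp
  have "conjugates n (1\<^sub>m n + N) (1\<^sub>m n - N) (W + y) (E + y + L)"
  proof (rule conjugates_unipotent[OF c(2) _ _ NN])
    define K where "K = E * N"
    have Kc: "K \<in> carrier_mat n n" using Ec c by (simp add: K_def)
    show "W + y + N * (W + y) = E + y + L + (E + y + L) * N"
      unfolding l r unfolding EN[symmetric] K_def[symmetric]
      by (rule eq_matI) (use Ec c Lc Kc in auto)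
  qed (use c Ec Lc in auto)
  then show ?thesis by (simp add: N_def E_def L_def)
qed

text \<open>
  Let \<open>d\<close> be a column behind \<open>piv i\<close> in the same block. It is free,
  so row \<open>d\<close> of \<open>y\<close> contains no entry of \<open>\<Phi>\<close>: it
  is zero except in column \<open>piv d\<close>. The summand \<open>col_clear i W * y\<close>
  therefore fills exactly the positions \<open>(piv i, piv d)\<close>, and these are the
  elements of \<open>\<Phi>\<close> that the row \<open>i\<close> creates.
\<close>

lemma normal_supp_step:
  fixes W y :: "'a::field mat"
  assumes i: "i \<in> piv_rows"
    and nz: "\<And>b. b < n \<Longrightarrow> blk b = nb i \<Longrightarrow> piv i \<le> b \<Longrightarrow> W $$ (i, b) \<noteq> 0"
    and y: "y \<in> carrier_mat n n" "\<forall>a<n. \<forall>b<n. y $$ (a, b) \<noteq> 0 \<longleftrightarrow> normal_supp (Suc i) a b"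
    and ab: "a < n" "b < n"
  shows "(row_entry i (piv i) (W $$ (i, piv i)) + y + col_clear i W * y) $$ (a, b) \<noteq> 0 \<longleftrightarrow> normal_supp i a b"
proof -
  define N where "N = col_clear i W"
  have Nc: "N \<in> carrier_mat n n" by (simp add: N_def part_carrier)
  note p = piv_props[OF i]
  have yrow: "y $$ (d, b) \<noteq> 0 \<longleftrightarrow> d \<in> piv_rows \<and> b = piv d"
    if d: "d < n" "blk d = nb i" "piv i \<le> d" for d
  proof -
    have "\<not> (\<exists>h. Suc i \<le> h \<and> h \<in> piv_rows \<and> piv h = d)" using piv_not_later[OF i d(2,3)] by auto
    then show ?thesis using y ab d p(3) by (auto simp: normal_supp_def)
  qed
  \<comment> \<open>The new positions are \<open>(piv i, piv d)\<close> with \<open>d\<close> as follows.\<close>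
  let ?k = "\<lambda>d. blk d = nb i \<and> piv i < d \<and> d \<in> piv_rows \<and> b = piv d"
  have Ny: "(N * y) $$ (a, b) = (if a = piv i then \<Sum>d<n. if ?k d then N $$ (piv i, d) * y $$ (d, b) else 0 else 0)"
    unfolding mult_entry[OF Nc y(1) ab]
    using ab by (auto simp: N_def col_clear_def yrow intro!: sum.cong sum.neutral)
  have Ny_nz: "(N * y) $$ (a, b) \<noteq> 0 \<longleftrightarrow> a = piv i \<and> (\<exists>d. ?k d)"
  proof (cases "a = piv i \<and> (\<exists>d. ?k d)")
    case True
    then obtain d where d: "?k d" by blast
    have dn: "d < n" using d piv_rows_less by blast
    have "(N * y) $$ (a, b) = (\<Sum>e<n. if e = d then N $$ (piv i, d) * y $$ (d, b) else 0)"
    proof -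
      have "?k e \<longleftrightarrow> e = d" for e using d piv_inj by blast
      then have "(if ?k e then N $$ (piv i, e) * y $$ (e, b) else 0)
          = (if e = d then N $$ (piv i, d) * y $$ (d, b) else 0)" for e by simp
      then show ?thesis unfolding Ny using True by simp
    qed
    also have "\<dots> = N $$ (piv i, d) * y $$ (d, b)" using dn by simp
    also have "\<dots> \<noteq> 0" using d dn yrow[of d] nz[of d] nz[of "piv i"] p by (auto simp: N_def col_clear_def)
    finally show ?thesis using True by blast
  next
    case False
    then have "(N * y) $$ (a, b) = 0" unfolding Ny by (auto intro!: sum.neutral)
    then show ?thesis using False by blast
  qed
  have y_nz: "y $$ (a, b) \<noteq> 0 \<longleftrightarrow> normal_supp (Suc i) a b" using y ab by auto
  have Nc': "N * y \<in> carrier_mat n n" using Nc y by simp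
  have e: "(row_entry i (piv i) (W $$ (i, piv i)) + y + N * y) $$ (a, b) =
      (if a = i \<and> b = piv i then W $$ (i, piv i) else 0) + y $$ (a, b) + (N * y) $$ (a, b)"
  proof -
    have "(row_entry i (piv i) (W $$ (i, piv i)) + y + L) $$ (a, b) =
      (if a = i \<and> b = piv i then W $$ (i, piv i) else 0) + y $$ (a, b) + L $$ (a, b)"
      if "L \<in> carrier_mat n n" for L using ab that y(1) by (simp add: row_entry_def)
    from this[OF Nc'] show ?thesis .
  qed
  have W0: "W $$ (i, piv i) \<noteq> 0" using nz p by simp
  have sp: "normal_supp i a b \<longleftrightarrow> (a = i \<and> b = piv i) \<or> normal_supp (Suc i) a b \<or> (a = piv i \<and> (\<exists>d. ?k d))"
  proof
    assume "normal_supp i a b"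
    then consider "i \<le> a" "a \<in> piv_rows" "b = piv a"
      | h k where "i \<le> h" "h \<in> piv_rows" "piv h = a" "k \<in> piv_rows" "blk k = blk a" "a < k" "b = piv k"
      unfolding normal_supp_def by blast
    then show "(a = i \<and> b = piv i) \<or> normal_supp (Suc i) a b \<or> (a = piv i \<and> (\<exists>d. ?k d))"
    proof cases
      case 1
      then show ?thesis unfolding normal_supp_def by (cases "a = i") auto
    next
      case 2
      show ?thesis
      proof (cases "h = i")
        case True
        then have "?k k" using 2 p(2) by simp
        then show ?thesis using True 2(3) by blast
      next
        case False
        then have "Suc i \<le> h" using 2(1) by simp
        then have "normal_supp (Suc i) a b" unfolding normal_supp_def using 2 by blast
        then show ?thesis by blast
      qed
    qed
  next
    assume "(a = i \<and> b = piv i) \<or> normal_supp (Suc i) a b \<or> (a = piv i \<and> (\<exists>d. ?k d))"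
    then show "normal_supp i a b"
    proof (elim disjE conjE exE)
      assume "a = i" "b = piv i" then show ?thesis using i by (simp add: normal_supp_def)
    next
      assume "normal_supp (Suc i) a b" then show ?thesis unfolding normal_supp_def by (blast dest: Suc_leD)
    next
      fix d assume "a = piv i" "blk d = nb i" "piv i < d" "d \<in> piv_rows" "b = piv d"
      then show ?thesis unfolding normal_supp_def using i p(2) by (metis le_refl)
    qed
  qed
  have d1: "\<not> normal_supp (Suc i) i b" using normal_supp_props[of "Suc i" i b] by auto
  have d2: "\<not> (\<exists>d. ?k d)" if "normal_supp (Suc i) (piv i) b"
  proof -
    have no: "\<not> (\<exists>h. Suc i \<le> h \<and> h \<in> piv_rows \<and> piv h = piv i)"
      using piv_inj[OF i] by (metis Suc_n_not_le_n)
    then have "b = piv (piv i)" "piv i \<in> piv_rows" using that unfolding normal_supp_def by blast+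
    then show ?thesis using piv_inj by (metis less_irrefl)
  qed
  show ?thesis unfolding N_def[symmetric] e sp
    using W0 y_nz Ny_nz d1 d2 p(3) by (cases "a = i"; cases "a = piv i") auto
qed

lemma new_row_conjugates:
  assumes G: "acts_from (Suc i) G" "conjugates n G G' x y" and V: "supp_in n V (\<lambda>a b. a = i \<and> blk i < blk b)"
  shows "conjugates n G G' (V + x) (V * G' + y)"
proof -
  have c: "G \<in> carrier_mat n n" "G' \<in> carrier_mat n n" "x \<in> carrier_mat n n" "y \<in> carrier_mat n n"
    "V \<in> carrier_mat n n" "G * G' = 1\<^sub>m n" "G' * G = 1\<^sub>m n" "G * x = y * G"
    using G V by (auto simp: conjugates_def supp_in_def)
  have "V * G' * G = V * (G' * G)" by (rule assoc_mult_mat) (use c in auto)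
  then have V1: "V * G' * G = V" using c(5) by (simp add: c(7))
  have V2: "G * V = V" by (rule acts_from_row[OF G(1) V]) simp
  have Vc: "V * G' \<in> carrier_mat n n" using c by simp
  have "G * (V + x) = (V * G' + y) * G"
    unfolding mult_add_distrib_mat[OF c(1,5,3)] add_mult_distrib_mat[OF Vc c(4,1)] V1 V2 c(8) ..
  then show ?thesis using c Vc by (simp add: conjugates_def)
qed

lemma new_row_supp:
  assumes "upper G'" "supp_in n V (\<lambda>a b. a = i \<and> blk i < blk b)"
  shows "supp_in n (V * G') (\<lambda>a b. a = i \<and> blk i < blk b)"
  by (rule supp_in_mult[OF assms(2) assms(1)[unfolded upper_def]]) (use blk_mono le_trans less_le_trans in blast)

text \<open>
  A homomorphism of chains, transported to the coordinates of \<open>y\<close>.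
\<close>

lemma transfer_supp:
  assumes i: "i \<in> piv_rows" and H: "acts_from (Suc i) H" "acts_from (Suc i) H'" "blockupper H" "blockupper H'"
    "H * H' = 1\<^sub>m n" "H' * H = 1\<^sub>m n" and \<delta>: "\<And>c. blk c \<le> nb i \<Longrightarrow> \<delta> c = 0"
  defines "\<theta> \<equiv> H * chain_hom i \<delta> * H'"
  shows "supp_in n \<theta> (\<lambda>a b. i < a \<and> i < b)" "supp_in n \<theta> (\<lambda>a b. blk a < blk b)" "\<theta> * \<theta> = 0\<^sub>m n n"
    "conjugates n H H' (chain (Suc i)) y \<Longrightarrow> \<theta> * y = y * \<theta>"
proof -
  let ?Z = "chain_hom i \<delta>"
  note as = assoc_mult_mat[of _ n n _ n _ n] and cc = chain_carrier(1)[where 'a='a and i="Suc i"]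
  have c: "H \<in> carrier_mat n n" "H' \<in> carrier_mat n n" "?Z \<in> carrier_mat n n"
    using H chain_hom_carrier by (auto simp: acts_from_def)
  have "supp_in n (H * ?Z) (\<lambda>a b. i < a \<and> i < b)"
    by (rule supp_in_mult[OF acts_from_supp[OF H(1)] chain_hom_supp[OF i]]) auto
  then show "supp_in n \<theta> (\<lambda>a b. i < a \<and> i < b)" unfolding \<theta>_def
    by (rule supp_in_mult[OF _ acts_from_supp[OF H(2)]]) auto
  have "supp_in n (H * ?Z) (\<lambda>a b. blk a < blk b)"
    by (rule supp_in_mult[OF H(3)[unfolded blockupper_def] chain_hom_supp_strict[OF i \<delta>]]) auto
  then show "supp_in n \<theta> (\<lambda>a b. blk a < blk b)" unfolding \<theta>_def
    by (rule supp_in_mult[OF _ H(4)[unfolded blockupper_def]]) auto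
  have "\<theta> * \<theta> = H * (?Z * (H' * H) * ?Z) * H'" unfolding \<theta>_def using c by (simp add: as)
  also have "?Z * (H' * H) * ?Z = 0\<^sub>m n n" using c by (simp add: H(6) chain_hom_square[OF i])
  finally show "\<theta> * \<theta> = 0\<^sub>m n n" using c by simp
  assume hh: "conjugates n H H' (chain (Suc i)) y"
  then have y: "y \<in> carrier_mat n n" "H * chain (Suc i) = y * H" by (auto simp: conjugates_def)
  have Hy: "H' * y = chain (Suc i) * H'" using conjugates_sym[OF hh] by (simp add: conjugates_def)
  have "\<theta> * y = H * ?Z * (H' * y)" unfolding \<theta>_def by (rule as) (use c y in auto)
  also have "\<dots> = H * (?Z * chain (Suc i)) * H'" unfolding Hy using c cc by (simp add: as)
  also have "\<dots> = H * chain (Suc i) * ?Z * H'" unfolding chain_hom_commutes[OF i] using c cc by (simp add: as)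
  also have "\<dots> = y * \<theta>" unfolding y(2) \<theta>_def using c y(1) by (simp add: as)
  finally show "\<theta> * y = y * \<theta>" .
qed

lemma pivot_part_image:
  fixes H y W :: "'a::field mat"
  assumes hh: "conjugates n H H' (chain (Suc i)) y"
    and y: "\<forall>a<n. \<forall>b<n. y $$ (a, b) \<noteq> 0 \<longleftrightarrow> normal_supp (Suc i) a b"
    and W: "supp_in n W (\<lambda>a b. \<exists>k>i. k \<in> piv_rows \<and> piv k = b)"
  shows "supp_in n (W * H) (\<lambda>a b. \<exists>d\<ge>Suc i. d \<in> piv_rows \<and> nxt d = b)"
proof -
  have c: "H \<in> carrier_mat n n" "y \<in> carrier_mat n n" "H * chain (Suc i) = y * H"
    using hh by (auto simp: conjugates_def)
  have "supp_in n H (\<lambda>b c. (\<forall>k>i. k \<in> piv_rows \<longrightarrow> piv k \<noteq> b) \<or> (\<exists>d\<ge>Suc i. d \<in> piv_rows \<and> nxt d = c))"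
    unfolding supp_in_def
  proof (intro conjI allI impI c(1))
    fix b e assume be: "b < n" "e < n" "H $$ (b, e) \<noteq> 0"
    show "(\<forall>k>i. k \<in> piv_rows \<longrightarrow> piv k \<noteq> b) \<or> (\<exists>d\<ge>Suc i. d \<in> piv_rows \<and> nxt d = e)"
      using pivot_rows_in_image[OF c(1,3,2) y be(2)] be(3) by (metis Suc_leI)
  qed
  then show ?thesis by (rule supp_in_mult[OF W]) blast
qed

text \<open>
  The entries of the new row outside \<open>block_part\<close> lie in the row space of
  \<open>y\<close> up to \<open>block_part i W * \<theta>\<close>. Indeed, the pivot columns
  span that row space, and in chain coordinates the difference of \<open>B\<close> and
  \<open>A * chain_hom\<close> vanishes in all free columns by the choice of
  \<open>later_ratio\<close>.
\<close>

lemma cleared_image: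
  fixes H y W :: "'a::field mat"
  assumes i: "i \<in> piv_rows"
    and hh: "conjugates n H H' (chain (Suc i)) y" and bH: "blockupper H"
    and y: "\<forall>a<n. \<forall>b<n. y $$ (a, b) \<noteq> 0 \<longleftrightarrow> normal_supp (Suc i) a b"
    and W: "supp_in n W (\<lambda>a b. a = i \<and> blk i < blk b)"
  defines "A \<equiv> block_part i W * H" and "B \<equiv> later_part i W * H"
  defines "\<theta> \<equiv> H * chain_hom i (later_ratio i A B) * H'"
  assumes nz: "A $$ (i, nxt i) \<noteq> 0"
  shows "supp_in n ((W - (block_part i W + block_part i W * \<theta>)) * H) (\<lambda>a b. \<exists>d\<ge>Suc i. d \<in> piv_rows \<and> nxt d = b)"
proof -
  let ?Z = "chain_hom i (later_ratio i A B)"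
  define Wt Wg where "Wt = block_part i W" and "Wg = later_part i W"
  \<comment> \<open>The part of the row in pivot columns.\<close>
  define Wp where "Wp = W - (Wt + Wg)"
  have c: "H \<in> carrier_mat n n" "H' \<in> carrier_mat n n" "?Z \<in> carrier_mat n n" "H' * H = 1\<^sub>m n"
    "W \<in> carrier_mat n n"
    using hh W chain_hom_carrier by (auto simp: conjugates_def supp_in_def)
  have cW: "Wt \<in> carrier_mat n n" "Wg \<in> carrier_mat n n" "Wp \<in> carrier_mat n n"
    by (simp_all add: Wt_def Wg_def Wp_def part_carrier minus_carrier_mat)
  note as = assoc_mult_mat[of _ n n _ n _ n]
  have Wts: "supp_in n Wt (\<lambda>a b. a = i)" and Wgs: "supp_in n Wg (\<lambda>a b. a = i \<and> nb i < blk b)"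
    using W by (auto simp: supp_in_def Wt_def Wg_def block_part_def later_part_def)
  have As: "supp_in n A (\<lambda>a b. a = i)"
    unfolding A_def Wt_def[symmetric]
    by (rule supp_in_mult[OF Wts, of _ "\<lambda>_ _. True"]) (use c in \<open>auto simp: supp_in_def\<close>)
  have Bs: "supp_in n B (\<lambda>a b. a = i \<and> nb i < blk b)"
    unfolding B_def Wg_def[symmetric]
    by (rule supp_in_mult[OF Wgs bH[unfolded blockupper_def]]) auto
  have AZs: "supp_in n (A * ?Z) (\<lambda>a b. a = i)"
    by (rule supp_in_mult[OF As chain_hom_supp[OF i]]) auto
  note cA = supp_in_carrier[OF As] supp_in_carrier[OF Bs] supp_in_carrier[OF AZs]
  have "Wt * \<theta> * H = Wt * (H * (?Z * (H' * H)))" unfolding \<theta>_def using c cW by (simp add: as del: c(4))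
  then have e: "Wt * \<theta> * H = A * ?Z" using c cW by (simp add: as A_def Wt_def)
  have \<theta>c: "Wt * \<theta> \<in> carrier_mat n n" using c cW by (simp add: \<theta>_def)
  have "W - (Wt + Wt * \<theta>) = Wp + (Wg - Wt * \<theta>)"
  proof -
    define M where "M = Wt * \<theta>"
    have "M \<in> carrier_mat n n" using \<theta>c by (simp add: M_def)
    then show ?thesis unfolding M_def[symmetric] Wp_def using c(5) cW(1,2) by (intro eq_matI) auto
  qed
  then have "(W - (Wt + Wt * \<theta>)) * H = Wp * H + (Wg - Wt * \<theta>) * H"
    using c cW \<theta>c by (simp add: add_mult_distrib_mat[of _ n n _ _ n] minus_carrier_mat)
  also have "(Wg - Wt * \<theta>) * H = B - A * ?Z"
  proof -
    have "Wg * H = B" by (simp add: B_def Wg_def)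
    then show ?thesis using minus_mult_distrib_mat[OF cW(2) \<theta>c c(1)] unfolding e by simp
  qed
  finally have main: "(W - (Wt + Wt * \<theta>)) * H = Wp * H + (B - A * ?Z)" .
  have "supp_in n Wp (\<lambda>a b. \<exists>k>i. k \<in> piv_rows \<and> piv k = b)"
    unfolding supp_in_def
  proof (intro conjI allI impI cW(3))
    fix a b assume ab: "a < n" "b < n" "Wp $$ (a, b) \<noteq> 0"
    then have e: "W $$ (a, b) - (Wt $$ (a, b) + Wg $$ (a, b)) \<noteq> 0"
      using c cW by (simp add: Wp_def)
    have "W $$ (a, b) \<noteq> 0"
      using e ab by (auto simp: Wt_def Wg_def block_part_def later_part_def split: if_splits)
    then have ai: "blk i < blk b" using W ab unfolding supp_in_def by blast
    have "\<not> (blk b = nb i \<and> piv i \<le> b)" "\<not> (nb i < blk b \<and> free_piv_col i b)"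
      using e ab by (auto simp: Wt_def Wg_def block_part_def later_part_def split: if_splits)
    then show "\<exists>k>i. k \<in> piv_rows \<and> piv k = b" using uncovered_free[OF piv_rows_less[OF i] ab(2) ai] by blast
  qed
  then have 1: "supp_in n (Wp * H) (\<lambda>a b. \<exists>d\<ge>Suc i. d \<in> piv_rows \<and> nxt d = b)"
    by (rule pivot_part_image[OF hh y])
  have 2: "supp_in n (B - A * ?Z) (\<lambda>a b. \<exists>d\<ge>Suc i. d \<in> piv_rows \<and> nxt d = b)"
    unfolding supp_in_def
  proof (intro conjI allI impI)
    show "B - A * ?Z \<in> carrier_mat n n" using cA by (simp add: minus_carrier_mat)
    fix a b assume ab: "a < n" "b < n" "(B - A * ?Z) $$ (a, b) \<noteq> 0"
    have idx: "(B - A * ?Z) $$ (a, b) = B $$ (a, b) - (A * ?Z) $$ (a, b)"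
      by (rule index_minus_mat(1)) (use ab carrier_matD[OF cA(3)] in simp_all)
    show "\<exists>d\<ge>Suc i. d \<in> piv_rows \<and> nxt d = b"
    proof (rule ccontr)
      assume no: "\<not> ?thesis"
      have ai: "a = i" using idx ab Bs AZs unfolding supp_in_def by fastforce
      have "(A * ?Z) $$ (i, b) = (\<Sum>d<n. if d = nxt i then A $$ (i, d) * ?Z $$ (d, b) else 0)"
        unfolding mult_entry[OF cA(1) c(3) piv_rows_less[OF i] ab(2)]
      proof (rule sum.cong[OF refl])
        fix d assume "d \<in> {..<n}"
        then show "A $$ (i, d) * ?Z $$ (d, b) = (if d = nxt i then A $$ (i, d) * ?Z $$ (d, b) else 0)"
          using chain_hom_other_row[OF i, of d b "later_ratio i A B"] no ab(2) by (auto simp: Suc_le_eq)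
      qed
      also have "\<dots> = A $$ (i, nxt i) * ?Z $$ (nxt i, b)" using nxt_props(1)[OF i] by simp
      also have "\<dots> = B $$ (i, b)"
      proof (cases "nb i < blk b")
        case True
        then have "free_nxt_col i b" "b \<noteq> nxt i"
          using no ab nb_props(1)[OF i] nxt_props(2)[OF i] by (auto simp: free_nxt_col_def Suc_le_eq)
        then show ?thesis unfolding chain_hom_row[OF i ab(2)] using nz True by (simp add: later_ratio_def)
      next
        case False
        then have "B $$ (i, b) = 0" using Bs ab(2) piv_rows_less[OF i] unfolding supp_in_def by blast
        then show ?thesis unfolding chain_hom_row[OF i ab(2)] using False by (simp add: later_ratio_def)
      qed
      finally show False using ab(3) idx ai by simp
    qed
  qed
  show ?thesis using supp_in_add[OF 1 2] main unfolding Wt_def by simp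
qed

text \<open>
  In chain coordinates the new row is reduced to its entry in column \<open>nxt i\<close>:
  lower rows clear the image of the chain matrix, a chain homomorphism clears the other free
  columns, and a diagonal matrix scales the remaining entry.
\<close>

lemma chain_row_conjugates:
  fixes A :: "'a::field mat"
  assumes i: "i \<in> piv_rows" and A: "supp_in n A (\<lambda>a b. a = i \<and> blk i < blk b)" and nz: "A $$ (i, nxt i) \<noteq> 0"
  defines "\<zeta> \<equiv> chain_hom i (row_ratio i A)" and "U \<equiv> (A - free_part i A) * chain_T (Suc i)"
  defines "s \<equiv> A $$ (i, nxt i)"
  shows "conjugates n ((1\<^sub>m n + U) * ((1\<^sub>m n - \<zeta>) * row_scale i s)) (row_scale i (inverse s) * (1\<^sub>m n + \<zeta>) * (1\<^sub>m n - U))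
    (chain i) (A + chain (Suc i))" (is ?conj)
    "supp_in n U (\<lambda>a b. a = i \<and> i < b)"
proof -
  let ?E = "row_entry i (nxt i) s" and ?C = "chain (Suc i) :: 'a mat"
  note cc = chain_carrier[where 'a='a and i="Suc i"]
  have Ac: "A \<in> carrier_mat n n" using A by (simp add: supp_in_def)
  have Fc: "free_part i A \<in> carrier_mat n n" by (rule part_carrier)
  have 1: "conjugates n (row_scale i s) (row_scale i (inverse s)) (chain i) (?E + ?C)"
    unfolding row_entry_def by (rule row_scale_conjugates[OF i]) (use nz in \<open>simp add: s_def\<close>)
  have Es: "supp_in n ?E (\<lambda>a b. a = i)" by (auto simp: supp_in_def row_entry_def)
  have \<zeta>s: "supp_in n \<zeta> (\<lambda>a b. i < a \<and> i < b)"
    unfolding \<zeta>_def by (rule supp_in_mono[OF chain_hom_supp[OF i]]) auto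
  have 2: "conjugates n (1\<^sub>m n - \<zeta>) (1\<^sub>m n + \<zeta>) (?E + ?C) (?E + ?E * \<zeta> + ?C)"
    by (rule module_hom_conjugates(2)[OF Es cc(1) \<zeta>s]) (simp_all add: \<zeta>_def chain_hom_square[OF i] chain_hom_commutes[OF i])
  have free: "?E + ?E * \<zeta> = free_part i A"
  proof (rule eq_matI)
    fix a b assume "a < dim_row (free_part i A)" "b < dim_col (free_part i A)"
    then have ab: "a < n" "b < n" using Fc by auto
    have "(?E * \<zeta>) $$ (a, b) = (\<Sum>d<n. if d = nxt i then ?E $$ (a, d) * \<zeta> $$ (d, b) else 0)"
      unfolding mult_entry[OF supp_in_carrier[OF Es] supp_in_carrier[OF \<zeta>s] ab]
      by (rule sum.cong) (use ab in \<open>auto simp: row_entry_def\<close>)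
    also have "\<dots> = ?E $$ (a, nxt i) * \<zeta> $$ (nxt i, b)" using nxt_props(1)[OF i] by simp
    finally have e: "(?E * \<zeta>) $$ (a, b) = ?E $$ (a, nxt i) * \<zeta> $$ (nxt i, b)" .
    have E: "?E $$ (a, nxt i) = (if a = i then s else 0)" "?E $$ (a, b) = (if a = i \<and> b = nxt i then s else 0)"
      using ab nxt_props(1)[OF i] by (simp_all add: row_entry_def)
    have A0: "A $$ (a, b) = 0" if "a \<noteq> i" using A ab that unfolding supp_in_def by blast
    have "(?E + ?E * \<zeta>) $$ (a, b) = ?E $$ (a, b) + (?E * \<zeta>) $$ (a, b)"
      by (rule index_add_mat(1))
        (use ab carrier_matD[OF mult_carrier_mat[OF supp_in_carrier[OF Es] supp_in_carrier[OF \<zeta>s]]] in simp_all)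
    also have "\<dots> = free_part i A $$ (a, b)"
      unfolding e E unfolding \<zeta>_def chain_hom_row[OF i ab(2)] using nz ab A0 free_nxt_nxt[OF i]
      by (cases "a = i"; cases "b = nxt i") (auto simp: free_part_def row_ratio_def s_def)
    finally show "(?E + ?E * \<zeta>) $$ (a, b) = free_part i A $$ (a, b)" .
  qed (use Fc supp_in_carrier[OF Es] supp_in_carrier[OF \<zeta>s] in auto)
  have Fs: "supp_in n (free_part i A) (\<lambda>a b. a = i \<and> blk i < blk b)"
    using A by (auto simp: supp_in_def free_part_def)
  \<comment> \<open>The clearing of a row is applied to the chain matrix itself as normal form, that is with the
    identity as \<open>H\<close>.\<close>
  have one: "conjugates n (1\<^sub>m n) (1\<^sub>m n) ?C ?C" "acts_from (Suc i) (1\<^sub>m n :: 'a mat)"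
    using cc by (auto simp: conjugates_def acts_from_def)
  have Cs: "supp_in n ?C (\<lambda>a b. i < a \<and> i < b)"
    using nxt_props(3) by (fastforce simp: supp_in_def chain_def)
  have Dc: "A - free_part i A \<in> carrier_mat n n" by (rule minus_carrier_mat[OF Fc])
  have img: "supp_in n ((A - free_part i A) * 1\<^sub>m n) (\<lambda>a b. \<exists>d\<ge>Suc i. d \<in> piv_rows \<and> nxt d = b)"
    unfolding right_mult_one_mat[OF Dc] unfolding supp_in_def
  proof (intro conjI allI impI Dc)
    fix a b assume ab: "a < n" "b < n" "(A - free_part i A) $$ (a, b) \<noteq> 0"
    then have nz: "A $$ (a, b) \<noteq> 0" "\<not> free_nxt_col i b" using Ac Fc by (auto simp: free_part_def split: if_splits)
    then have "blk i < blk b" using A ab unfolding supp_in_def by blast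
    then show "\<exists>d\<ge>Suc i. d \<in> piv_rows \<and> nxt d = b" using nz(2) ab by (auto simp: free_nxt_col_def Suc_le_eq)
  qed
  have U: "U = (A - free_part i A) * 1\<^sub>m n * chain_T (Suc i) * 1\<^sub>m n"
    unfolding U_def right_mult_one_mat[OF Dc] using Dc cc by simp
  note cl = clear_row_conjugates[OF one A Fs Cs img U]
  show "supp_in n U (\<lambda>a b. a = i \<and> i < b)" by (rule cl(2))
  show ?conj
    using conjugates_trans[OF conjugates_trans[OF 1 2[unfolded free]] conjugates_sym[OF cl(1)]] .
qed

lemma unipotent_above:
  fixes N :: "'a::field mat"
  assumes "supp_in n N (\<lambda>a b. i \<le> a \<and> a < b)"
  shows "acts_from i (1\<^sub>m n + N)" "acts_from i (1\<^sub>m n - N)" "upper (1\<^sub>m n + N)" "upper (1\<^sub>m n - N)"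
    "blockupper (1\<^sub>m n + N)" "blockupper (1\<^sub>m n - N)"
proof -
  have "supp_in n N (\<lambda>a b. i \<le> a \<and> i \<le> b)" "supp_in n N (\<le>)" "supp_in n N (\<lambda>a b. blk a \<le> blk b)"
    by (rule supp_in_mono[OF assms]; auto intro: blk_mono)+
  then show "acts_from i (1\<^sub>m n + N)" "acts_from i (1\<^sub>m n - N)" "upper (1\<^sub>m n + N)" "upper (1\<^sub>m n - N)"
    "blockupper (1\<^sub>m n + N)" "blockupper (1\<^sub>m n - N)"
    by (simp_all add: acts_from_unipotent upper_unipotent blockupper_unipotent)
qed

text \<open>
  Let \<open>W\<close> be the new row in the coordinates of \<open>y\<close>. Multiples of
  lower rows (\<open>U\<close>) and a module endomorphism (\<open>\<theta>\<close>) remove all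
  entries but those in the free columns of the block \<open>nb i\<close>, and \<open>N\<close>
  reduces these to the entry in column \<open>piv i\<close> while it creates the new entries
  in row \<open>piv i\<close>. Two conditions make this possible: the coordinate
  \<open>s\<close> of the row at the start of its chain is nonzero, and so are the entries of
  \<open>W\<close> in the free columns of the block \<open>nb i\<close>, which turn into
  entries in positions of \<open>\<Phi>\<close>.
\<close>

lemma normalizes_pivot_row:
  fixes x G G' H H' y V :: "'a::field mat"
  assumes i: "i \<in> piv_rows" and norm: "normalizes (Suc i) x G G' H H' y"
    and V: "supp_in n V (\<lambda>a b. a = i \<and> blk i < blk b)"
  defines "W \<equiv> V * G'"
  defines "Wt \<equiv> block_part i W" and "B \<equiv> later_part i W * H"
  defines "A \<equiv> Wt * H"
  defines "\<theta> \<equiv> H * chain_hom i (later_ratio i A B) * H'"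
  defines "U \<equiv> (W - (Wt + Wt * \<theta>)) * H * chain_T (Suc i) * H'"
    and "N \<equiv> col_clear i Wt"
    and "\<zeta> \<equiv> chain_hom i (row_ratio i A)" and "U' \<equiv> (A - free_part i A) * chain_T (Suc i)"
    and "s \<equiv> A $$ (i, nxt i)"
  assumes nzW: "\<And>b. b < n \<Longrightarrow> blk b = nb i \<Longrightarrow> piv i \<le> b \<Longrightarrow> W $$ (i, b) \<noteq> 0"
    and nzA: "s \<noteq> 0"
  shows "normalizes i (V + x)
    ((1\<^sub>m n + N) * ((1\<^sub>m n + \<theta>) * ((1\<^sub>m n - U) * G)))
    (G' * (1\<^sub>m n + U) * (1\<^sub>m n - \<theta>) * (1\<^sub>m n - N))
    ((1\<^sub>m n + N) * (H * ((1\<^sub>m n + U') * ((1\<^sub>m n - \<zeta>) * row_scale i s))))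
    (row_scale i (inverse s) * (1\<^sub>m n + \<zeta>) * (1\<^sub>m n - U') * H' * (1\<^sub>m n - N))
    (row_entry i (piv i) (Wt $$ (i, piv i)) + y + N * y)"
proof -
  have acts: "acts_from (Suc i) G" "acts_from (Suc i) G'" "acts_from (Suc i) H" "acts_from (Suc i) H'"
    and up: "upper G" "upper G'" and bu: "blockupper H" "blockupper H'"
    and cg: "conjugates n G G' x y" and ch: "conjugates n H H' (chain (Suc i)) y"
    and ys: "\<forall>a<n. \<forall>b<n. y $$ (a, b) \<noteq> 0 \<longleftrightarrow> normal_supp (Suc i) a b"
    using norm by (auto simp: normalizes_def)
  have yc: "y \<in> carrier_mat n n" and HH: "H * H' = 1\<^sub>m n" "H' * H = 1\<^sub>m n"
    and Hc: "H \<in> carrier_mat n n" "H' \<in> carrier_mat n n"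
    using ch by (auto simp: conjugates_def)
  have Ws: "supp_in n W (\<lambda>a b. a = i \<and> blk i < blk b)" unfolding W_def by (rule new_row_supp[OF up(2) V])
  have Wts: "supp_in n Wt (\<lambda>a b. a = i \<and> blk b = nb i \<and> piv i \<le> b)"
    using Ws by (auto simp: supp_in_def Wt_def block_part_def)
  have Wts': "supp_in n Wt (\<lambda>a b. a = i \<and> blk i < blk b)"
    by (rule supp_in_mono[OF Wts]) (use nb_props(1)[OF i] in auto)
  have Wts'': "supp_in n Wt (\<lambda>a b. a = i)" by (rule supp_in_mono[OF Wts]) simp
  have As: "supp_in n A (\<lambda>a b. a = i \<and> blk i < blk b)" unfolding A_def
    by (rule supp_in_mult[OF Wts' bu(1)[unfolded blockupper_def]]) auto
  have later: "\<And>c. blk c \<le> nb i \<Longrightarrow> later_ratio i A B c = 0" by (simp add: later_ratio_def)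
  have tr: "supp_in n \<theta> (\<lambda>a b. i < a \<and> i < b)" "supp_in n \<theta> (\<lambda>a b. blk a < blk b)"
    "\<theta> * \<theta> = 0\<^sub>m n n" "\<theta> * y = y * \<theta>"
    unfolding \<theta>_def by (rule transfer_supp[OF i acts(3,4) bu HH]; simp add: later ch)+
  have \<theta>_up: "supp_in n \<theta> (\<le>)"
    by (rule supp_in_mono[OF tr(2)]) (auto intro: less_imp_le[OF less_if_blk_less])
  have WtT: "supp_in n (Wt + Wt * \<theta>) (\<lambda>a b. a = i \<and> blk i < blk b)"
  proof (rule supp_in_add[OF Wts'])
    show "supp_in n (Wt * \<theta>) (\<lambda>a b. a = i \<and> blk i < blk b)"
      by (rule supp_in_mult[OF Wts' tr(2)]) auto
  qed
  have ysupp: "supp_in n y (\<lambda>a b. i < a \<and> i < b)"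
    unfolding supp_in_def
  proof (intro conjI allI impI yc)
    fix a b assume ab: "a < n" "b < n" "y $$ (a, b) \<noteq> 0"
    then have "normal_supp (Suc i) a b" using ys by simp
    then show "i < a" "i < b" using normal_supp_props[of "Suc i" a b] by auto
  qed
  have img: "supp_in n ((W - (Wt + Wt * \<theta>)) * H) (\<lambda>a b. \<exists>d\<ge>Suc i. d \<in> piv_rows \<and> nxt d = b)"
    using cleared_image[OF i ch bu(1) ys Ws] nzA
    unfolding \<theta>_def A_def B_def Wt_def s_def by blast
  note cl = clear_row_conjugates[OF ch acts(4) Ws WtT ysupp img U_def[THEN meta_eq_to_obj_eq]]
  have nz0: "Wt $$ (i, b) \<noteq> 0" if "b < n" "blk b = nb i" "piv i \<le> b" for b
    using nzW[OF that] that piv_rows_less[OF i] by (simp add: Wt_def block_part_def)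
  have nz1: "Wt $$ (i, piv i) \<noteq> 0" using nz0[of "piv i"] piv_props[OF i] by simp
  have cN: "conjugates n (1\<^sub>m n + N) (1\<^sub>m n - N) (Wt + y) (row_entry i (piv i) (Wt $$ (i, piv i)) + y + N * y)"
    unfolding N_def by (rule col_clear_conjugates[OF i Wts nz1 yc ys])
  have Ns: "supp_in n N (\<lambda>a b. i < a \<and> a < b)"
    using piv_props(3)[OF i] by (auto simp: N_def col_clear_def supp_in_def)
  have g: "conjugates n ((1\<^sub>m n + N) * ((1\<^sub>m n + \<theta>) * ((1\<^sub>m n - U) * G)))
      (G' * (1\<^sub>m n + U) * (1\<^sub>m n - \<theta>) * (1\<^sub>m n - N)) (V + x)
      (row_entry i (piv i) (Wt $$ (i, piv i)) + y + N * y)"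
    by (rule conjugates_trans[OF conjugates_trans[OF conjugates_trans[OF
          new_row_conjugates[OF acts(1) cg V, folded W_def] cl(1)]
          module_hom_conjugates(1)[OF Wts'' yc tr(1,3,4)]] cN])
  note cr = chain_row_conjugates[OF i As, folded s_def, OF nzA, folded \<zeta>_def U'_def]
  have "A * H' = Wt * (H * H')" unfolding A_def
    by (rule assoc_mult_mat) (use Hc supp_in_carrier[OF Wts] in auto)
  then have AH: "A * H' = Wt" using supp_in_carrier[OF Wts] by (simp add: HH(1))
  have h: "conjugates n ((1\<^sub>m n + N) * (H * ((1\<^sub>m n + U') * ((1\<^sub>m n - \<zeta>) * row_scale i s))))
    (row_scale i (inverse s) * (1\<^sub>m n + \<zeta>) * (1\<^sub>m n - U') * H' * (1\<^sub>m n - N)) (chain i)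
    (row_entry i (piv i) (Wt $$ (i, piv i)) + y + N * y)"
    by (rule conjugates_trans[OF conjugates_trans[OF cr(1)
          new_row_conjugates[OF acts(3) ch As, unfolded AH]] cN])
  \<comment> \<open>It remains to check that all factors are triangular and act from row \<open>i\<close> on.\<close>
  have sN: "supp_in n N (\<lambda>a b. i \<le> a \<and> a < b)" "supp_in n U (\<lambda>a b. i \<le> a \<and> a < b)"
    "supp_in n U' (\<lambda>a b. i \<le> a \<and> a < b)"
    by (rule supp_in_mono[OF Ns] supp_in_mono[OF cl(2)] supp_in_mono[OF cr(2)]; simp)+
  note sN = unipotent_above[OF sN(1)] unipotent_above[OF sN(2)] unipotent_above[OF sN(3)]
  have s\<theta>: "acts_from i (1\<^sub>m n + \<theta>)" "acts_from i (1\<^sub>m n - \<theta>)" "upper (1\<^sub>m n + \<theta>)" "upper (1\<^sub>m n - \<theta>)"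
    using acts_from_unipotent[OF supp_in_mono[OF tr(1)]] upper_unipotent[OF \<theta>_up] by auto
  have \<zeta>s: "supp_in n \<zeta> (\<lambda>a b. lab a = lab i \<and> lab i < lab b \<and> blk a \<le> blk b \<and> i < a \<and> i < b)"
    unfolding \<zeta>_def by (rule chain_hom_supp[OF i])
  have s\<zeta>: "acts_from i (1\<^sub>m n + \<zeta>)" "acts_from i (1\<^sub>m n - \<zeta>)"
    "blockupper (1\<^sub>m n + \<zeta>)" "blockupper (1\<^sub>m n - \<zeta>)"
    using acts_from_unipotent[OF supp_in_mono[OF \<zeta>s]] blockupper_unipotent[OF supp_in_mono[OF \<zeta>s]] by auto
  have ss: "acts_from i (row_scale i e)" "blockupper (row_scale i e)" for e :: 'a
    by (auto simp: acts_from_def blockupper_def row_scale_def supp_in_def)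
  note ac = acts[THEN acts_from_Suc]
  show ?thesis
    unfolding normalizes_def
    using g h normal_supp_step[OF i nz0 yc ys, folded N_def] up bu ac sN s\<theta> s\<zeta> ss
    by (auto intro!: acts_from_mult upper_mult blockupper_mult)
qed

text \<open>
  Without a base root in row \<open>i\<close> there is no free column behind its block, and
  lower rows clear the new row completely.
\<close>

lemma normalizes_free_row:
  fixes x G G' H H' y V :: "'a::field mat"
  assumes i: "i < n" "i \<notin> piv_rows" and norm: "normalizes (Suc i) x G G' H H' y"
    and V: "supp_in n V (\<lambda>a b. a = i \<and> blk i < blk b)"
  defines "W \<equiv> V * G'"
  defines "U \<equiv> (W - 0\<^sub>m n n) * H * chain_T (Suc i) * H'"
  shows "normalizes i (V + x) ((1\<^sub>m n - U) * G) (G' * (1\<^sub>m n + U)) H H' y"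
proof -
  have acts: "acts_from (Suc i) G" "acts_from (Suc i) G'" "acts_from (Suc i) H" "acts_from (Suc i) H'"
    and up: "upper G" "upper G'" and bu: "blockupper H" "blockupper H'"
    and cg: "conjugates n G G' x y" and ch: "conjugates n H H' (chain (Suc i)) y"
    and ys: "\<forall>a<n. \<forall>b<n. y $$ (a, b) \<noteq> 0 \<longleftrightarrow> normal_supp (Suc i) a b"
    using norm by (auto simp: normalizes_def)
  have yc: "y \<in> carrier_mat n n" using ch by (auto simp: conjugates_def)
  have Ws: "supp_in n W (\<lambda>a b. a = i \<and> blk i < blk b)" unfolding W_def by (rule new_row_supp[OF up(2) V])
  have W0: "W - 0\<^sub>m n n = W" using supp_in_carrier[OF Ws] by (intro eq_matI) auto
  have Wp: "supp_in n W (\<lambda>a b. \<exists>k>i. k \<in> piv_rows \<and> piv k = b)"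
    by (rule supp_in_mono[OF Ws]) (use free_piv(1)[OF i(1)] i(2) in blast)
  have ysupp: "supp_in n y (\<lambda>a b. i < a \<and> i < b)"
    unfolding supp_in_def
  proof (intro conjI allI impI yc)
    fix a b assume ab: "a < n" "b < n" "y $$ (a, b) \<noteq> 0"
    then have "normal_supp (Suc i) a b" using ys by simp
    then show "i < a" "i < b" using normal_supp_props[of "Suc i" a b] by auto
  qed
  have z: "supp_in n (0\<^sub>m n n :: 'a mat) (\<lambda>a b. a = i \<and> blk i < blk b)" by (simp add: supp_in_def)
  have img: "supp_in n ((W - 0\<^sub>m n n) * H) (\<lambda>a b. \<exists>d\<ge>Suc i. d \<in> piv_rows \<and> nxt d = b)"
    unfolding W0 by (rule pivot_part_image[OF ch ys Wp])
  note cl = clear_row_conjugates[OF ch acts(4) Ws z ysupp img U_def[THEN meta_eq_to_obj_eq]]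
  have g: "conjugates n ((1\<^sub>m n - U) * G) (G' * (1\<^sub>m n + U)) (V + x) y"
    using conjugates_trans[OF new_row_conjugates[OF acts(1) cg V, folded W_def] cl(1)] yc by simp
  have chi: "chain i = chain (Suc i)"
  proof -
    have "i \<le> a \<and> a \<in> piv_rows \<longleftrightarrow> Suc i \<le> a \<and> a \<in> piv_rows" for a using i(2) by (cases "a = i") auto
    then have "i \<le> a \<and> a \<in> piv_rows \<and> b = nxt a \<longleftrightarrow> Suc i \<le> a \<and> a \<in> piv_rows \<and> b = nxt a" for a b by blast
    then show ?thesis unfolding chain_def by simp
  qed
  have Yi: "normal_supp i a b \<longleftrightarrow> normal_supp (Suc i) a b" for a b
  proof -
    have "i \<le> a \<and> a \<in> piv_rows \<longleftrightarrow> Suc i \<le> a \<and> a \<in> piv_rows" for a using i(2) by (cases "a = i") auto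
    then show ?thesis unfolding normal_supp_def conj_assoc[symmetric] by simp
  qed
  have "supp_in n U (\<lambda>a b. i \<le> a \<and> a < b)" by (rule supp_in_mono[OF cl(2)]) simp
  note sU = unipotent_above[OF this]
  note ac = acts[THEN acts_from_Suc]
  show ?thesis
    unfolding normalizes_def chi Yi
    using g ch ys up bu ac sU by (auto intro!: acts_from_mult upper_mult)
qed

end

section \<open>The normal form of a generic matrix\<close>

text \<open>
  If the sum of the values of \<open>f\<close> vanishes, then doubling one nonzero summand
  helps.
\<close>

lemma exists_nonvanishing_combination:
  fixes f :: "'b \<Rightarrow> 'a::field_char_0"
  assumes "finite F" "b\<^sub>0 \<in> F" "f b\<^sub>0 \<noteq> 0"
  shows "\<exists>\<nu>. (\<forall>b. \<nu> b \<noteq> 0) \<and> (\<Sum>b\<in>F. \<nu> b * f b) \<noteq> 0"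
proof (cases "(\<Sum>b\<in>F. f b) = 0")
  case False
  then show ?thesis by (intro exI[of _ "\<lambda>_. 1"]) simp
next
  case True
  have "(\<Sum>b\<in>F. (if b = b\<^sub>0 then 2 else 1) * f b) = (\<Sum>b\<in>F. f b + (if b = b\<^sub>0 then f b else 0))"
    by (rule sum.cong) auto
  also have "\<dots> = f b\<^sub>0" using assms True by (simp add: sum.distrib)
  finally show ?thesis using assms(3) by (intro exI[of _ "\<lambda>b. if b = b\<^sub>0 then 2 else 1"]) auto
qed

lemma regular_if: "regular n V x\<^sub>0 f \<Longrightarrow> regular n V x\<^sub>0 (\<lambda>x. if P then f x else 0)"
  by (cases P) (simp_all add: regular_const)

context composition
begin

lemma nilradical_iff: "x \<in> nilradical r \<longleftrightarrow> supp_in n x (\<lambda>a b. blk a < blk b)"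
proof -
  have "(\<exists>s t. 1 \<le> s \<and> s < t \<and> t \<le> length r \<and> a + 1 \<in> block r s \<and> b + 1 \<in> block r t) \<longleftrightarrow> blk a < blk b"
    if ab: "a < n" "b < n" for a b
  proof
    assume "\<exists>s t. 1 \<le> s \<and> s < t \<and> t \<le> length r \<and> a + 1 \<in> block r s \<and> b + 1 \<in> block r t"
    then show "blk a < blk b" using block_iff[OF ab(1)] block_iff[OF ab(2)] by fastforce
  next
    assume "blk a < blk b"
    then show "\<exists>s t. 1 \<le> s \<and> s < t \<and> t \<le> length r \<and> a + 1 \<in> block r s \<and> b + 1 \<in> block r t"
      using block_iff[OF ab(1)] block_iff[OF ab(2)] blk_bounds(1)[OF ab(2)]
      by (intro exI[of _ "Suc (blk a)"] exI[of _ "Suc (blk b)"]) auto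
  qed
  then show ?thesis by (auto simp: nilradical_def supp_in_def sum_r)
qed

definition lower_rows :: "nat \<Rightarrow> 'a::field mat set" where
  "lower_rows i = {x. supp_in n x (\<lambda>a b. i \<le> a \<and> blk a < blk b)}"

definition drop_row :: "nat \<Rightarrow> 'a::field mat \<Rightarrow> 'a mat" where
  "drop_row i x = mat n n (\<lambda>(a, b). if a = i then 0 else x $$ (a, b))"

definition only_row :: "nat \<Rightarrow> 'a::field mat \<Rightarrow> 'a mat" where
  "only_row i x = mat n n (\<lambda>(a, b). if a = i then x $$ (a, b) else 0)"

lemma row_decomposition:
  assumes "x \<in> lower_rows i"
  shows "drop_row i x \<in> lower_rows (Suc i)" "supp_in n (only_row i x) (\<lambda>a b. a = i \<and> blk i < blk b)"
    "only_row i x + drop_row i x = x"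
proof -
  have x: "x \<in> carrier_mat n n" "\<And>a b. a < n \<Longrightarrow> b < n \<Longrightarrow> x $$ (a, b) \<noteq> 0 \<Longrightarrow> i \<le> a \<and> blk a < blk b"
    using assms by (auto simp: lower_rows_def supp_in_def)
  show "drop_row i x \<in> lower_rows (Suc i)" "supp_in n (only_row i x) (\<lambda>a b. a = i \<and> blk i < blk b)"
    using x(2) by (auto simp: lower_rows_def supp_in_def drop_row_def only_row_def Suc_le_eq nat_less_le)
  show "only_row i x + drop_row i x = x"
    using x(1) by (intro eq_matI) (auto simp: drop_row_def only_row_def)
qed

lemma drop_row_poly: "a < n \<Longrightarrow> b < n \<Longrightarrow> (\<lambda>x. drop_row i x $$ (a, b)) \<in> poly_funs n"
  by (cases "a = i") (simp_all add: drop_row_def poly_funs.const poly_funs.entry)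

lemma only_row_regular: "regular_mat n V x\<^sub>0 (only_row i)"
  unfolding only_row_def by (intro regular_mat_mat regular_if regular_poly poly_funs.entry)

lemma regular_chain_hom:
  assumes "\<And>c. regular n V x\<^sub>0 (\<lambda>x. \<delta> x c)"
  shows "regular_mat n V x\<^sub>0 (\<lambda>x. chain_hom i (\<delta> x))"
  unfolding chain_hom_def by (intro regular_mat_mat regular_sum regular_if assms finite_free_nxt)

lemma regular_mat_one_plus: "regular_mat n V x\<^sub>0 A \<Longrightarrow> regular_mat n V x\<^sub>0 (\<lambda>x. 1\<^sub>m n + A x)"
  "regular_mat n V x\<^sub>0 A \<Longrightarrow> regular_mat n V x\<^sub>0 (\<lambda>x. 1\<^sub>m n - A x)"
  by (intro regular_mat_add regular_mat_diff regular_mat_const; simp)+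

text \<open>
  A choice of the new row that meets both conditions for normalizing a row with a base root.
  Column \<open>nxt i\<close> of \<open>H\<close> has a nonzero entry in some row of the block
  \<open>nb i\<close>, since \<open>H\<close> and its inverse are block triangular; and it
  vanishes in the rows that are pivot columns, since \<open>nxt i\<close> is not in the image
  of the chain matrix.
\<close>

lemma generic_row:
  fixes H H' y :: "'a::field_char_0 mat"
  assumes i: "i \<in> piv_rows" and ch: "conjugates n H H' (chain (Suc i)) y" and bu: "blockupper H" "blockupper H'"
    and ys: "\<forall>a<n. \<forall>b<n. y $$ (a, b) \<noteq> 0 \<longleftrightarrow> normal_supp (Suc i) a b"
  shows "\<exists>\<nu>. (\<forall>b. \<nu> b \<noteq> 0) \<and> (\<Sum>b\<in>{b. b < n \<and> blk b = nb i \<and> piv i \<le> b}. \<nu> b * H $$ (b, nxt i)) \<noteq> 0"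
proof -
  have Hc: "H \<in> carrier_mat n n" "H' \<in> carrier_mat n n" "H' * H = 1\<^sub>m n" "H * chain (Suc i) = y * H" "y \<in> carrier_mat n n"
    using ch by (auto simp: conjugates_def)
  note x = nxt_props(1,2)[OF i]
  have "(\<Sum>e<n. H' $$ (nxt i, e) * H $$ (e, nxt i)) = (H' * H) $$ (nxt i, nxt i)"
    by (rule mult_entry[symmetric]) (use Hc x in auto)
  also have "\<dots> = 1" using x Hc(3) by simp
  finally have "(\<Sum>e<n. H' $$ (nxt i, e) * H $$ (e, nxt i)) \<noteq> 0" by simp
  then have "\<not> (\<forall>e<n. H' $$ (nxt i, e) * H $$ (e, nxt i) = 0)"
    by (metis (no_types, lifting) lessThan_iff sum.neutral)
  then obtain e where e: "e < n" "H' $$ (nxt i, e) \<noteq> 0" "H $$ (e, nxt i) \<noteq> 0" by auto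
  have be: "blk e = nb i"
    using e bu x unfolding blockupper_def supp_in_def by (metis le_antisym)
  have "piv i \<le> e"
  proof (rule ccontr)
    assume c: "\<not> piv i \<le> e"
    have "blk i < blk e" using be nb_props(1)[OF i] by simp
    have "\<exists>k>i. k \<in> piv_rows \<and> piv k = e"
    proof (rule ccontr)
      assume "\<not> ?thesis"
      then have "piv i \<le> e"
        by (intro free_piv(3)[OF piv_rows_less[OF i] e(1) \<open>blk i < blk e\<close>]) (use be in auto)
      then show False using c by simp
    qed
    then obtain k where k: "i < k" "k \<in> piv_rows" "piv k = e" by blast
    have "nxt d \<noteq> nxt i" if "i < d" "d \<in> piv_rows" for d using nxt_inj[OF that(2) i] that(1) by auto
    then have "H $$ (piv k, nxt i) = 0"
      using pivot_rows_in_image[OF Hc(1,4,5) ys x(1) _ k(1,2)] by blast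
    then show False using e k by simp
  qed
  then have eF: "e \<in> {b. b < n \<and> blk b = nb i \<and> piv i \<le> b}" using e be by simp
  show ?thesis by (rule exists_nonvanishing_combination[OF _ eF]) (use e(3) in auto)
qed

definition generically_normal :: "nat \<Rightarrow> 'a::field mat \<Rightarrow> ('a mat \<Rightarrow> 'a mat) \<Rightarrow> ('a mat \<Rightarrow> 'a mat) \<Rightarrow>
    ('a mat \<Rightarrow> 'a mat) \<Rightarrow> ('a mat \<Rightarrow> 'a mat) \<Rightarrow> bool" where
  "generically_normal i x\<^sub>0 g g' h h' \<longleftrightarrow> x\<^sub>0 \<in> lower_rows i \<and>
     regular_mat n (lower_rows i) x\<^sub>0 g \<and> regular_mat n (lower_rows i) x\<^sub>0 g' \<and>
     regular_mat n (lower_rows i) x\<^sub>0 h \<and> regular_mat n (lower_rows i) x\<^sub>0 h' \<and>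
     near n (lower_rows i) x\<^sub>0 (\<lambda>x. \<exists>y. normalizes i x (g x) (g' x) (h x) (h' x) y)"

text \<open>
  Functions of the lower rows are pulled back along \<open>drop_row\<close>. The base point is
  extended by the row that has generic coordinates after the normalization of the lower rows;
  all conditions then hold at the base point and hence near it.
\<close>

lemma generically_normal_step:
  fixes x\<^sub>1 :: "'a::field_char_0 mat"
  assumes "i < n" and IH: "generically_normal (Suc i) x\<^sub>1 g g' h h'"
  shows "\<exists>(x\<^sub>0 :: 'a mat) g g' h h'. generically_normal i x\<^sub>0 g g' h h'"
proof -
  let ?V = "lower_rows i :: 'a mat set" and ?V' = "lower_rows (Suc i) :: 'a mat set"
  have x1: "x\<^sub>1 \<in> ?V'" and reg: "regular_mat n ?V' x\<^sub>1 g" "regular_mat n ?V' x\<^sub>1 g'"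
    "regular_mat n ?V' x\<^sub>1 h" "regular_mat n ?V' x\<^sub>1 h'"
    and nr: "near n ?V' x\<^sub>1 (\<lambda>x. \<exists>y. normalizes (Suc i) x (g x) (g' x) (h x) (h' x) y)"
    using IH by (auto simp: generically_normal_def)
  from near_at[OF nr x1] obtain y\<^sub>1 where n1: "normalizes (Suc i) x\<^sub>1 (g x\<^sub>1) (g' x\<^sub>1) (h x\<^sub>1) (h' x\<^sub>1) y\<^sub>1" by blast
  define G G' H H' V where "G = (\<lambda>x. g (drop_row i x))" "G' = (\<lambda>x. g' (drop_row i x))"
    "H = (\<lambda>x. h (drop_row i x))" "H' = (\<lambda>x. h' (drop_row i x))" "V = (only_row i :: 'a mat \<Rightarrow> 'a mat)"
  note defs = this
  have lift: "regular_mat n ?V x\<^sub>0 G" "regular_mat n ?V x\<^sub>0 G'" "regular_mat n ?V x\<^sub>0 H" "regular_mat n ?V x\<^sub>0 H'"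
    "near n ?V x\<^sub>0 (\<lambda>x. \<exists>y. normalizes (Suc i) (drop_row i x) (G x) (G' x) (H x) (H' x) y)"
    if "drop_row i x\<^sub>0 = x\<^sub>1" for x\<^sub>0
    unfolding defs
    using regular_mat_compose[OF _ row_decomposition(1) drop_row_poly] reg
      near_compose[OF _ row_decomposition(1) drop_row_poly] nr that by blast+
  have V: "regular_mat n ?V x\<^sub>0 V" for x\<^sub>0 unfolding defs by (rule only_row_regular)
  note cc = chain_carrier(2)[where 'a='a and i="Suc i"]
  show ?thesis
  proof (cases "i \<in> piv_rows")
    case False
    define U where "U = (\<lambda>x. (V x * G' x - 0\<^sub>m n n) * H x * chain_T (Suc i) * H' x)"
    have x0: "x\<^sub>1 \<in> ?V" using x1 by (auto simp: lower_rows_def elim!: supp_in_mono)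
    have d: "drop_row i x\<^sub>1 = x\<^sub>1"
      using x1 by (intro eq_matI) (auto simp: drop_row_def lower_rows_def supp_in_def)
    note L = lift[OF d]
    have U: "regular_mat n ?V x\<^sub>1 U" unfolding U_def
      by (intro regular_mat_mult regular_mat_diff L V regular_mat_const cc) simp
    have "near n ?V x\<^sub>1 (\<lambda>x. \<exists>y. normalizes i x ((1\<^sub>m n - U x) * G x) (G' x * (1\<^sub>m n + U x)) (H x) (H' x) y)"
      using L(5)
    proof (rule near_mono)
      fix x assume x: "x \<in> ?V" and "\<exists>y. normalizes (Suc i) (drop_row i x) (G x) (G' x) (H x) (H' x) y"
      then obtain y where y: "normalizes (Suc i) (drop_row i x) (G x) (G' x) (H x) (H' x) y" by blast
      show "\<exists>y. normalizes i x ((1\<^sub>m n - U x) * G x) (G' x * (1\<^sub>m n + U x)) (H x) (H' x) y"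
        using normalizes_free_row[OF assms(1) False y row_decomposition(2)[OF x]]
        unfolding row_decomposition(3)[OF x] U_def defs(5) by blast
    qed
    then have "generically_normal i x\<^sub>1 (\<lambda>x. (1\<^sub>m n - U x) * G x) (\<lambda>x. G' x * (1\<^sub>m n + U x)) H H'"
      unfolding generically_normal_def using x0 L U by (intro conjI regular_mat_mult regular_mat_one_plus)
    then show ?thesis by blast
  next
    case True
    note i = True
    let ?F = "{b. b < n \<and> blk b = nb i \<and> piv i \<le> b}"
    have n1': "conjugates n (h x\<^sub>1) (h' x\<^sub>1) (chain (Suc i)) y\<^sub>1" "blockupper (h x\<^sub>1)" "blockupper (h' x\<^sub>1)"
      "\<forall>a<n. \<forall>b<n. y\<^sub>1 $$ (a, b) \<noteq> 0 \<longleftrightarrow> normal_supp (Suc i) a b" "upper (g x\<^sub>1)" "g x\<^sub>1 * g' x\<^sub>1 = 1\<^sub>m n"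
      using n1 by (auto simp: normalizes_def conjugates_def)
    obtain \<nu> where \<nu>: "\<forall>b. \<nu> b \<noteq> 0" "(\<Sum>b\<in>?F. \<nu> b * h x\<^sub>1 $$ (b, nxt i)) \<noteq> 0"
      using generic_row[OF i n1'(1-4)] by blast
    \<comment> \<open>In the coordinates of the normal form of the lower rows, the new row of the base point is to
      be \<open>W\<^sub>0\<close>.\<close>
    define W\<^sub>0 where "W\<^sub>0 = mat n n (\<lambda>(a, b). if a = i \<and> b \<in> ?F then \<nu> b else 0)"
    have W0s: "supp_in n W\<^sub>0 (\<lambda>a b. a = i \<and> blk i < blk b)"
      using nb_props(1)[OF i] by (auto simp: W\<^sub>0_def supp_in_def)
    have W0c: "W\<^sub>0 \<in> carrier_mat n n" by (simp add: W\<^sub>0_def)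
    have V0s: "supp_in n (W\<^sub>0 * g x\<^sub>1) (\<lambda>a b. a = i \<and> blk i < blk b)"
      by (rule new_row_supp[OF n1'(5) W0s])
    define x\<^sub>0 where "x\<^sub>0 = W\<^sub>0 * g x\<^sub>1 + x\<^sub>1"
    have x1s: "supp_in n x\<^sub>1 (\<lambda>a b. Suc i \<le> a \<and> blk a < blk b)" using x1 by (simp add: lower_rows_def)
    have x0: "x\<^sub>0 \<in> ?V" unfolding lower_rows_def x\<^sub>0_def mem_Collect_eq
      by (intro supp_in_add supp_in_mono[OF V0s] supp_in_mono[OF x1s]) auto
    have V0c: "W\<^sub>0 * g x\<^sub>1 \<in> carrier_mat n n" "x\<^sub>1 \<in> carrier_mat n n"
      using V0s x1s by (auto simp: supp_in_def)
    have idx: "x\<^sub>0 $$ (a, b) = (W\<^sub>0 * g x\<^sub>1) $$ (a, b) + x\<^sub>1 $$ (a, b)" if "a < n" "b < n" for a b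
      unfolding x\<^sub>0_def by (rule index_add_mat(1)) (use that carrier_matD[OF V0c(2)] in auto)
    have zero: "(W\<^sub>0 * g x\<^sub>1) $$ (a, b) = 0" if "a < n" "b < n" "a \<noteq> i" for a b
      using V0s that unfolding supp_in_def by blast
    have zero': "x\<^sub>1 $$ (i, b) = 0" if "b < n" for b
      using x1s that assms(1) unfolding supp_in_def by (metis Suc_n_not_le_n)
    have d: "drop_row i x\<^sub>0 = x\<^sub>1"
    proof (rule eq_matI)
      fix a b assume "a < dim_row x\<^sub>1" "b < dim_col x\<^sub>1"
      then have "a < n" "b < n" using V0c by auto
      then show "drop_row i x\<^sub>0 $$ (a, b) = x\<^sub>1 $$ (a, b)"
        using idx zero zero' by (auto simp: drop_row_def)
    qed (use V0c in \<open>auto simp: drop_row_def\<close>)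
    have vx0: "V x\<^sub>0 = W\<^sub>0 * g x\<^sub>1"
    proof (rule eq_matI)
      fix a b assume "a < dim_row (W\<^sub>0 * g x\<^sub>1)" "b < dim_col (W\<^sub>0 * g x\<^sub>1)"
      then have "a < n" "b < n" using V0c by auto
      then show "V x\<^sub>0 $$ (a, b) = (W\<^sub>0 * g x\<^sub>1) $$ (a, b)"
        unfolding defs(5) only_row_def by (cases "a = i") (simp_all add: idx zero zero' del: index_mult_mat(1))
    qed (use V0c in \<open>auto simp: defs(5) only_row_def\<close>)
    note L = lift[OF d]
    define W Wt B A where "W = (\<lambda>x. V x * G' x)" "Wt = (\<lambda>x. block_part i (W x))"
      "B = (\<lambda>x. later_part i (W x) * H x)" "A = (\<lambda>x. Wt x * H x)"
    note defs2 = this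
    define \<theta> where "\<theta> = (\<lambda>x. H x * chain_hom i (later_ratio i (A x) (B x)) * H' x)"
    define U where "U = (\<lambda>x. (W x - (Wt x + Wt x * \<theta> x)) * H x * chain_T (Suc i) * H' x)"
    define N where "N = (\<lambda>x. col_clear i (Wt x))"
    define \<zeta> where "\<zeta> = (\<lambda>x. chain_hom i (row_ratio i (A x)))"
    define U' where "U' = (\<lambda>x. (A x - free_part i (A x)) * chain_T (Suc i))"
    define s where "s = (\<lambda>x. A x $$ (i, nxt i))"
    have gc: "g x\<^sub>1 \<in> carrier_mat n n" "g' x\<^sub>1 \<in> carrier_mat n n" "h x\<^sub>1 \<in> carrier_mat n n"
      using regular_matD(1)[OF reg(1)] regular_matD(1)[OF reg(2)] regular_matD(1)[OF reg(3)] by auto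
    have Wx0: "W x\<^sub>0 = W\<^sub>0"
    proof -
      have "W x\<^sub>0 = W\<^sub>0 * g x\<^sub>1 * g' x\<^sub>1" by (simp add: defs2 vx0 defs(2) d)
      also have "\<dots> = W\<^sub>0 * (g x\<^sub>1 * g' x\<^sub>1)" by (rule assoc_mult_mat[OF W0c gc(1,2)])
      finally show ?thesis using W0c n1'(6) by simp
    qed
    have Wtx0: "Wt x\<^sub>0 = W\<^sub>0" unfolding defs2(2) Wx0
      by (rule eq_matI) (auto simp: block_part_def W\<^sub>0_def)
    have sx0: "s x\<^sub>0 \<noteq> 0"
    proof -
      have "s x\<^sub>0 = (W\<^sub>0 * h x\<^sub>1) $$ (i, nxt i)"
        unfolding s_def defs2(4) Wtx0 by (simp add: defs(3) d)
      also have "\<dots> = (\<Sum>b<n. W\<^sub>0 $$ (i, b) * h x\<^sub>1 $$ (b, nxt i))"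
        by (rule mult_entry[OF W0c gc(3) assms(1) nxt_props(1)[OF i]])
      also have "\<dots> = (\<Sum>b\<in>?F. \<nu> b * h x\<^sub>1 $$ (b, nxt i))"
        by (rule sum.mono_neutral_cong_right) (use assms(1) in \<open>auto simp: W\<^sub>0_def\<close>)
      finally show ?thesis using \<nu> by simp
    qed
    have p: "piv i < n" "piv i \<in> ?F" using piv_props(1,2)[OF i] by auto
    have Wx0nz: "W x\<^sub>0 $$ (i, b) \<noteq> 0" "Wt x\<^sub>0 $$ (i, b) \<noteq> 0" if "b \<in> ?F" for b
      unfolding Wx0 Wtx0 using that \<nu>(1) assms(1) by (auto simp: W\<^sub>0_def)
    have W: "regular_mat n ?V x\<^sub>0 W" unfolding defs2(1) by (intro regular_mat_mult L V)
    have parts: "regular_mat n ?V x\<^sub>0 (\<lambda>x. block_part i (M x))" "regular_mat n ?V x\<^sub>0 (\<lambda>x. later_part i (M x))"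
      "regular_mat n ?V x\<^sub>0 (\<lambda>x. free_part i (M x))" if M: "regular_mat n ?V x\<^sub>0 M" for M
      unfolding block_part_def later_part_def free_part_def
      by (intro regular_mat_mat regular_if regular_matD(2)[OF M]; assumption)+
    have Wt: "regular_mat n ?V x\<^sub>0 Wt" unfolding defs2(2) by (intro parts W)
    have B: "regular_mat n ?V x\<^sub>0 B" unfolding defs2(3) by (intro parts W regular_mat_mult L)
    have A: "regular_mat n ?V x\<^sub>0 A" unfolding defs2(4) by (intro Wt regular_mat_mult L)
    have s: "regular n ?V x\<^sub>0 s" unfolding s_def
      by (rule regular_matD(2)[OF A assms(1) nxt_props(1)[OF i]])
    \<comment> \<open>Outside the index range the coefficients are unspecified matrix entries, so they are cut
      off.\<close>
    have out: "chain_hom i \<delta> = chain_hom i (\<lambda>c. if c < n then \<delta> c else 0)" for \<delta> :: "nat \<Rightarrow> 'a"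
      unfolding chain_hom_def by (intro cong_mat refl) (auto simp: free_nxt_col_def intro!: sum.cong)
    have quot: "regular n ?V x\<^sub>0 (\<lambda>x. if c < n then M x $$ (i, c) / s x else 0)"
      if "regular_mat n ?V x\<^sub>0 M" for M c
      by (cases "c < n") (auto intro!: regular_divide regular_matD(2)[OF that] assms(1) s x0 sx0 regular_const)
    have rZ1: "regular_mat n ?V x\<^sub>0 (\<lambda>x. chain_hom i (later_ratio i (A x) (B x)))"
    proof (subst out, rule regular_chain_hom)
      fix c
      have "(\<lambda>x. if c < n then later_ratio i (A x) (B x) c else 0) =
          (\<lambda>x. if nb i < blk c then (if c < n then B x $$ (i, c) / s x else 0) else 0)"
        by (auto simp: later_ratio_def s_def)
      then show "regular n ?V x\<^sub>0 (\<lambda>x. if c < n then later_ratio i (A x) (B x) c else 0)"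
        using regular_if[OF quot[OF B]] by simp
    qed
    have \<theta>: "regular_mat n ?V x\<^sub>0 \<theta>" unfolding \<theta>_def by (intro regular_mat_mult L rZ1)
    have U: "regular_mat n ?V x\<^sub>0 U" unfolding U_def
      by (intro regular_mat_mult regular_mat_diff regular_mat_add L W Wt \<theta> regular_mat_const cc)
    have N: "regular_mat n ?V x\<^sub>0 N" unfolding N_def col_clear_def
      by (intro regular_mat_mat regular_if regular_divide regular_matD(2)[OF Wt] assms(1) p x0 Wx0nz(2))
    have \<zeta>: "regular_mat n ?V x\<^sub>0 \<zeta>" unfolding \<zeta>_def
    proof (subst out, rule regular_chain_hom)
      fix c
      show "regular n ?V x\<^sub>0 (\<lambda>x. if c < n then row_ratio i (A x) c else 0)"
        using quot[OF A, of c] unfolding row_ratio_def s_def .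
    qed
    have U': "regular_mat n ?V x\<^sub>0 U'" unfolding U'_def
      by (intro regular_mat_mult regular_mat_diff A parts regular_mat_const cc)
    have rs: "regular_mat n ?V x\<^sub>0 (\<lambda>x. row_scale i (f x))" if "regular n ?V x\<^sub>0 f" for f
    proof -
      have "regular n ?V x\<^sub>0 (\<lambda>x. if a = b then (if a = i then f x else 1) else 0)" for a b
        using that by (cases "a = b"; cases "a = i") (simp_all add: regular_const)
      then show ?thesis unfolding row_scale_def by (rule regular_mat_mat)
    qed
    let ?g = "\<lambda>x. (1\<^sub>m n + N x) * ((1\<^sub>m n + \<theta> x) * ((1\<^sub>m n - U x) * G x))"
    let ?g' = "\<lambda>x. G' x * (1\<^sub>m n + U x) * (1\<^sub>m n - \<theta> x) * (1\<^sub>m n - N x)"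
    let ?h = "\<lambda>x. (1\<^sub>m n + N x) * (H x * ((1\<^sub>m n + U' x) * ((1\<^sub>m n - \<zeta> x) * row_scale i (s x))))"
    let ?h' = "\<lambda>x. row_scale i (inverse (s x)) * (1\<^sub>m n + \<zeta> x) * (1\<^sub>m n - U' x) * H' x * (1\<^sub>m n - N x)"
    have rg: "regular_mat n ?V x\<^sub>0 ?g" "regular_mat n ?V x\<^sub>0 ?g'" "regular_mat n ?V x\<^sub>0 ?h" "regular_mat n ?V x\<^sub>0 ?h'"
      by (intro regular_mat_mult regular_mat_one_plus N \<theta> U L U' \<zeta> rs s regular_inverse x0 sx0)+
    have nW: "near n ?V x\<^sub>0 (\<lambda>x. \<forall>b\<in>?F. W x $$ (i, b) \<noteq> 0)"
      by (rule near_ball, simp, rule regular_near_nonzero[OF regular_matD(2)[OF W assms(1)] x0 Wx0nz(1)]) auto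
    have ns: "near n ?V x\<^sub>0 (\<lambda>x. s x \<noteq> 0)" by (rule regular_near_nonzero[OF s x0 sx0])
    have "near n ?V x\<^sub>0 (\<lambda>x. \<exists>y. normalizes i x (?g x) (?g' x) (?h x) (?h' x) y)"
      using near_conj[OF L(5) near_conj[OF nW ns]]
    proof (rule near_mono)
      fix x assume x: "x \<in> ?V" and a: "(\<exists>y. normalizes (Suc i) (drop_row i x) (G x) (G' x) (H x) (H' x) y)
        \<and> (\<forall>b\<in>?F. W x $$ (i, b) \<noteq> 0) \<and> s x \<noteq> 0"
      then obtain y where y: "normalizes (Suc i) (drop_row i x) (G x) (G' x) (H x) (H' x) y" by blast
      have nzW: "\<And>b. b < n \<Longrightarrow> blk b = nb i \<Longrightarrow> piv i \<le> b \<Longrightarrow> (V x * G' x) $$ (i, b) \<noteq> 0"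
        using a by (auto simp: defs2(1))
      have nzs: "(block_part i (V x * G' x) * H x) $$ (i, nxt i) \<noteq> 0"
        using a by (simp add: s_def defs2)
      show "\<exists>y. normalizes i x (?g x) (?g' x) (?h x) (?h' x) y"
        using normalizes_pivot_row[OF i y row_decomposition(2)[OF x], folded defs(5), OF nzW nzs]
        unfolding defs(5) row_decomposition(3)[OF x]
        unfolding defs(5)[symmetric] N_def U_def \<theta>_def U'_def \<zeta>_def s_def defs2 by blast
    qed
    then have "generically_normal i x\<^sub>0 ?g ?g' ?h ?h'"
      unfolding generically_normal_def using x0 rg by blast
    then show ?thesis by blast
  qed
qed

lemma generically_normal_base:
  "generically_normal n (0\<^sub>m n n :: 'a::field mat) (\<lambda>_. 1\<^sub>m n) (\<lambda>_. 1\<^sub>m n) (\<lambda>_. 1\<^sub>m n) (\<lambda>_. 1\<^sub>m n)"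
proof -
  have z: "x = 0\<^sub>m n n" if "x \<in> lower_rows n" for x :: "'a mat"
    using that by (intro eq_matI) (auto simp: lower_rows_def supp_in_def)
  have c: "chain n = (0\<^sub>m n n :: 'a mat)" by (rule eq_matI) (auto simp: chain_def)
  have Y: "\<not> normal_supp n a b" if "a < n" for a b
    using that normal_supp_props[of n a b] by auto
  have "normalizes n (0\<^sub>m n n :: 'a mat) (1\<^sub>m n) (1\<^sub>m n) (1\<^sub>m n) (1\<^sub>m n) (0\<^sub>m n n)"
    unfolding normalizes_def c
    by (auto simp: conjugates_def acts_from_def upper_def blockupper_def supp_in_def Y)
  then have "near n (lower_rows n) (0\<^sub>m n n :: 'a mat) (\<lambda>x. \<exists>y. normalizes n x (1\<^sub>m n) (1\<^sub>m n) (1\<^sub>m n) (1\<^sub>m n) y)"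
    by (intro near_True) (use z in blast)
  then show ?thesis
    by (auto simp: generically_normal_def lower_rows_def supp_in_def intro!: regular_mat_const)
qed

lemma generic_normal_form:
  "\<exists>(x\<^sub>0 :: 'a::field_char_0 mat) g g' h h'. generically_normal 0 x\<^sub>0 g g' h h'"
proof -
  have "\<exists>(x\<^sub>0 :: 'a mat) g g' h h'. generically_normal i x\<^sub>0 g g' h h'" if "i \<le> n" for i
    using that
  proof (induction rule: inc_induct)
    case base show ?case using generically_normal_base by blast
  next
    case (step i) then show ?case using generically_normal_step by blast
  qed
  then show ?thesis by blast
qed

end

section \<open>Forests and the torus\<close>

text \<open>
  Conjugation by the diagonal matrix with entries \<open>\<tau>\<close> multiplies the entry
  in position \<open>(a, b)\<close> by \<open>\<tau> a / \<tau> b\<close>. So the question is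
  whether arbitrary nonzero entries in the positions of \<open>E\<close> can be turned into 1
  at once, which is the case if \<open>E\<close> is a forest as an undirected graph.
\<close>

definition torus_solvable :: "(nat \<times> nat) set \<Rightarrow> 'a::field itself \<Rightarrow> bool" where
  "torus_solvable E _ \<longleftrightarrow> (\<forall>c :: nat \<times> nat \<Rightarrow> 'a. (\<forall>e\<in>E. c e \<noteq> 0) \<longrightarrow>
     (\<exists>\<tau> :: nat \<Rightarrow> 'a. (\<forall>v. \<tau> v \<noteq> 0) \<and> (\<forall>(a, b)\<in>E. \<tau> a * c (a, b) = \<tau> b)))"

text \<open>
  Scaling \<open>\<tau>\<close> on \<open>X\<close> respects the equations of
  \<open>E\<close>, because no edge of \<open>E\<close> crosses \<open>X\<close>, and it can
  be used to satisfy the equation of the new edge, which does.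
\<close>

lemma torus_solvable_insert:
  assumes E: "torus_solvable E TYPE('a::field)"
    and X: "\<And>i j. (i, j) \<in> E \<Longrightarrow> i \<in> X \<longleftrightarrow> j \<in> X" and ab: "(a \<in> X) \<noteq> (b \<in> X)"
  shows "torus_solvable (insert (a, b) E) TYPE('a)"
  unfolding torus_solvable_def
proof (intro allI impI)
  fix c :: "nat \<times> nat \<Rightarrow> 'a" assume c: "\<forall>e\<in>insert (a, b) E. c e \<noteq> 0"
  then have "\<forall>e\<in>E. c e \<noteq> 0" by simp
  with E have "\<exists>\<tau>. (\<forall>v. \<tau> v \<noteq> 0) \<and> (\<forall>(a, b)\<in>E. \<tau> a * c (a, b) = \<tau> b)"
    unfolding torus_solvable_def by simp
  then obtain \<tau> where \<tau>: "\<forall>v. \<tau> v \<noteq> 0" "\<forall>(a, b)\<in>E. \<tau> a * c (a, b) = \<tau> b" by (elim exE conjE)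
  define \<kappa> where "\<kappa> = (if a \<in> X then \<tau> b / (\<tau> a * c (a, b)) else \<tau> a * c (a, b) / \<tau> b)"
  define \<sigma> where "\<sigma> v = (if v \<in> X then \<kappa> * \<tau> v else \<tau> v)" for v
  have "\<kappa> \<noteq> 0" using \<tau>(1) c by (simp add: \<kappa>_def)
  then have 1: "\<forall>v. \<sigma> v \<noteq> 0" using \<tau>(1) by (simp add: \<sigma>_def)
  have 2: "\<sigma> a * c (a, b) = \<sigma> b"
    using \<tau>(1) c ab by (cases "a \<in> X") (auto simp: \<sigma>_def \<kappa>_def)
  have 3: "\<sigma> i * c (i, j) = \<sigma> j" if "(i, j) \<in> E" for i j
    using X[OF that] \<tau>(2) that by (auto simp: \<sigma>_def mult.assoc)
  show "\<exists>\<tau>. (\<forall>v. \<tau> v \<noteq> 0) \<and> (\<forall>(a, b)\<in>insert (a, b) E. \<tau> a * c (a, b) = \<tau> b)"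
    using 1 2 3 by (intro exI[of _ \<sigma>]) auto
qed

text \<open>
  A forest is certified by a ranking of its edges together with, for each edge, a set of
  vertices that the edge crosses while other edges of the same or smaller rank do not.
\<close>

lemma torus_solvable_ranked:
  fixes rk :: "nat \<times> nat \<Rightarrow> nat"
  assumes "finite E"
    and "\<And>a b. (a, b) \<in> E \<Longrightarrow> \<exists>X. (a \<in> X) \<noteq> (b \<in> X) \<and>
      (\<forall>i j. (i, j) \<in> E \<longrightarrow> (i, j) \<noteq> (a, b) \<longrightarrow> rk (i, j) \<le> rk (a, b) \<longrightarrow> (i \<in> X \<longleftrightarrow> j \<in> X))"
  shows "torus_solvable E TYPE('a::field)"
  using assms
proof (induction "card E" arbitrary: E)
  case 0
  then show ?case by (auto simp: torus_solvable_def intro: exI[of _ "\<lambda>_. 1"])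
next
  case (Suc m)
  then have ne: "E \<noteq> {}" "finite (rk ` E)" by auto
  then have "Max (rk ` E) \<in> rk ` E" by (intro Max_in) auto
  then obtain a b where e: "(a, b) \<in> E" "rk (a, b) = Max (rk ` E)" by (metis imageE surj_pair)
  have max: "rk e' \<le> rk (a, b)" if "e' \<in> E" for e' using that ne e by simp
  have "torus_solvable (E - {(a, b)}) TYPE('a)"
  proof (rule Suc.hyps(1))
    show "m = card (E - {(a, b)})" using Suc.hyps(2) Suc.prems(1) e by simp
    show "finite (E - {(a, b)})" using Suc.prems(1) by simp
    fix i j assume "(i, j) \<in> E - {(a, b)}"
    then show "\<exists>X. (i \<in> X) \<noteq> (j \<in> X) \<and> (\<forall>k l. (k, l) \<in> E - {(a, b)} \<longrightarrow> (k, l) \<noteq> (i, j) \<longrightarrow>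
        rk (k, l) \<le> rk (i, j) \<longrightarrow> (k \<in> X \<longleftrightarrow> l \<in> X))"
      using Suc.prems(2)[of i j] by blast
  qed
  moreover obtain X where "(a \<in> X) \<noteq> (b \<in> X)"
    "\<forall>i j. (i, j) \<in> E \<longrightarrow> (i, j) \<noteq> (a, b) \<longrightarrow> rk (i, j) \<le> rk (a, b) \<longrightarrow> (i \<in> X \<longleftrightarrow> j \<in> X)"
    using Suc.prems(2)[OF e(1)] by blast
  ultimately have "torus_solvable (insert (a, b) (E - {(a, b)})) TYPE('a)"
    by (intro torus_solvable_insert[where X = X]) (use max in auto)
  then show ?case using e by (simp add: insert_absorb)
qed

context composition
begin

lemma normal_supp_iff_root: "normal_supp 0 a b \<longleftrightarrow> (Suc a, Suc b) \<in> base r \<union> Phi r"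
  unfolding normal_supp_def by (auto simp: base_iff Phi_iff)

lemma normal_supp_iff_pivot: "normal_supp 0 a b \<longleftrightarrow>
  (\<exists>k\<in>piv_rows. blk k = blk a \<and> a \<le> k \<and> b = piv k \<and> (a = k \<or> a \<in> piv ` piv_rows))"
proof
  assume "normal_supp 0 a b"
  then show "\<exists>k\<in>piv_rows. blk k = blk a \<and> a \<le> k \<and> b = piv k \<and> (a = k \<or> a \<in> piv ` piv_rows)"
    unfolding normal_supp_def by fastforce
next
  assume "\<exists>k\<in>piv_rows. blk k = blk a \<and> a \<le> k \<and> b = piv k \<and> (a = k \<or> a \<in> piv ` piv_rows)"
  then obtain k where k: "k \<in> piv_rows" "blk k = blk a" "a \<le> k" "b = piv k" "a = k \<or> a \<in> piv ` piv_rows" by blast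
  show "normal_supp 0 a b"
  proof (cases "a = k")
    case True then show ?thesis using k by (simp add: normal_supp_def)
  next
    case False
    then obtain h where "h \<in> piv_rows" "piv h = a" using k by auto
    then show ?thesis unfolding normal_supp_def using k False by (metis le0 le_neq_implies_less)
  qed
qed

lemma last_row_piv:
  assumes "Suc t < length r"
  shows "R r (Suc t) - 1 \<in> piv_rows" "blk (R r (Suc t) - 1) = t" "piv (R r (Suc t) - 1) = R r (Suc t)"
proof -
  let ?k = "R r (Suc t) - 1"
  have s: "?k < n" "blk ?k = t" "lab ?k = 1" using slot_index(1-3)[of t 1] r_pos[of t] assms by auto
  have p: "1 \<le> r ! Suc t" using r_pos[OF assms] by simp
  show d: "?k \<in> piv_rows" by (rule piv_rowsI[of ?k "Suc t"]) (use s p assms in auto)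
  show "blk ?k = t" by (rule s(2))
  have "nb ?k \<le> Suc t" by (rule nb_le) (use s p assms in auto)
  then have "nb ?k = Suc t" using nb_props(1)[OF d] s by simp
  then show "piv ?k = R r (Suc t)" using s by (simp add: piv_def)
qed

lemma first_column:
  assumes "k \<in> piv_rows"
  shows "Suc (blk k) < length r" "R r (Suc (blk k)) \<le> piv k" "k \<le> R r (Suc (blk k)) - 1"
proof -
  show l: "Suc (blk k) < length r" using nb_props(1,2)[OF assms] by simp
  have "R r (Suc (blk k)) \<le> R r (nb k)" using nb_props(1)[OF assms] by (intro R_mono) simp
  then show "R r (Suc (blk k)) \<le> piv k"
    using blk_bounds(2)[OF piv_props(1)[OF assms]] piv_props(2)[OF assms] by simp
  show "k \<le> R r (Suc (blk k)) - 1" using blk_bounds(3)[OF piv_rows_less[OF assms]] by simp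
qed

text \<open>
  Both rows also have an entry in the first column of the next block, and \<open>(x,
  y)\<close> is the upper right corner of the resulting rectangle.
\<close>

lemma Psi1_member:
  assumes "x < x'" "x \<in> piv ` piv_rows" "x' \<in> piv ` piv_rows" "normal_supp 0 x y" "normal_supp 0 x' y" "y \<noteq> R r (Suc (blk x))"
  shows "(Suc x, Suc y) \<in> Psi1 r"
proof -
  obtain k where k: "k \<in> piv_rows" "blk k = blk x" "x \<le> k" "y = piv k" using assms(4) unfolding normal_supp_iff_pivot by blast
  obtain k' where k': "k' \<in> piv_rows" "blk k' = blk x'" "x' \<le> k'" "y = piv k'"
    using assms(5) unfolding normal_supp_iff_pivot by blast
  have "k' = k" using piv_inj k k' by metis
  note k' = k'[unfolded this]
  let ?l = "R r (Suc (blk x)) - 1"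
  note f = first_column[OF k(1), unfolded k(2)]
  note l = last_row_piv[OF f(1)]
  obtain h where h: "h \<in> piv_rows" "piv h = x" using assms(2) by auto
  have Phi: "(Suc x, Suc y) \<in> Phi r"
    unfolding Phi_iff by (intro exI[of _ h] exI[of _ k]) (use h k k' assms(1) in simp)
  have "normal_supp 0 x (R r (Suc (blk x)))" "normal_supp 0 x' (R r (Suc (blk x)))"
    unfolding normal_supp_iff_pivot using l f k k' assms(2,3) by (auto intro!: bexI[of _ ?l])
  then have "(Suc x, Suc (R r (Suc (blk x)))) \<in> base r \<union> Phi r" "(Suc x', Suc (R r (Suc (blk x)))) \<in> base r \<union> Phi r"
    "(Suc x', Suc y) \<in> base r \<union> Phi r" using assms(5) by (simp_all only: normal_supp_iff_root)
  moreover have "Suc (R r (Suc (blk x))) < Suc y" using f(2) k(4) assms(6) by simp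
  ultimately show ?thesis unfolding Psi1_def using Phi assms(1) by blast
qed

lemma finite_Phi: "finite (Phi r)"
proof -
  have "finite piv_rows" by (rule finite_subset[of _ "{..<n}"]) (auto dest: piv_rows_less)
  then have "finite (snd ` base r \<times> snd ` base r)" by (simp add: base_eq)
  then show ?thesis by (rule finite_subset[rotated]) (force simp: Phi_def)
qed

text \<open>
  With \<open>m\<close> the position of \<open>x\<close> in its block, the last
  \<open>m\<close> rows of the block \<open>s\<close> have base roots, because the block of
  \<open>x\<close> is a later one with at least \<open>m\<close> columns. Each of these roots
  gives a root of \<open>\<Phi>\<close> in the top row of the block \<open>s\<close>.
\<close>

lemma Psi2_member:
  assumes x: "x \<in> piv ` piv_rows" "Suc (blk x) < length r" and s: "1 \<le> s" "s < blk x" "Suc x - R r (blk x) < r ! s"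
    and last: "Suc x < R r (Suc (blk x))"
  shows "(Suc x, Suc (R r (Suc (blk x)))) \<in> Psi2 r"
proof -
  define t where "t = blk x"
  define m where "m = Suc x - R r t"
  have xn: "x < n" using x(1) piv_props(1) by auto
  note b = blk_bounds[OF xn, folded t_def]
  note l = last_row_piv[OF x(2), folded t_def]
  have m: "1 \<le> m" "m < r ! t" "R r t + m = Suc x"
    using b last R_Suc[OF b(1)] by (auto simp: m_def t_def[symmetric])
  obtain h where h: "h \<in> piv_rows" "piv h = x" using x(1) by auto
  have Phi: "(Suc x, Suc (R r (Suc t))) \<in> Phi r"
    unfolding Phi_iff by (intro exI[of _ h] exI[of _ "R r (Suc t) - 1"]) (use h l last t_def in simp)
  have sl: "s < length r" "s < t" using s b by (auto simp: t_def)
  define k where "k l = R r (Suc s) - l" for l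
  have k: "k l \<in> piv_rows" "blk (k l) = s" "lab (k l) = l" "R r s < k l" if "l \<in> {1..m}" for l
  proof -
    have lr: "1 \<le> l" "l < r ! s" "l \<le> r ! t" using that s(3) m by (auto simp: m_def t_def)
    show sk: "blk (k l) = s" "lab (k l) = l" using slot_index(2,3)[OF sl(1) lr(1)] lr by (auto simp: k_def)
    have "k l < n" using slot_index(1)[OF sl(1) lr(1)] lr by (simp add: k_def)
    then show "k l \<in> piv_rows" using sk lr b sl by (intro piv_rowsI[of _ t]) auto
    show "R r s < k l" using R_Suc[OF sl(1)] lr by (simp add: k_def)
  qed
  obtain u where u: "s = Suc u" using s(1) by (cases s) auto
  have top: "R r s \<in> piv ` piv_rows" using last_row_piv[of u] sl u by (metis image_eqI)
  have bs: "blk (R r s) = s" by (rule blk_eqI) (use R_Suc[OF sl(1)] r_pos[OF sl(1)] in auto)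
  have "(\<lambda>l. (R r s + 1, Suc (piv (k l)))) ` {1..m} \<subseteq> {\<phi> \<in> Phi r. \<exists>j. \<phi> = (R r s + 1, j)}"
  proof (rule image_subsetI)
    fix l assume l: "l \<in> {1..m}"
    obtain h where "h \<in> piv_rows" "piv h = R r s" using top by auto
    then have "(Suc (R r s), Suc (piv (k l))) \<in> Phi r"
      unfolding Phi_iff using k[OF l] bs by (intro exI[of _ h] exI[of _ "k l"]) auto
    then show "(R r s + 1, Suc (piv (k l))) \<in> {\<phi> \<in> Phi r. \<exists>j. \<phi> = (R r s + 1, j)}" by simp
  qed
  then have "card ((\<lambda>l. (R r s + 1, Suc (piv (k l)))) ` {1..m}) \<le> card {\<phi> \<in> Phi r. \<exists>j. \<phi> = (R r s + 1, j)}"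
    by (intro card_mono) (simp add: finite_Phi)
  moreover have "inj_on (\<lambda>l. (R r s + 1, Suc (piv (k l)))) {1..m}"
  proof (rule inj_onI)
    fix l l' assume l: "l \<in> {1..m}" "l' \<in> {1..m}"
      and "(R r s + 1, Suc (piv (k l))) = (R r s + 1, Suc (piv (k l')))"
    then have "k l = k l'" using piv_inj k(1)[OF l(1)] k(1)[OF l(2)] by simp
    then have "lab (k l) = lab (k l')" by (rule arg_cong)
    then show "l = l'" unfolding k(3)[OF l(1)] k(3)[OF l(2)] .
  qed
  ultimately have card: "m \<le> card {\<phi> \<in> Phi r. \<exists>j. \<phi> = (R r s + 1, j)}" by (simp add: card_image)
  have ex: "\<exists>s'. 1 \<le> s' \<and> s' < Suc t \<and> m \<le> card {\<phi> \<in> Phi r. \<exists>j. \<phi> = (R r (s' - 1) + 1, j)}"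
    by (intro exI[of _ "Suc s"]) (use sl card in simp)
  have "(Suc x, Suc (R r (Suc t))) \<in> Psi2 r"
    unfolding Psi2_def mem_Collect_eq
    by (rule conjI[OF Phi], rule bexI[of _ "Suc t"], rule exI[of _ m]) (use ex m b in simp_all)
  then show ?thesis by (simp add: t_def)
qed

definition unit_positions :: "(nat \<times> nat) set" where
  "unit_positions = {(a, b). normal_supp 0 a b \<and> (Suc a, Suc b) \<notin> Psi r}"

text \<open>
  Within a block, the edges in the first column of the next block come first, from top to
  bottom, as far as their row is a pivot column. The other edges in rows that are pivot
  columns follow, and the edges in the remaining rows come last.
\<close>

definition edge_class :: "nat \<times> nat \<Rightarrow> nat" where
  "edge_class e = (if fst e \<notin> piv ` piv_rows then n + 2
     else if snd e \<noteq> R r (Suc (blk (fst e))) then n + 1 else fst e)"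

definition edge_rank :: "nat \<times> nat \<Rightarrow> nat" where
  "edge_rank e = blk (fst e) * (n + 3) + edge_class e"

lemma edge_rank_less:
  assumes "normal_supp 0 a b" "blk a < blk a' \<or> (blk a = blk a' \<and> edge_class (a, b) < edge_class (a', b'))"
  shows "edge_rank (a, b) < edge_rank (a', b')"
proof -
  have "a < n" using assms(1) unfolding normal_supp_iff_pivot by (meson piv_rows_less le_less_trans)
  then have c: "edge_class (a, b) < n + 3" by (auto simp: edge_class_def)
  show ?thesis
  proof (cases "blk a < blk a'")
    case True
    then have "Suc (blk a) * (n + 3) \<le> blk a' * (n + 3)" by (intro mult_le_mono1) simp
    then show ?thesis using c by (simp add: edge_rank_def)
  next
    case False
    then show ?thesis using assms(2) by (simp add: edge_rank_def)
  qed
qed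

text \<open>
  Each edge is separated by a set of at most two vertices. An edge whose row is not a pivot
  column is the only one at its row. An edge outside the first column of the next block is
  separated by its column, since by the choice of \<open>\<Psi>\<^sub>1\<close> no other edge
  of that column has a row that is a pivot column. In the first column of the next block there
  are two cases. If the position of the row \<open>a\<close> in its block exceeds the sizes of
  all earlier blocks but the first, then the base root in column \<open>a\<close> lies in a
  row \<open>h\<close> of the first block; that row meets no other edge, and the two vertices
  together form the set. Otherwise the column serves again, since by the choice of
  \<open>\<Psi>\<^sub>2\<close> all edges above \<open>a\<close> in it have been removed.
\<close>

lemma unit_positions_cut:
  assumes ab: "(a, b) \<in> unit_positions"
  shows "\<exists>X. (a \<in> X) \<noteq> (b \<in> X) \<and> (\<forall>i j. (i, j) \<in> unit_positions \<longrightarrow> (i, j) \<noteq> (a, b) \<longrightarrow>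
    edge_rank (i, j) \<le> edge_rank (a, b) \<longrightarrow> (i \<in> X \<longleftrightarrow> j \<in> X))"
proof -
  have Y: "normal_supp 0 a b" and nP: "(Suc a, Suc b) \<notin> Psi r" using ab by (auto simp: unit_positions_def)
  obtain k where k: "k \<in> piv_rows" "blk k = blk a" "a \<le> k" "b = piv k" "a = k \<or> a \<in> piv ` piv_rows"
    using Y unfolding normal_supp_iff_pivot by blast
  note Yp = normal_supp_props[OF Y]
  \<comment> \<open>Edges whose row is \<open>b\<close> belong to a later block, hence only edges whose column
    is \<open>b\<close> matter for the cut \<open>{b}\<close>.\<close>
  have later: "\<not> edge_rank (b, j) \<le> edge_rank (a, b)" for j
    using edge_rank_less[OF Y, of b j] Yp by simp
  have same: "\<exists>k'. k' \<in> piv_rows \<and> blk k' = blk i \<and> i \<le> k' \<and> j = piv k' \<and> (i = k' \<or> i \<in> piv ` piv_rows)"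
    if "(i, j) \<in> unit_positions" for i j using that unfolding unit_positions_def normal_supp_iff_pivot by blast
  have sameblk: "blk i = blk a" if "(i, b) \<in> unit_positions" for i
    using same[OF that] k piv_inj by metis
  show ?thesis
  proof (cases "a \<in> piv ` piv_rows")
    case False
    have "a \<noteq> b" using Yp by simp
    moreover have "i = a \<longleftrightarrow> j = a" if "(i, j) \<in> unit_positions" "(i, j) \<noteq> (a, b)" for i j
      using same[OF that(1)] that(2) False k by auto
    ultimately show ?thesis by (intro exI[of _ "{a}"]) auto
  next
    case True
    have colb: "\<exists>X. (a \<in> X) \<noteq> (b \<in> X) \<and> (\<forall>i j. (i, j) \<in> unit_positions \<longrightarrow> (i, j) \<noteq> (a, b) \<longrightarrow>
        edge_rank (i, j) \<le> edge_rank (a, b) \<longrightarrow> (i \<in> X \<longleftrightarrow> j \<in> X))"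
      if other: "\<And>i. (i, b) \<in> unit_positions \<Longrightarrow> i \<in> piv ` piv_rows \<Longrightarrow> i \<noteq> a \<Longrightarrow> blk i = blk a \<Longrightarrow>
        edge_class (a, b) < edge_class (i, b)"
    proof (intro exI[of _ "{b}"] conjI allI impI)
      show "(a \<in> {b}) \<noteq> (b \<in> {b})" using Yp by simp
      fix i j assume e: "(i, j) \<in> unit_positions" "(i, j) \<noteq> (a, b)" "edge_rank (i, j) \<le> edge_rank (a, b)"
      have "i \<noteq> b" using later e(3) by auto
      moreover have "j \<noteq> b"
      proof
        assume j: "j = b"
        then have i: "i \<noteq> a" "(i, b) \<in> unit_positions" "blk i = blk a" using e sameblk by auto
        have "edge_class (a, b) < edge_class (i, b)"
        proof (cases "i \<in> piv ` piv_rows")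
          case True then show ?thesis using other i by blast
        next
          case False
          have "a < n" using piv_rows_less[OF k(1)] k(3) by simp
          then show ?thesis using \<open>a \<in> piv ` piv_rows\<close> False by (simp add: edge_class_def)
        qed
        then show False using edge_rank_less[OF Y, of i b] i e(3) j by simp
      qed
      ultimately show "i \<in> {b} \<longleftrightarrow> j \<in> {b}" by simp
    qed
    show ?thesis
    proof (cases "b = R r (Suc (blk a))")
      case False
      show ?thesis
      proof (rule colb)
        fix i assume i: "(i, b) \<in> unit_positions" "i \<in> piv ` piv_rows" "i \<noteq> a" "blk i = blk a"
        have "(Suc a, Suc b) \<in> Psi1 r \<or> (Suc i, Suc b) \<in> Psi1 r"
          using Psi1_member[of a i b] Psi1_member[of i a b] i True Y False
          by (cases "a < i") (auto simp: unit_positions_def)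
        then show "edge_class (a, b) < edge_class (i, b)"
          using nP i(1) by (auto simp: Psi_def unit_positions_def)
      qed
    next
      case b: True
      define m where "m = Suc a - R r (blk a)"
      obtain h where h: "h \<in> piv_rows" "piv h = a" using True by auto
      have an: "a < n" using piv_rows_less[OF k(1)] k(3) by simp
      show ?thesis
      proof (cases "\<exists>s. 1 \<le> s \<and> s < blk a \<and> m \<le> r ! s")
        case True
        then obtain s where s: "1 \<le> s" "s < blk a" "m \<le> r ! s" by blast
        show ?thesis
        proof (rule colb)
          fix i assume i: "(i, b) \<in> unit_positions" "i \<in> piv ` piv_rows" "i \<noteq> a" "blk i = blk a"
          have "\<not> i < a"
          proof
            assume ia: "i < a"
            have "R r (blk a) \<le> i" "a < R r (Suc (blk a))"
              using blk_bounds(2)[of i] blk_bounds(3)[OF an] i(4) ia an by auto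
            then have "(Suc i, Suc b) \<in> Psi2 r"
              unfolding b i(4)[symmetric]
              using first_column(1)[OF k(1)] k(2) s i ia
              by (intro Psi2_member[of i s]) (auto simp: m_def)
            then show False using i(1) by (auto simp: Psi_def unit_positions_def)
          qed
          then show "edge_class (a, b) < edge_class (i, b)"
            using i b \<open>a \<in> piv ` piv_rows\<close> by (simp add: edge_class_def)
        qed
      next
        case False
        have hm: "lab h = m" using piv_props(4)[OF h(1)] h(2) by (simp add: m_def)
        \<comment> \<open>Any other block that contains a row of label \<open>m\<close> is excluded by the case
          assumption.\<close>
        have h0: "blk h = 0"
        proof (rule ccontr)
          assume "blk h \<noteq> 0"
          then show False
            using False nb_props(1)[OF h(1)] piv_props(2)[OF h(1)] h(2) hm lab_bounds[OF piv_rows_less[OF h(1)]]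
            by (metis One_nat_def Suc_leI neq0_conv)
        qed
        have nopiv: "i \<notin> piv ` piv_rows" if "blk i = 0" for i
          using that nb_props(1) piv_props(2) by fastforce
        have hab: "h < a" "a < b" using piv_props(3)[OF h(1)] h(2) Yp by auto
        show ?thesis
        proof (intro exI[of _ "{a, h}"] conjI allI impI)
          show "(a \<in> {a, h}) \<noteq> (b \<in> {a, h})" using hab by auto
          fix i j assume e: "(i, j) \<in> unit_positions" "(i, j) \<noteq> (a, b)" "edge_rank (i, j) \<le> edge_rank (a, b)"
          obtain k' where k': "k' \<in> piv_rows" "blk k' = blk i" "i \<le> k'" "j = piv k'" "i = k' \<or> i \<in> piv ` piv_rows"
            using same[OF e(1)] by blast
          have "j \<noteq> h" using nopiv[OF h0] k' by auto
          moreover have "j = a \<longleftrightarrow> i = h"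
          proof
            assume "j = a"
            then have "k' = h" using piv_inj k' h by metis
            then show "i = h" using k' h0 nopiv[of i] by simp
          next
            assume "i = h" then show "j = a" using k' h nopiv[OF h0] by auto
          qed
          moreover have "i \<noteq> a"
          proof
            assume ia: "i = a"
            then have "j \<noteq> b" using e(2) by simp
            then have "edge_class (a, b) < edge_class (i, j)"
              using ia b \<open>a \<in> piv ` piv_rows\<close> an by (simp add: edge_class_def)
            then show False using edge_rank_less[OF Y, of i j] ia e(3) by simp
          qed
          ultimately show "i \<in> {a, h} \<longleftrightarrow> j \<in> {a, h}" by auto
        qed
      qed
    qed
  qed
qed

lemma unit_positions_solvable: "torus_solvable unit_positions TYPE('a::field)"
proof (rule torus_solvable_ranked[where rk = edge_rank])
  have "unit_positions \<subseteq> {..<n} \<times> {..<n}"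
    unfolding unit_positions_def normal_supp_iff_pivot using piv_props(1) piv_rows_less by (auto intro: le_less_trans)
  then show "finite unit_positions" by (rule finite_subset) simp
qed (rule unit_positions_cut)

end

section \<open>Membership in the canonical set\<close>

lemma finsum_ring_mat:
  fixes f :: "'b \<Rightarrow> 'a::comm_ring_1 mat"
  assumes "finite A" "\<And>a. a \<in> A \<Longrightarrow> f a \<in> carrier_mat n n"
  shows "finsum (ring_mat TYPE('a) n ()) f A \<in> carrier_mat n n \<and>
    (\<forall>i<n. \<forall>j<n. finsum (ring_mat TYPE('a) n ()) f A $$ (i, j) = (\<Sum>a\<in>A. f a $$ (i, j)))"
  using assms
proof (induction A rule: finite_induct)
  case empty
  interpret ring "ring_mat TYPE('a) n ()" by (rule ring_mat)
  show ?case by (simp add: ring_mat_simps)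
next
  case (insert x A)
  interpret ring "ring_mat TYPE('a) n ()" by (rule ring_mat)
  have "finsum (ring_mat TYPE('a) n ()) f (insert x A) = f x + finsum (ring_mat TYPE('a) n ()) f A"
    using insert by (subst finsum_insert) (auto simp: ring_mat_simps)
  moreover have "finsum (ring_mat TYPE('a) n ()) f A \<in> carrier_mat n n"
    "\<forall>i<n. \<forall>j<n. finsum (ring_mat TYPE('a) n ()) f A $$ (i, j) = (\<Sum>a\<in>A. f a $$ (i, j))"
    "f x \<in> carrier_mat n n" using insert by auto
  ultimately show ?case using insert(1,2) by auto
qed

lemma inv_ring_mat:
  fixes g :: "'a::field mat"
  assumes "g \<in> carrier_mat n n" "g' \<in> carrier_mat n n" "g * g' = 1\<^sub>m n" "g' * g = 1\<^sub>m n"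
  shows "g \<in> Units (ring_mat TYPE('a) n ())" "inv\<^bsub>ring_mat TYPE('a) n ()\<^esub> g = g'"
proof -
  interpret ring "ring_mat TYPE('a) n ()" by (rule ring_mat)
  show "g \<in> Units (ring_mat TYPE('a) n ())" using assms by (auto simp: Units_def ring_mat_simps)
  show "inv\<^bsub>ring_mat TYPE('a) n ()\<^esub> g = g'"
    by (rule inv_char) (use assms in \<open>auto simp: ring_mat_simps\<close>)
qed

definition diagonal :: "nat \<Rightarrow> (nat \<Rightarrow> 'a::field) \<Rightarrow> 'a mat" where
  "diagonal n \<tau> = mat n n (\<lambda>(a, b). if a = b then \<tau> a else 0)"

lemma diagonal_carrier: "diagonal n \<tau> \<in> carrier_mat n n"
  by (simp add: diagonal_def)

lemma diagonal_mult_left: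
  assumes "M \<in> carrier_mat n n" "a < n" "b < n"
  shows "(diagonal n \<tau> * M) $$ (a, b) = \<tau> a * M $$ (a, b)"
proof -
  have "(diagonal n \<tau> * M) $$ (a, b) = (\<Sum>d<n. if d = a then \<tau> a * M $$ (a, b) else 0)"
    unfolding mult_entry[OF diagonal_carrier assms] by (rule sum.cong) (use assms in \<open>auto simp: diagonal_def\<close>)
  then show ?thesis using assms by simp
qed

lemma diagonal_mult_right:
  assumes "M \<in> carrier_mat n n" "a < n" "b < n"
  shows "(M * diagonal n \<tau>) $$ (a, b) = M $$ (a, b) * \<tau> b"
proof -
  have "(M * diagonal n \<tau>) $$ (a, b) = (\<Sum>d<n. if d = b then M $$ (a, b) * \<tau> b else 0)"
    unfolding mult_entry[OF assms(1) diagonal_carrier assms(2,3)]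
    by (rule sum.cong) (use assms in \<open>auto simp: diagonal_def\<close>)
  then show ?thesis using assms by simp
qed

lemma diagonal_conjugates:
  assumes "\<And>v. \<tau> v \<noteq> 0" "y \<in> carrier_mat n n"
  shows "conjugates n (diagonal n \<tau>) (diagonal n (\<lambda>v. inverse (\<tau> v))) y
    (mat n n (\<lambda>(a, b). \<tau> a * y $$ (a, b) / \<tau> b))"
proof -
  let ?z = "mat n n (\<lambda>(a, b). \<tau> a * y $$ (a, b) / \<tau> b)"
  have i: "diagonal n \<sigma> * diagonal n (\<lambda>v. inverse (\<sigma> v)) = 1\<^sub>m n" if "\<And>v. \<sigma> v \<noteq> 0" for \<sigma> :: "nat \<Rightarrow> 'a"
  proof (rule eq_matI)
    fix a b assume "a < dim_row (1\<^sub>m n)" "b < dim_col (1\<^sub>m n)"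
    then have "a < n" "b < n" by auto
    then show "(diagonal n \<sigma> * diagonal n (\<lambda>v. inverse (\<sigma> v))) $$ (a, b) = 1\<^sub>m n $$ (a, b)"
      using that by (subst diagonal_mult_left[OF diagonal_carrier]) (auto simp: diagonal_def)
  qed (auto simp: diagonal_def)
  have "diagonal n \<tau> * y = ?z * diagonal n \<tau>"
  proof (rule eq_matI)
    fix a b assume "a < dim_row (?z * diagonal n \<tau>)" "b < dim_col (?z * diagonal n \<tau>)"
    then have ab: "a < n" "b < n" by (auto simp: diagonal_def)
    show "(diagonal n \<tau> * y) $$ (a, b) = (?z * diagonal n \<tau>) $$ (a, b)"
      using diagonal_mult_left[OF assms(2) ab] diagonal_mult_right[of ?z n a b] ab assms(1) by simp
  qed (use assms in \<open>auto simp: diagonal_def\<close>)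
  moreover have "diagonal n (\<lambda>v. inverse (\<tau> v)) * diagonal n \<tau> = 1\<^sub>m n"
    using i[of "\<lambda>v. inverse (\<tau> v)"] assms(1) by simp
  ultimately show ?thesis using i[OF assms(1)] assms(2) by (simp add: conjugates_def diagonal_carrier)
qed

context composition
begin

lemma Phi_elim:
  assumes "\<gamma> \<in> base r \<union> Phi r" obtains a b where "\<gamma> = (Suc a, Suc b)" "a < n" "b < n" "normal_supp 0 a b"
proof -
  have "\<exists>a b. \<gamma> = (Suc a, Suc b)"
  proof (cases "\<gamma> \<in> base r")
    case True then show ?thesis by (auto simp: base_eq)
  next
    case False
    then have "\<gamma> \<in> Phi r" using assms by simp
    then obtain i j k l where "\<gamma> = (j, l)" "(i, j) \<in> base r" "(k, l) \<in> base r" by (auto simp: Phi_def)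
    then show ?thesis by (auto simp: base_eq)
  qed
  then obtain a b where ab: "\<gamma> = (Suc a, Suc b)" by blast
  then have Y: "normal_supp 0 a b" using assms normal_supp_iff_root by simp
  then have "b < n" using normal_supp_props[OF Y] piv_props(1) by auto
  then show ?thesis using that[OF ab] Y normal_supp_props[OF Y] by simp
qed

lemma Psi_subset: "Psi r \<subseteq> Phi r"
  by (auto simp: Psi_def Psi1_def Psi2_def)

lemma canonical_set_member:
  fixes z :: "'a::field mat"
  assumes z: "z \<in> carrier_mat n n"
    and supp: "\<And>a b. a < n \<Longrightarrow> b < n \<Longrightarrow> z $$ (a, b) \<noteq> 0 \<longleftrightarrow> normal_supp 0 a b"
    and one: "\<And>a b. (a, b) \<in> unit_positions \<Longrightarrow> z $$ (a, b) = 1"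
  shows "z \<in> canonical_set r"
proof -
  let ?V = "ring_mat TYPE('a) n ()"
  let ?B = "(base r \<union> Phi r) - Psi r"
  define c where "c \<psi> = z $$ (fst \<psi> - 1, snd \<psi> - 1)" for \<psi> :: root
  have fin: "finite (Psi r)" "finite ?B"
  proof -
    have "finite piv_rows" by (rule finite_subset[of _ "{..<n}"]) (auto dest: piv_rows_less)
    then show "finite (Psi r)" "finite ?B"
      using finite_Phi finite_subset[OF Psi_subset] by (auto simp: base_eq)
  qed
  have E: "(E_root n \<gamma> :: 'a mat) \<in> carrier_mat n n" "c \<gamma> \<cdot>\<^sub>m E_root n \<gamma> \<in> carrier_mat n n" for \<gamma>
    by (simp_all add: E_root_def)
  let ?S = "finsum ?V (\<lambda>\<psi>. c \<psi> \<cdot>\<^sub>m E_root n \<psi>) (Psi r)" and ?T = "finsum ?V (E_root n) ?B"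
  have S: "?S \<in> carrier_mat n n" "\<And>i j. i < n \<Longrightarrow> j < n \<Longrightarrow> ?S $$ (i, j) = (\<Sum>\<psi>\<in>Psi r. (c \<psi> \<cdot>\<^sub>m E_root n \<psi>) $$ (i, j))"
    using finsum_ring_mat[OF fin(1) E(2)] by auto
  have T: "?T \<in> carrier_mat n n" "\<And>i j. i < n \<Longrightarrow> j < n \<Longrightarrow> ?T $$ (i, j) = (\<Sum>\<psi>\<in>?B. E_root n \<psi> $$ (i, j))"
    using finsum_ring_mat[OF fin(2) E(1)] by auto
  have "z = ?S + ?T"
  proof (rule eq_matI)
    fix a b assume "a < dim_row (?S + ?T)" "b < dim_col (?S + ?T)"
    then have ab: "a < n" "b < n" using S(1) T(1) by auto
    have "?S $$ (a, b) = (\<Sum>\<psi>\<in>Psi r. if \<psi> = (Suc a, Suc b) then c \<psi> else 0)"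
      unfolding S(2)[OF ab] by (rule sum.cong) (use ab in \<open>auto simp: E_root_def\<close>)
    also have "\<dots> = (if (Suc a, Suc b) \<in> Psi r then z $$ (a, b) else 0)"
      by (subst sum.delta[OF fin(1)]) (simp add: c_def)
    finally have s: "?S $$ (a, b) = (if (Suc a, Suc b) \<in> Psi r then z $$ (a, b) else 0)" .
    have "?T $$ (a, b) = (\<Sum>\<psi>\<in>?B. if \<psi> = (Suc a, Suc b) then 1 else 0)"
      unfolding T(2)[OF ab] by (rule sum.cong) (use ab in \<open>auto simp: E_root_def\<close>)
    also have "\<dots> = (if (Suc a, Suc b) \<in> ?B then 1 else 0)"
      by (subst sum.delta[OF fin(2)]) simp
    finally have t: "?T $$ (a, b) = (if (Suc a, Suc b) \<in> ?B then 1 else 0)" .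
    have "(Suc a, Suc b) \<in> ?B \<longleftrightarrow> (a, b) \<in> unit_positions" by (auto simp: unit_positions_def normal_supp_iff_root)
    then have "z $$ (a, b) = ?S $$ (a, b) + ?T $$ (a, b)"
      unfolding s t using supp[OF ab] one[of a b] Psi_subset by (auto simp: unit_positions_def normal_supp_iff_root)
    then show "z $$ (a, b) = (?S + ?T) $$ (a, b)" using ab S(1) T(1) by simp
  qed (use S(1) T(1) z in auto)
  moreover have "\<forall>\<psi>\<in>Psi r. c \<psi> \<noteq> 0"
  proof
    fix \<psi> assume "\<psi> \<in> Psi r"
    then obtain a b where "\<psi> = (Suc a, Suc b)" "a < n" "b < n" "normal_supp 0 a b"
      using Phi_elim Psi_subset by blast
    then show "c \<psi> \<noteq> 0" using supp by (simp add: c_def)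
  qed
  ultimately show ?thesis
    unfolding canonical_set_def Let_def sum_r by (auto simp: ring_mat_simps)
qed

lemma normal_form_orbit:
  fixes x :: "'a::field mat"
  assumes "normalizes 0 x g g' h h' y"
  shows "\<exists>k\<in>Borel_subgroup n. Ad n k x \<in> canonical_set r"
proof -
  have cg: "conjugates n g g' x y" and ys: "\<forall>a<n. \<forall>b<n. y $$ (a, b) \<noteq> 0 \<longleftrightarrow> normal_supp 0 a b" and up: "upper g"
    using assms by (auto simp: normalizes_def)
  have yc: "y \<in> carrier_mat n n" using cg by (simp add: conjugates_def)
  have rig: "a < n" "b < n" "normal_supp 0 a b" if "(a, b) \<in> unit_positions" for a b
  proof -
    show Y: "normal_supp 0 a b" using that by (simp add: unit_positions_def)
    show "b < n" using normal_supp_props[OF Y] piv_props(1) by auto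
    then show "a < n" using normal_supp_props[OF Y] by simp
  qed
  have "y $$ (a, b) \<noteq> 0" if "(a, b) \<in> unit_positions" for a b using rig[OF that] ys by simp
  then have "\<forall>e\<in>unit_positions. y $$ e \<noteq> 0" by auto
  with unit_positions_solvable[where 'a = 'a]
  have "\<exists>\<tau> :: nat \<Rightarrow> 'a. (\<forall>v. \<tau> v \<noteq> 0) \<and> (\<forall>(a, b)\<in>unit_positions. \<tau> a * y $$ (a, b) = \<tau> b)"
    unfolding torus_solvable_def by simp
  then obtain \<tau> :: "nat \<Rightarrow> 'a" where \<tau>: "\<forall>v. \<tau> v \<noteq> 0" "\<forall>(a, b)\<in>unit_positions. \<tau> a * y $$ (a, b) = \<tau> b"
    by (elim exE conjE)
  let ?D = "diagonal n \<tau>" and ?D' = "diagonal n (\<lambda>v. inverse (\<tau> v))"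
  let ?z = "mat n n (\<lambda>(a, b). \<tau> a * y $$ (a, b) / \<tau> b)"
  have cz: "conjugates n (?D * g) (g' * ?D') x ?z"
    by (rule conjugates_trans[OF cg diagonal_conjugates[OF _ yc]]) (use \<tau> in auto)
  have c: "?D * g \<in> carrier_mat n n" "g' * ?D' \<in> carrier_mat n n" "?D * g * (g' * ?D') = 1\<^sub>m n"
    "g' * ?D' * (?D * g) = 1\<^sub>m n" "?D * g * x = ?z * (?D * g)"
    using cz by (auto simp: conjugates_def)
  note inv = inv_ring_mat[OF c(1-4)]
  have "upper ?D" by (auto simp: upper_def supp_in_def diagonal_def)
  then have "upper (?D * g)" using up by (rule upper_mult)
  then have "upper_triangular (?D * g)"
    unfolding upper_triangular_def upper_def supp_in_def by (metis carrier_matD(1) leD less_trans)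
  then have B: "?D * g \<in> Borel_subgroup n" using inv(1) by (simp add: Borel_subgroup_def)
  have "Ad n (?D * g) x = ?z * (?D * g) * (g' * ?D')" unfolding Ad_def inv(2) c(5) ..
  also have "\<dots> = ?z * (?D * g * (g' * ?D'))" by (rule assoc_mult_mat) (use c in auto)
  also have "\<dots> = ?z" unfolding c(3) by (rule right_mult_one_mat[of _ n]) simp
  finally have Ad: "Ad n (?D * g) x = ?z" .
  have "?z \<in> canonical_set r"
  proof (rule canonical_set_member)
    show "?z $$ (a, b) \<noteq> 0 \<longleftrightarrow> normal_supp 0 a b" if "a < n" "b < n" for a b
      using that \<tau>(1) ys by simp
    show "?z $$ (a, b) = 1" if "(a, b) \<in> unit_positions" for a b
      using rig[OF that] \<tau> that by auto
  qed simp
  then show ?thesis using B Ad by (intro bexI[of _ "?D * g"]) simp_all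
qed

end

theorem theorem4p1:
  fixes r :: "nat list" and n :: nat
  assumes "sum_list r = n" and "\<forall>m\<in>set r. 0 < m"
  shows "\<exists>U :: 'a::{alg_closed_field, field_char_0} mat set.
           U \<noteq> {} \<and> zariski_open_in n (nilradical r) U \<and>
           (\<forall>x\<in>U. \<exists>g\<in>Borel_subgroup n. Ad n g x \<in> canonical_set r)"
proof -
  interpret composition r n by unfold_locales (use assms in auto)
  obtain x\<^sub>0 g g' h h' where gn: "generically_normal 0 (x\<^sub>0 :: 'a mat) g g' h h'"
    using generic_normal_form[where 'a = 'a] by blast
  have V: "lower_rows 0 = (nilradical r :: 'a mat set)" by (auto simp: lower_rows_def nilradical_iff)
  obtain q where q: "q \<in> poly_funs n" "q x\<^sub>0 \<noteq> 0"
    "\<forall>x\<in>nilradical r. q x \<noteq> 0 \<longrightarrow> (\<exists>y. normalizes 0 x (g x) (g' x) (h x) (h' x) y)"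
    using gn unfolding generically_normal_def near_def V by blast
  have x0: "x\<^sub>0 \<in> nilradical r" using gn by (simp add: generically_normal_def V)
  show ?thesis
  proof (intro exI[of _ "{x \<in> nilradical r. q x \<noteq> 0}"] conjI ballI)
    show "{x \<in> nilradical r. q x \<noteq> 0} \<noteq> {}" using x0 q by blast
    show "zariski_open_in n (nilradical r) {x \<in> nilradical r. q x \<noteq> 0}"
      unfolding zariski_open_in_def using q(1) by (intro conjI exI[of _ "{q}"]) auto
    fix x assume "x \<in> {x \<in> nilradical r. q x \<noteq> 0}"
    then show "\<exists>g\<in>Borel_subgroup n. Ad n g x \<in> canonical_set r" using q(3) normal_form_orbit by blast
  qed
qed

end
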